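(* Every tuple in the (real or complex) Hilbert space, viewed as a metric structure $H$, is homogeneously isolated. In particular, every homomorphism $\Phi:O(\ell_2)\to K$ or $\Phi:U(\ell_2)\to K$ into a separable topological group $K$ with a left-invariant, complete (compatible) metric is trivial.
   Context: The real Hilbert space is treated as a two-sorted metric structure $H$ whose first sort is the real separable infinite-dimensional Hilbert space $\ell_2$ (with the norm metric) and whose second sort is the real line with the field structure (including the inverse function $x\mapsto x^{-1}$ on non-zero elements, sending $0$ to $0$, and $x\mapsto -x$) and constants for the rationals. The language also contains the constant $0$ for the zero vector, vector addition $+$, the inner product $\langle\cdot,\cdot\rangle:\ell_2\times\ell_2\to\mathbb{R}$, and multiplication by scalars $\mathbb{R}\times\ell_2\to\ell_2$. Then $\mathrm{Aut}(H)$ (bijections of the first sort preserving the structure) is the orthogonal group $O(\ell_2)$ of all invertible linear inner-product-preserving transformations. The complex Hilbert space is defined as a metric structure analogously, and then $\mathrm{Aut}(H)$ is the unitary group $U(\ell_2)$. Both groups carry the topology of pointwise convergence. Tuples are finite. The quantifier-free type $\mathrm{qftp}(\bar a)$ of a tuple $\bar a$ in the first sort is the set of quantifier-free formulas it satisfies, where elements of the second sort may be used as constants; for $p=\mathrm{qftp}(\bar a)$ and $Y\subseteq H$, $p(Y)$ is the set of tuples of elements of $Y$ realizing $p$. A metric structure is homogeneous if every partial isomorphism between its finitely generated substructures extends to an automorphism of it. $S_\infty$ is the group of all permutations of $\mathbb{N}$. A tuple $\bar a$ in a homogeneous metric structure $X$, with $p=\mathrm{qftp}(\bar a)$ and $G=\mathrm{Aut}(X)$,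 is homogeneously isolated if there exist $X_k\subseteq X$ and $\bar a_k\in p(X_k)$, $k\in\mathbb{N}$, such that: (1) each $X_k$ is a homogeneous substructure of $X$; (2) for all $\phi_l\in\mathrm{Aut}(X_l)$, $l\in\mathbb{N}$, there exists $\phi\in\mathrm{Aut}(X)$ that extends each $\phi_l$; (3) there exists an injective group homomorphism $e:S_\infty\to G$ such that for every $\sigma\in S_\infty$ and $k,l\in\mathbb{N}$, $\sigma(k)=l\Leftrightarrow e(\sigma)[X_k]=X_l$. *)

theory Defs
  imports "HOL-Analysis.Analysis" "HOL-Algebra.Bij"
begin

section \<open>Hilbert space as a two-sorted metric structure\<close>

text \<open>
  The second sort is the whole scalar field \<open>'s\<close>; it is never moved (by isomorphisms) nor shrunk
  (in substructures). Isabelle's \<^const>\<open>inverse\<close> already satisfies \<^prop>\<open>inverse 0 = (0::'s::field)\<close>.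
  The metric takes values in the second sort.
\<close>

record ('v, 's) hilbert_structure =
  vecs :: "'v set"
  vzero :: 'v
  vadd :: "'v \<Rightarrow> 'v \<Rightarrow> 'v"
  vscale :: "'s \<Rightarrow> 'v \<Rightarrow> 'v"
  vinner :: "'v \<Rightarrow> 'v \<Rightarrow> 's"
  vdist :: "'v \<Rightarrow> 'v \<Rightarrow> 's"

subsection \<open>Quantifier-free formulas and types\<close>

text \<open>
  All elements of the second sort serve as constants (\<open>SConst\<close>), which covers in particular the
  constants for the rationals. Variables range over the first sort; \<open>VVar i\<close> is the \<open>i\<close>-th entry
  of the tuple.
\<close>

datatype 's vec_term =
    VVar nat
  | VZero
  | VAdd "'s vec_term" "'s vec_term"
  | VScale "'s scal_term" "'s vec_term"
and 's scal_term =
    SConst 's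
  | SAdd "'s scal_term" "'s scal_term"
  | SMult "'s scal_term" "'s scal_term"
  | SMinus "'s scal_term"
  | SInv "'s scal_term"
  | SInner "'s vec_term" "'s vec_term"
  | SDist "'s vec_term" "'s vec_term"

datatype 's qf_formula =
    VEq "'s vec_term" "'s vec_term"
  | SEq "'s scal_term" "'s scal_term"
  | Neg "'s qf_formula"
  | And "'s qf_formula" "'s qf_formula"
  | Or "'s qf_formula" "'s qf_formula"

primrec vec_vars :: "'s vec_term \<Rightarrow> nat set" and scal_vars :: "'s scal_term \<Rightarrow> nat set" where
  "vec_vars (VVar i) = {i}"
| "vec_vars VZero = {}"
| "vec_vars (VAdd s t) = vec_vars s \<union> vec_vars t"
| "vec_vars (VScale r t) = scal_vars r \<union> vec_vars t"
| "scal_vars (SConst c) = {}"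
| "scal_vars (SAdd r s) = scal_vars r \<union> scal_vars s"
| "scal_vars (SMult r s) = scal_vars r \<union> scal_vars s"
| "scal_vars (SMinus r) = scal_vars r"
| "scal_vars (SInv r) = scal_vars r"
| "scal_vars (SInner s t) = vec_vars s \<union> vec_vars t"
| "scal_vars (SDist s t) = vec_vars s \<union> vec_vars t"

primrec qf_vars :: "'s qf_formula \<Rightarrow> nat set" where
  "qf_vars (VEq s t) = vec_vars s \<union> vec_vars t"
| "qf_vars (SEq r s) = scal_vars r \<union> scal_vars s"
| "qf_vars (Neg \<phi>) = qf_vars \<phi>"
| "qf_vars (And \<phi> \<psi>) = qf_vars \<phi> \<union> qf_vars \<psi>"
| "qf_vars (Or \<phi> \<psi>) = qf_vars \<phi> \<union> qf_vars \<psi>"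

primrec vec_val :: "('v, 's::field) hilbert_structure \<Rightarrow> 'v list \<Rightarrow> 's vec_term \<Rightarrow> 'v"
  and scal_val :: "('v, 's::field) hilbert_structure \<Rightarrow> 'v list \<Rightarrow> 's scal_term \<Rightarrow> 's" where
  "vec_val X a (VVar i) = a ! i"
| "vec_val X a VZero = vzero X"
| "vec_val X a (VAdd s t) = vadd X (vec_val X a s) (vec_val X a t)"
| "vec_val X a (VScale r t) = vscale X (scal_val X a r) (vec_val X a t)"
| "scal_val X a (SConst c) = c"
| "scal_val X a (SAdd r s) = scal_val X a r + scal_val X a s"
| "scal_val X a (SMult r s) = scal_val X a r * scal_val X a s"
| "scal_val X a (SMinus r) = - scal_val X a r"
| "scal_val X a (SInv r) = inverse (scal_val X a r)"
| "scal_val X a (SInner s t) = vinner X (vec_val X a s) (vec_val X a t)"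
| "scal_val X a (SDist s t) = vdist X (vec_val X a s) (vec_val X a t)"

primrec qf_sat :: "('v, 's::field) hilbert_structure \<Rightarrow> 'v list \<Rightarrow> 's qf_formula \<Rightarrow> bool" where
  "qf_sat X a (VEq s t) \<longleftrightarrow> vec_val X a s = vec_val X a t"
| "qf_sat X a (SEq r s) \<longleftrightarrow> scal_val X a r = scal_val X a s"
| "qf_sat X a (Neg \<phi>) \<longleftrightarrow> \<not> qf_sat X a \<phi>"
| "qf_sat X a (And \<phi> \<psi>) \<longleftrightarrow> qf_sat X a \<phi> \<and> qf_sat X a \<psi>"
| "qf_sat X a (Or \<phi> \<psi>) \<longleftrightarrow> qf_sat X a \<phi> \<or> qf_sat X a \<psi>"

definition qftp :: "('v, 's::field) hilbert_structure \<Rightarrow> 'v list \<Rightarrow> 's qf_formula set" where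
  "qftp X a = {\<phi>. qf_vars \<phi> \<subseteq> {..<length a} \<and> qf_sat X a \<phi>}"

text \<open>The length \<open>n\<close> of the tuples is passed separately: it is not determined by the set \<open>p\<close> as such.\<close>

definition realizations ::
    "('v, 's::field) hilbert_structure \<Rightarrow> nat \<Rightarrow> 's qf_formula set \<Rightarrow> 'v set \<Rightarrow> 'v list set" where
  "realizations X n p Y = {b. length b = n \<and> set b \<subseteq> Y \<and> (\<forall>\<phi>\<in>p. qf_sat X b \<phi>)}"

subsection \<open>Substructures, isomorphisms, homogeneity\<close>

definition substructure :: "('v, 's) hilbert_structure \<Rightarrow> 'v set \<Rightarrow> bool" where
  "substructure X Y \<longleftrightarrow> Y \<subseteq> vecs X \<and> vzero X \<in> Y \<and>
     (\<forall>x\<in>Y. \<forall>y\<in>Y. vadd X x y \<in> Y) \<and> (\<forall>c. \<forall>x\<in>Y. vscale X c x \<in> Y)"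

abbreviation restrict_structure ::
    "('v, 's) hilbert_structure \<Rightarrow> 'v set \<Rightarrow> ('v, 's) hilbert_structure" where
  "restrict_structure X Y \<equiv> X\<lparr>vecs := Y\<rparr>"

definition finitely_generated :: "('v, 's) hilbert_structure \<Rightarrow> 'v set \<Rightarrow> bool" where
  "finitely_generated X Y \<longleftrightarrow> (\<exists>A. finite A \<and> A \<subseteq> vecs X \<and> Y = substructure X hull A)"

definition isomorphism ::
    "('v, 's) hilbert_structure \<Rightarrow> 'v set \<Rightarrow> 'v set \<Rightarrow> ('v \<Rightarrow> 'v) \<Rightarrow> bool" where
  "isomorphism X Y Z f \<longleftrightarrow> bij_betw f Y Z \<and> f (vzero X) = vzero X \<and>
     (\<forall>x\<in>Y. \<forall>y\<in>Y. f (vadd X x y) = vadd X (f x) (f y)) \<and>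
     (\<forall>c. \<forall>x\<in>Y. f (vscale X c x) = vscale X c (f x)) \<and>
     (\<forall>x\<in>Y. \<forall>y\<in>Y. vinner X (f x) (f y) = vinner X x y) \<and>
     (\<forall>x\<in>Y. \<forall>y\<in>Y. vdist X (f x) (f y) = vdist X x y)"

definition Aut :: "('v, 's) hilbert_structure \<Rightarrow> ('v \<Rightarrow> 'v) monoid" where
  "Aut X = (BijGroup (vecs X))
     \<lparr>carrier := {f \<in> Bij (vecs X). isomorphism X (vecs X) (vecs X) f}\<rparr>"

definition homogeneous :: "('v, 's) hilbert_structure \<Rightarrow> bool" where
  "homogeneous X \<longleftrightarrow>
     (\<forall>Y Z f. finitely_generated X Y \<and> finitely_generated X Z \<and> isomorphism X Y Z f \<longrightarrow>
        (\<exists>g\<in>carrier (Aut X). \<forall>x\<in>Y. g x = f x))"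

definition homogeneously_isolated ::
    "('v, 's::field) hilbert_structure \<Rightarrow> 'v list \<Rightarrow> bool" where
  "homogeneously_isolated X a \<longleftrightarrow>
     homogeneous X \<and> set a \<subseteq> vecs X \<and>
     (\<exists>(Y :: nat \<Rightarrow> 'v set) (b :: nat \<Rightarrow> 'v list).
        (\<forall>k. b k \<in> realizations X (length a) (qftp X a) (Y k)) \<and>
        (\<forall>k. substructure X (Y k) \<and> homogeneous (restrict_structure X (Y k))) \<and>
        (\<forall>\<phi> :: nat \<Rightarrow> 'v \<Rightarrow> 'v.
           (\<forall>l. \<phi> l \<in> carrier (Aut (restrict_structure X (Y l)))) \<longrightarrow>
           (\<exists>\<psi>\<in>carrier (Aut X). \<forall>l. \<forall>x\<in>Y l. \<psi> x = \<phi> l x)) \<and>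
        (\<exists>e\<in>hom (BijGroup (UNIV :: nat set)) (Aut X).
           inj_on e (carrier (BijGroup UNIV)) \<and>
           (\<forall>\<sigma>\<in>carrier (BijGroup UNIV). \<forall>k l. \<sigma> k = l \<longleftrightarrow> e \<sigma> ` Y k = Y l)))"

section \<open>The real and the complex Hilbert space\<close>

definition ell2 :: "(nat \<Rightarrow> 's::real_normed_field) set" where
  "ell2 = {x. summable (\<lambda>n. (norm (x n))\<^sup>2)}"

text \<open>The parameter \<open>cj\<close> is the conjugation of the scalar field.\<close>

definition ell2_structure ::
    "('s \<Rightarrow> 's) \<Rightarrow> (nat \<Rightarrow> 's::real_normed_field, 's) hilbert_structure" where
  "ell2_structure cj = \<lparr>
     vecs = ell2,
     vzero = (\<lambda>n. 0),
     vadd = (\<lambda>x y n. x n + y n),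
     vscale = (\<lambda>c x n. c * x n),
     vinner = (\<lambda>x y. \<Sum>n. x n * cj (y n)),
     vdist = (\<lambda>x y. of_real (sqrt (\<Sum>n. (norm (x n - y n))\<^sup>2)))\<rparr>"

definition real_hilbert :: "(nat \<Rightarrow> real, real) hilbert_structure" where
  "real_hilbert = ell2_structure (\<lambda>x. x)"

definition complex_hilbert :: "(nat \<Rightarrow> complex, complex) hilbert_structure" where
  "complex_hilbert = ell2_structure cnj"

text \<open>
  The invertible linear transformations preserving the inner product: for
  \<^const>\<open>real_hilbert\<close> this is \<open>O(\<ell>\<^sub>2)\<close>, for \<^const>\<open>complex_hilbert\<close> it is \<open>U(\<ell>\<^sub>2)\<close>.
\<close>

definition inner_preserving_group :: "('v, 's) hilbert_structure \<Rightarrow> ('v \<Rightarrow> 'v) monoid" where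
  "inner_preserving_group X = (BijGroup (vecs X))
     \<lparr>carrier := {f \<in> Bij (vecs X).
        (\<forall>x\<in>vecs X. \<forall>y\<in>vecs X. f (vadd X x y) = vadd X (f x) (f y)) \<and>
        (\<forall>c. \<forall>x\<in>vecs X. f (vscale X c x) = vscale X c (f x)) \<and>
        (\<forall>x\<in>vecs X. \<forall>y\<in>vecs X. vinner X (f x) (f y) = vinner X x y)}\<rparr>"

definition orthogonal_group :: "((nat \<Rightarrow> real) \<Rightarrow> (nat \<Rightarrow> real)) monoid" where
  "orthogonal_group = inner_preserving_group real_hilbert"

definition unitary_group :: "((nat \<Rightarrow> complex) \<Rightarrow> (nat \<Rightarrow> complex)) monoid" where
  "unitary_group = inner_preserving_group complex_hilbert"

lemma ell2_vadd:
  assumes "x \<in> ell2" "y \<in> ell2"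
  shows "(\<lambda>n. x n + y n) \<in> ell2"
proof -
  have "summable (\<lambda>n. 2 * (norm (x n))\<^sup>2 + 2 * (norm (y n))\<^sup>2)"
    using assms by (auto simp: ell2_def intro!: summable_add summable_mult)
  moreover have "(norm (x n + y n))\<^sup>2 \<le> 2 * (norm (x n))\<^sup>2 + 2 * (norm (y n))\<^sup>2" for n
  proof -
    have "(norm (x n + y n))\<^sup>2 \<le> (norm (x n) + norm (y n))\<^sup>2"
      by (simp add: norm_triangle_ineq power_mono)
    also have "\<dots> \<le> 2 * (norm (x n))\<^sup>2 + 2 * (norm (y n))\<^sup>2"
      using sum_squares_bound[of "norm (x n)" "norm (y n)"] by (simp add: power2_sum)
    finally show ?thesis .
  qed
  ultimately show ?thesis
    by (auto simp: ell2_def intro: summable_comparison_test')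
qed

lemma ell2_vscale: "x \<in> ell2 \<Longrightarrow> (\<lambda>n. c * x n) \<in> ell2"
  by (auto simp: ell2_def norm_mult power_mult_distrib intro!: summable_mult)

lemma ell2_zero: "(\<lambda>n. 0) \<in> ell2"
  by (simp add: ell2_def)

lemma substructure_ell2: "substructure (ell2_structure cj) (vecs (ell2_structure cj))"
  by (auto simp: substructure_def ell2_structure_def ell2_vadd ell2_vscale ell2_zero)

lemma Aut_ell2_structure:
  fixes cj :: "'s::real_normed_field \<Rightarrow> 's"
  assumes cj: "\<And>z. z * cj z = of_real ((norm z)\<^sup>2)"
  shows "Aut (ell2_structure cj) = inner_preserving_group (ell2_structure cj)"
proof -
  let ?H = "ell2_structure cj"
  have norm_inner: "(\<Sum>n. x n * cj (x n)) = of_real (\<Sum>n. (norm (x n))\<^sup>2)"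
    if "x \<in> ell2" for x :: "nat \<Rightarrow> 's"
    using that by (simp add: cj suminf_of_real ell2_def)
  have "isomorphism ?H ell2 ell2 f"
    if f: "bij_betw f ell2 ell2"
      and add: "\<And>x y. x \<in> ell2 \<Longrightarrow> y \<in> ell2 \<Longrightarrow> f (\<lambda>n. x n + y n) = (\<lambda>n. f x n + f y n)"
      and scale: "\<And>c x. x \<in> ell2 \<Longrightarrow> f (\<lambda>n. c * x n) = (\<lambda>n. c * f x n)"
      and inner: "\<And>x y. x \<in> ell2 \<Longrightarrow> y \<in> ell2 \<Longrightarrow>
        (\<Sum>n. f x n * cj (f y n)) = (\<Sum>n. x n * cj (y n))"
    for f
  proof -
    have fz: "f (\<lambda>n. 0) = (\<lambda>n. 0)"
      using scale[OF ell2_zero, of 0] by simp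
    have dist: "(\<Sum>n. (norm (f x n - f y n))\<^sup>2) = (\<Sum>n. (norm (x n - y n))\<^sup>2)"
      if x: "x \<in> ell2" and y: "y \<in> ell2" for x y
    proof -
      let ?z = "\<lambda>n. x n + (- 1) * y n"
      have z: "?z \<in> ell2"
        by (intro ell2_vadd ell2_vscale x y)
      have fzz: "f ?z = (\<lambda>n. f x n + (- 1) * f y n)"
        using add[OF x ell2_vscale[OF y, of "- 1"]] scale[OF y, of "- 1"] by simp
      have "f ?z \<in> ell2"
        using z f by (auto simp: bij_betw_def)
      hence "of_real (\<Sum>n. (norm (f ?z n))\<^sup>2) = (of_real (\<Sum>n. (norm (?z n))\<^sup>2) :: 's)"
        using inner[OF z z] norm_inner[OF z] norm_inner[of "f ?z"] by simp
      hence "(\<Sum>n. (norm (f ?z n))\<^sup>2) = (\<Sum>n. (norm (?z n))\<^sup>2)"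
        by (simp only: of_real_eq_iff)
      thus ?thesis unfolding fzz by simp
    qed
    show ?thesis
      using f add scale inner fz dist by (simp add: isomorphism_def ell2_structure_def)
  qed
  hence "{f \<in> Bij (vecs ?H). isomorphism ?H (vecs ?H) (vecs ?H) f} =
    carrier (inner_preserving_group ?H)"
    by (auto simp: inner_preserving_group_def Bij_def isomorphism_def ell2_structure_def)
  thus ?thesis
    by (simp add: Aut_def inner_preserving_group_def)
qed

lemma Aut_real_hilbert: "Aut real_hilbert = orthogonal_group"
  by (simp add: real_hilbert_def orthogonal_group_def Aut_ell2_structure power2_eq_square)

lemma Aut_complex_hilbert: "Aut complex_hilbert = unitary_group"
  unfolding complex_hilbert_def unitary_group_def
  by (intro Aut_ell2_structure) (simp only: complex_norm_square)

section \<open>Topological groups\<close>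

definition topological_group :: "'k monoid \<Rightarrow> 'k topology \<Rightarrow> bool" where
  "topological_group K T \<longleftrightarrow> group K \<and> topspace T = carrier K \<and>
     continuous_map (prod_topology T T) T (\<lambda>(x, y). x \<otimes>\<^bsub>K\<^esub> y) \<and>
     continuous_map T T (\<lambda>x. inv\<^bsub>K\<^esub> x)"

definition has_complete_left_invariant_metric :: "'k monoid \<Rightarrow> 'k topology \<Rightarrow> bool" where
  "has_complete_left_invariant_metric K T \<longleftrightarrow>
     (\<exists>d. Metric_space (carrier K) d \<and>
        Metric_space.mtopology (carrier K) d = T \<and>
        Metric_space.mcomplete (carrier K) d \<and>
        (\<forall>g\<in>carrier K. \<forall>x\<in>carrier K. \<forall>y\<in>carrier K. d (g \<otimes>\<^bsub>K\<^esub> x) (g \<otimes>\<^bsub>K\<^esub> y) = d x y))"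

end

theory Submission
  imports Defs "HOL-Library.Function_Algebras"
begin

text \<open>
  \<^bold>\<open>Isolation.\<close> Identify \<open>\<nat>\<close> with \<open>\<nat> \<times> \<nat>\<close>. This splits \<open>\<ell>\<^sub>2\<close> into an orthogonal sum of blocks
  \<open>X\<^sub>k\<close>, each an isometric copy of \<open>\<ell>\<^sub>2\<close>. The copy of a tuple in \<open>X\<^sub>k\<close> has the same quantifier-free
  type as the tuple, any sequence of automorphisms of the blocks is the restriction of their direct
  sum (\<open>block_automorphisms_amalgamate\<close>), and permutations of \<open>\<nat>\<close> act by permuting the blocks.
  Homogeneity holds for every subspace at once (\<open>homogeneous_restrict\<close>): a finite partial isometry
  is extended one vector at a time, the correction needed at each step being a reflection, or in
  the complex case a rotation in a single complex direction.

  \<^bold>\<open>Triviality.\<close> Let \<open>\<Phi>\<close> be a homomorphism into a separable group \<open>K\<close> with a complete left-invariant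
  metric. Composed with the permutations of the blocks it gives a homomorphism \<open>\<Psi>\<close> of the
  permutation group of \<open>\<nat>\<close>, and the heart of the matter is that \<open>\<Psi>\<close> kills every involution that
  moves infinitely many points and fixes infinitely many (\<open>hom_kills_moiety_involution\<close>). All such
  involutions are conjugate. By separability and a diagonal argument there are infinite sets
  \<open>B\<^sub>0 \<supseteq> B\<^sub>1 \<supseteq> \<dots>\<close> such that all such involutions \<^emph>\<open>inside\<close> \<open>B\<^sub>n\<close>, and enough permutations
  to conjugate them into each other, are sent \<open>2\<^sup>-\<^sup>n\<close>-close to the identity. Take an involution
  \<open>J\<^sub>n\<close> inside each \<open>B\<^sub>n\<close> and let \<open>h\<^sub>n\<close>, with image close to the identity, conjugate \<open>J\<^sub>n\<close> to \<open>J\<^sub>n\<^sub>+\<^sub>1\<close>.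
  Left invariance makes the products \<open>\<Psi>(h\<^sub>0 \<cdots> h\<^sub>n)\<close> a Cauchy sequence; completeness gives a limit \<open>x\<close>.
  Since \<open>\<Psi>(J\<^sub>0)\<close> is conjugate by these products to \<open>\<Psi>(J\<^sub>n) \<rightarrow> 1\<close>, it satisfies \<open>\<Psi>(J\<^sub>0) x = x\<close>.

  So \<open>\<Phi>\<close> kills the corresponding permutations of blocks, hence their products. Such a product
  \<open>S\<close> can shift infinitely many blocks, and an isometry \<open>g\<close> acting on one block only is the commutator
  of \<open>S\<close> with the isometry acting as \<open>g\<close> on each block of a forward half of the orbit; so \<open>\<Phi>(g) = 1\<close>
  (\<open>one_block_in_kernel\<close>). Any isometry fixing an infinite orthonormal sequence is conjugate to one
  acting on one block only, because the sequence extends to an orthonormal basis. Finally, every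
  isometry \<open>g\<close> is a product of two isometries fixing an infinite orthonormal sequence
  (\<open>unitary_in_kernel\<close>): choose orthonormal vectors \<open>x\<^sub>i\<close> with the subspaces spanned by \<open>x\<^sub>i\<close> and \<open>g x\<^sub>i\<close>
  mutually orthogonal, and undo \<open>g\<close> on infinitely many of the \<open>x\<^sub>i\<close> by an isometry that acts in these subspaces
  only and leaves infinitely many of the others alone.
\<close>

section \<open>Permutations of the natural numbers\<close>

abbreviation Sym_nat :: "(nat \<Rightarrow> nat) monoid" where
  "Sym_nat \<equiv> BijGroup UNIV"

lemma carrier_Sym_nat: "\<pi> \<in> carrier Sym_nat \<longleftrightarrow> bij \<pi>"
  by (simp add: BijGroup_def Bij_def)

lemma mult_Sym_nat: "bij \<pi> \<Longrightarrow> bij \<rho> \<Longrightarrow> \<pi> \<otimes>\<^bsub>Sym_nat\<^esub> \<rho> = \<pi> \<circ> \<rho>"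
  by (simp add: BijGroup_def Bij_def compose_def fun_eq_iff)

text \<open>
  A moiety is an infinite set with infinite complement; the set of points moved is one.
\<close>

definition moiety_involution :: "(nat \<Rightarrow> nat) \<Rightarrow> bool" where
  "moiety_involution \<tau> \<longleftrightarrow>
     (\<forall>n. \<tau> (\<tau> n) = n) \<and> infinite {n. \<tau> n \<noteq> n} \<and> infinite {n. \<tau> n = n}"

lemma moiety_involution_bij: "moiety_involution \<tau> \<Longrightarrow> bij \<tau>"
  by (auto simp: moiety_involution_def intro!: o_bij[of \<tau> \<tau>])

lemma moiety_involution_inv: "moiety_involution \<tau> \<Longrightarrow> inv_into UNIV \<tau> = \<tau>"
  by (rule inv_unique_comp) (auto simp: moiety_involution_def)

definition std_involution :: "nat \<Rightarrow> nat" where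
  "std_involution n = (if n mod 3 = 0 then n + 1 else if n mod 3 = 1 then n - 1 else n)"

lemma infinite_residue_class: "r < 3 \<Longrightarrow> infinite {n::nat. n mod 3 = r}"
proof -
  assume "r < 3"
  hence "range (\<lambda>n. 3 * n + r) \<subseteq> {n. n mod 3 = r}"
    by auto
  moreover have "infinite (range (\<lambda>n. 3 * n + r))"
    by (rule range_inj_infinite) (auto simp: inj_on_def)
  ultimately show ?thesis
    using finite_subset by blast
qed

lemma moiety_involution_std: "moiety_involution std_involution"
proof -
  have "std_involution (std_involution n) = n" for n
  proof -
    consider "n mod 3 = 0" | "n mod 3 = 1" | "n mod 3 = 2"
      by linarith
    thus ?thesis
    proof cases
      case 1
      hence "(n + 1) mod 3 = 1" by presburger
      with 1 show ?thesis by (simp add: std_involution_def)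
    next
      case 2
      hence "(n - 1) mod 3 = 0" "n \<ge> 1" by presburger+
      with 2 show ?thesis by (simp add: std_involution_def)
    qed (simp add: std_involution_def)
  qed
  moreover have "infinite {n. std_involution n \<noteq> n}"
    by (rule infinite_super[OF _ infinite_residue_class[of 0]]) (auto simp: std_involution_def)
  moreover have "infinite {n. std_involution n = n}"
    by (rule infinite_super[OF _ infinite_residue_class[of 2]]) (auto simp: std_involution_def)
  ultimately show ?thesis
    by (simp add: moiety_involution_def)
qed

text \<open>
  Enumerate the smaller elements of the two-element orbits and the fixed points; the conjugating
  permutation matches them with the residue classes 0 and 2 modulo 3.
\<close>

lemma moiety_involution_conj_std:
  assumes "moiety_involution \<tau>"
  shows "\<exists>\<pi>. bij \<pi> \<and> (\<forall>n. \<pi> (std_involution n) = \<tau> (\<pi> n))"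
proof -
  have invol: "\<tau> (\<tau> n) = n" for n
    using assms by (simp add: moiety_involution_def)
  define T where "T = {n. n < \<tau> n}"
  define F where "F = {n. \<tau> n = n}"
  have "{n. \<tau> n \<noteq> n} \<subseteq> T \<union> \<tau> ` T"
  proof
    fix n assume "n \<in> {n. \<tau> n \<noteq> n}"
    hence "n < \<tau> n \<or> \<tau> n < \<tau> (\<tau> n)" by (auto simp: invol)
    thus "n \<in> T \<union> \<tau> ` T"
      by (metis T_def UnI1 UnI2 image_eqI invol mem_Collect_eq)
  qed
  moreover have "infinite {n. \<tau> n \<noteq> n}"
    using assms by (simp add: moiety_involution_def)
  ultimately have "infinite T"
    by (meson finite_Un finite_imageI finite_subset)
  then obtain t where t: "bij_betw t (UNIV::nat set) T"
    using bij_enumerate by blast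
  have "infinite F"
    using assms by (simp add: moiety_involution_def F_def)
  then obtain f where f: "bij_betw f (UNIV::nat set) F"
    using bij_enumerate by blast
  have tT: "t i < \<tau> (t i)" for i using t by (auto simp: bij_betw_def T_def)
  have fF: "\<tau> (f i) = f i" for i using f by (auto simp: bij_betw_def F_def)
  define \<pi> where "\<pi> n = (if n mod 3 = 0 then t (n div 3)
    else if n mod 3 = 1 then \<tau> (t (n div 3)) else f (n div 3))" for n :: nat
  have comm: "\<pi> (std_involution n) = \<tau> (\<pi> n)" for n
  proof -
    consider "n mod 3 = 0" | "n mod 3 = 1" | "n mod 3 = 2"
      by linarith
    thus ?thesis
    proof cases
      case 1
      hence "(n + 1) mod 3 = 1" "(n + 1) div 3 = n div 3" by presburger+
      with 1 show ?thesis by (simp add: std_involution_def \<pi>_def)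
    next
      case 2
      hence "(n - 1) mod 3 = 0" "(n - 1) div 3 = n div 3" by presburger+
      with 2 show ?thesis by (simp add: std_involution_def \<pi>_def invol)
    qed (simp add: std_involution_def \<pi>_def fF)
  qed
  have "inj \<pi>"
  proof (rule injI)
    fix m n assume eq: "\<pi> m = \<pi> n"
    have lt: "\<pi> k < \<tau> (\<pi> k) \<longleftrightarrow> k mod 3 = 0" "\<tau> (\<pi> k) < \<pi> k \<longleftrightarrow> k mod 3 = 1" for k
      using tT[of "k div 3"] fF[of "k div 3"] by (auto simp: \<pi>_def invol)
    have mod: "m mod 3 = n mod 3"
      using lt[of m] lt[of n] eq by (cases "n mod 3 = 0"; cases "n mod 3 = 1") auto
    have "m div 3 = n div 3"
    proof -
      have "inj t" "inj f" using t f by (auto simp: bij_betw_def)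
      moreover have "inj \<tau>" by (metis injI invol)
      ultimately show ?thesis
        using eq mod by (auto simp: \<pi>_def inj_eq split: if_splits)
    qed
    with mod show "m = n" by (metis div_mult_mod_eq)
  qed
  moreover have "surj \<pi>"
  proof -
    have "\<exists>n. \<pi> n = m" for m
    proof -
      consider "m \<in> T" | "\<tau> m \<in> T" | "m \<in> F"
      proof -
        have "m < \<tau> m \<or> \<tau> m < m \<or> \<tau> m = m" by linarith
        thus ?thesis using that by (auto simp: T_def F_def invol)
      qed
      thus ?thesis
      proof cases
        case 1
        then obtain i where "t i = m" using t by (metis bij_betw_def imageE)
        hence "\<pi> (3 * i) = m" by (simp add: \<pi>_def)
        thus ?thesis ..
      next
        case 2
        then obtain i where "t i = \<tau> m" using t by (metis bij_betw_def imageE)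
        moreover have "(3 * i + 1) div 3 = i" by simp
        ultimately have "\<pi> (3 * i + 1) = m" by (simp add: \<pi>_def invol)
        thus ?thesis ..
      next
        case 3
        then obtain i where "f i = m" using f by (metis bij_betw_def imageE)
        moreover have "(3 * i + 2) mod 3 = 2" "(3 * i + 2) div 3 = i" by presburger+
        ultimately have "\<pi> (3 * i + 2) = m" by (simp add: \<pi>_def)
        thus ?thesis ..
      qed
    qed
    thus ?thesis by (metis surjI)
  qed
  ultimately show ?thesis
    using comm by (auto simp: bij_def)
qed

lemma moiety_involutions_conjugate:
  assumes "moiety_involution \<sigma>" "moiety_involution \<tau>"
  shows "\<exists>\<pi>. bij \<pi> \<and> \<pi> \<circ> \<sigma> = \<tau> \<circ> \<pi>"
proof -
  obtain \<alpha> where \<alpha>: "bij \<alpha>" "\<And>n. \<alpha> (std_involution n) = \<sigma> (\<alpha> n)"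
    using moiety_involution_conj_std[OF assms(1)] by blast
  obtain \<beta> where \<beta>: "bij \<beta>" "\<And>n. \<beta> (std_involution n) = \<tau> (\<beta> n)"
    using moiety_involution_conj_std[OF assms(2)] by blast
  define \<gamma> where "\<gamma> = inv_into UNIV \<alpha>"
  have \<gamma>: "bij \<gamma>" "\<And>n. \<gamma> (\<alpha> n) = n" "\<And>n. \<alpha> (\<gamma> n) = n"
    using \<alpha>(1) by (auto simp: \<gamma>_def bij_imp_bij_inv bij_is_inj bij_is_surj surj_f_inv_f)
  have "\<beta> (\<gamma> (\<sigma> n)) = \<tau> (\<beta> (\<gamma> n))" for n
    by (metis \<alpha>(2) \<beta>(2) \<gamma>(2,3))
  thus ?thesis
    using \<beta>(1) \<gamma>(1) by (intro exI[of _ "\<beta> \<circ> \<gamma>"]) (auto simp: bij_comp)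
qed

text \<open>
  The copy of \<open>\<pi>\<close> that acts on the range of an injective \<open>b\<close>. Parametrising infinite sets by injections
  turns a chain of nested sets into a chain of compositions, see \<open>lift_perm_lift_perm\<close>.
\<close>

definition lift_perm :: "(nat \<Rightarrow> nat) \<Rightarrow> (nat \<Rightarrow> nat) \<Rightarrow> nat \<Rightarrow> nat" where
  "lift_perm b \<pi> x = (if x \<in> range b then b (\<pi> (the_inv b x)) else x)"

lemma lift_perm_in: "inj b \<Longrightarrow> lift_perm b \<pi> (b n) = b (\<pi> n)"
  by (simp add: lift_perm_def the_inv_f_f)

lemma lift_perm_out: "x \<notin> range b \<Longrightarrow> lift_perm b \<pi> x = x"
  by (simp add: lift_perm_def)

lemma lift_perm_comp:
  assumes "inj b" shows "lift_perm b (\<pi> \<circ> \<rho>) = lift_perm b \<pi> \<circ> lift_perm b \<rho>"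
proof
  fix x show "lift_perm b (\<pi> \<circ> \<rho>) x = (lift_perm b \<pi> \<circ> lift_perm b \<rho>) x"
    by (cases "x \<in> range b") (auto simp: lift_perm_in lift_perm_out assms)
qed

lemma lift_perm_bij:
  assumes "inj b" "bij \<pi>" shows "bij (lift_perm b \<pi>)"
proof -
  have id: "lift_perm b id = id"
  proof
    fix x show "lift_perm b id x = id x"
      by (cases "x \<in> range b") (auto simp: lift_perm_in lift_perm_out assms)
  qed
  obtain \<rho> where "\<pi> \<circ> \<rho> = id" "\<rho> \<circ> \<pi> = id"
    using assms(2) by (metis bij_is_inj bij_is_surj inv_o_cancel surj_iff)
  thus ?thesis
    by (metis id assms(1) lift_perm_comp o_bij)
qed

lemma lift_perm_lift_perm:
  assumes "inj b" "inj c" shows "lift_perm b (lift_perm c \<pi>) = lift_perm (b \<circ> c) \<pi>"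
proof
  fix x
  have bc: "inj (b \<circ> c)" using assms by (simp add: inj_compose)
  consider n where "x = b (c n)" | n where "x = b n" "n \<notin> range c" | "x \<notin> range b"
    by auto
  thus "lift_perm b (lift_perm c \<pi>) x = lift_perm (b \<circ> c) \<pi> x"
  proof cases
    case (1 n)
    thus ?thesis
      using lift_perm_in[OF bc, of \<pi> n] by (simp add: assms lift_perm_in)
  next
    case (2 n)
    hence "x \<notin> range (b \<circ> c)" using assms by (auto simp: inj_eq)
    with 2 show ?thesis by (simp add: assms lift_perm_in lift_perm_out)
  next
    case 3
    hence "x \<notin> range (b \<circ> c)" by auto
    with 3 show ?thesis by (simp add: lift_perm_out)
  qed
qed

text \<open>
  A permutation that agrees with a copy of \<open>\<pi>\<close> on the range of \<open>b\<close> conjugates copies in the same way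
  as \<open>\<pi>\<close> conjugates the originals, whatever it does off the range: there the copies are the identity.
\<close>

lemma lift_perm_intertwine:
  assumes b: "inj b" and g: "bij g" and \<pi>: "bij \<pi>"
    and gb: "g \<circ> b = b \<circ> \<pi>" and conj: "\<pi> \<circ> \<sigma> = \<tau> \<circ> \<pi>"
  shows "g \<circ> lift_perm b \<sigma> = lift_perm b \<tau> \<circ> g"
proof
  have g_b: "g (b n) = b (\<pi> n)" for n using gb by (simp add: fun_eq_iff)
  fix x show "(g \<circ> lift_perm b \<sigma>) x = (lift_perm b \<tau> \<circ> g) x"
  proof (cases "x \<in> range b")
    case True
    then obtain n where "x = b n" by blast
    thus ?thesis using conj by (simp add: lift_perm_in[OF b] g_b fun_eq_iff)
  next
    case False
    have "g x \<notin> range b"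
    proof
      assume "g x \<in> range b"
      then obtain m where "g x = b m" by blast
      hence "g x = g (b (inv_into UNIV \<pi> m))"
        using \<pi> by (simp add: g_b bij_is_surj surj_f_inv_f)
      with g False show False by (metis bij_is_inj injD rangeI)
    qed
    with False show ?thesis by (simp add: lift_perm_out)
  qed
qed

lemma moiety_involution_lift_perm:
  assumes "inj b" "moiety_involution \<tau>" shows "moiety_involution (lift_perm b \<tau>)"
proof -
  have inv: "\<tau> \<circ> \<tau> = id" using assms(2) by (auto simp: moiety_involution_def)
  have "lift_perm b \<tau> (lift_perm b \<tau> x) = x" for x
    using assms(2) by (cases "x \<in> range b")
      (auto simp: lift_perm_in lift_perm_out assms moiety_involution_def)
  moreover have "b ` {n. \<tau> n \<noteq> n} \<subseteq> {n. lift_perm b \<tau> n \<noteq> n}"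
    "b ` {n. \<tau> n = n} \<subseteq> {n. lift_perm b \<tau> n = n}"
    by (auto simp: lift_perm_in assms inj_eq)
  moreover have "infinite (b ` {n. \<tau> n \<noteq> n})" "infinite (b ` {n. \<tau> n = n})"
    using assms by (auto simp: moiety_involution_def finite_image_iff inj_on_subset)
  ultimately show ?thesis
    unfolding moiety_involution_def using infinite_super by blast
qed

section \<open>Permutations mapped into a separable group with a complete left-invariant metric\<close>

text \<open>Separability is expressed by a dense sequence, the form that diagonalisation uses.\<close>

locale separable_cli_group = group K + Metric_space "carrier K" d
  for K :: "'k monoid" and d +
  assumes left_invariant: "\<And>g x y. g \<in> carrier K \<Longrightarrow> x \<in> carrier K \<Longrightarrow> y \<in> carrier K \<Longrightarrow>
      d (g \<otimes>\<^bsub>K\<^esub> x) (g \<otimes>\<^bsub>K\<^esub> y) = d x y"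
    and complete: mcomplete
    and separable: "\<exists>c :: nat \<Rightarrow> 'k. range c \<subseteq> carrier K \<and>
      (\<forall>x\<in>carrier K. \<forall>\<epsilon>>0. \<exists>i. d (c i) x < \<epsilon>)"
begin

text \<open>
  The metric is not assumed to be right-invariant, so \<open>lnorm\<close> is in general not invariant under conjugation.
\<close>

definition lnorm :: "'k \<Rightarrow> real" where
  "lnorm x = d \<one>\<^bsub>K\<^esub> x"

lemma dist_lnorm: "x \<in> carrier K \<Longrightarrow> y \<in> carrier K \<Longrightarrow> d x y = lnorm (inv\<^bsub>K\<^esub> x \<otimes>\<^bsub>K\<^esub> y)"
  using left_invariant[of "inv\<^bsub>K\<^esub> x" x y] by (simp add: lnorm_def)

lemma lnorm_inv: "x \<in> carrier K \<Longrightarrow> lnorm (inv\<^bsub>K\<^esub> x) = lnorm x"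
  using dist_lnorm[of x "\<one>\<^bsub>K\<^esub>"] by (simp add: lnorm_def commute)

lemma lnorm_mult:
  assumes "x \<in> carrier K" "y \<in> carrier K"
  shows "lnorm (x \<otimes>\<^bsub>K\<^esub> y) \<le> lnorm x + lnorm y"
proof -
  have "d \<one>\<^bsub>K\<^esub> (x \<otimes>\<^bsub>K\<^esub> y) \<le> d \<one>\<^bsub>K\<^esub> x + d x (x \<otimes>\<^bsub>K\<^esub> y)"
    using assms by (intro triangle) auto
  also have "d x (x \<otimes>\<^bsub>K\<^esub> y) = d \<one>\<^bsub>K\<^esub> y"
    using left_invariant[of x "\<one>\<^bsub>K\<^esub>" y] assms by simp
  finally show ?thesis by (simp add: lnorm_def)
qed

context
  fixes \<Psi> assumes \<Psi>: "\<Psi> \<in> hom Sym_nat K"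
begin

lemma perm_hom_closed: "bij \<pi> \<Longrightarrow> \<Psi> \<pi> \<in> carrier K"
  using \<Psi> by (auto simp: hom_def carrier_Sym_nat)

lemma perm_hom_comp: "bij \<pi> \<Longrightarrow> bij \<rho> \<Longrightarrow> \<Psi> (\<pi> \<circ> \<rho>) = \<Psi> \<pi> \<otimes>\<^bsub>K\<^esub> \<Psi> \<rho>"
  using \<Psi> by (auto simp: hom_def carrier_Sym_nat mult_Sym_nat)

lemma hom_comp_lift_perm: "inj b \<Longrightarrow> \<Psi> \<circ> lift_perm b \<in> hom Sym_nat K"
  by (auto simp: hom_def carrier_Sym_nat mult_Sym_nat lift_perm_bij lift_perm_comp
      perm_hom_closed perm_hom_comp)

lemma perm_hom_id: "\<Psi> id = \<one>\<^bsub>K\<^esub>"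
  using perm_hom_comp[of id id] perm_hom_closed[of id] by (simp add: l_cancel_one')

lemma perm_hom_inverse:
  assumes "bij \<pi>" "bij \<rho>" "\<pi> \<circ> \<rho> = id" shows "\<Psi> \<pi> = inv\<^bsub>K\<^esub> (\<Psi> \<rho>)"
  using perm_hom_comp[OF assms(1,2)] assms perm_hom_closed perm_hom_id
  by (metis inv_equality)

lemma dist_perm_hom:
  assumes "bij \<pi>" "bij \<rho>" shows "d (\<Psi> \<pi>) (\<Psi> \<rho>) = lnorm (\<Psi> (inv_into UNIV \<pi> \<circ> \<rho>))"
proof -
  have "bij (inv_into UNIV \<pi>)" "inv_into UNIV \<pi> \<circ> \<pi> = id"
    using assms by (auto simp: bij_imp_bij_inv bij_is_inj)
  thus ?thesis
    using assms perm_hom_inverse[of "inv_into UNIV \<pi>" \<pi>]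
    by (simp add: dist_lnorm perm_hom_closed perm_hom_comp)
qed

text \<open>
  Split \<open>\<nat>\<close> into infinitely many infinite blocks, one for each member \<open>c\<^sub>k\<close> of the dense sequence. If
  on each block \<open>k\<close> some \<open>\<pi>\<^sub>k\<close> could not be extended to a permutation with image near \<open>c\<^sub>k\<close>, then
  the permutation that extends all \<open>\<pi>\<^sub>k\<close> simultaneously would have an image far from the whole sequence.
  So for some \<open>k\<close> every \<open>\<pi>\<close> on block \<open>k\<close> has an extension with image near \<open>c\<^sub>k\<close>; dividing by an extension
  of the identity moves the image near the identity.
\<close>

lemma full_moiety:
  assumes "\<epsilon> > 0"
  shows "\<exists>b :: nat \<Rightarrow> nat. inj b \<and> (\<forall>\<pi>. bij \<pi> \<longrightarrow> (\<exists>g. bij g \<and> g \<circ> b = b \<circ> \<pi> \<and> lnorm (\<Psi> g) < \<epsilon>))"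
proof -
  obtain c :: "nat \<Rightarrow> 'k" where c: "range c \<subseteq> carrier K"
    "\<And>x \<epsilon>. x \<in> carrier K \<Longrightarrow> \<epsilon> > 0 \<Longrightarrow> \<exists>i. d (c i) x < \<epsilon>"
    using separable by blast
  define b where "b k = (\<lambda>n::nat. prod_encode (k, n))" for k :: nat
  have inj: "inj (b k)" for k
    by (auto simp: b_def inj_on_def)
  have "\<exists>k. \<forall>\<pi>. bij \<pi> \<longrightarrow> (\<exists>g. bij g \<and> g \<circ> b k = b k \<circ> \<pi> \<and> d (c k) (\<Psi> g) < \<epsilon> / 2)"
  proof (rule ccontr)
    assume "\<not> ?thesis"
    then obtain \<pi> where \<pi>: "\<And>k. bij (\<pi> k)"
      "\<And>k g. bij g \<Longrightarrow> g \<circ> b k = b k \<circ> \<pi> k \<Longrightarrow> \<not> d (c k) (\<Psi> g) < \<epsilon> / 2"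
      by metis
    define g where "g n = (case prod_decode n of (k, m) \<Rightarrow> prod_encode (k, \<pi> k m))" for n
    have "bij g"
    proof (rule o_bij)
      define h where "h n = (case prod_decode n of (k, m) \<Rightarrow>
        prod_encode (k, inv_into UNIV (\<pi> k) m))" for n
      show "h \<circ> g = id" "g \<circ> h = id"
        using \<pi>(1) by (auto simp: fun_eq_iff g_def h_def bij_is_inj bij_is_surj surj_f_inv_f
            prod_decode_inverse split: prod.split)
          (metis prod_decode_inverse)+
    qed
    moreover have "g \<circ> b k = b k \<circ> \<pi> k" for k
      by (auto simp: g_def b_def)
    moreover obtain k where "d (c k) (\<Psi> g) < \<epsilon> / 2"
      using c(2)[of "\<Psi> g" "\<epsilon> / 2"] perm_hom_closed[OF \<open>bij g\<close>] assms by auto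
    ultimately show False using \<pi>(2) by blast
  qed
  then obtain k where k: "\<And>\<pi>. bij \<pi> \<Longrightarrow>
      \<exists>g. bij g \<and> g \<circ> b k = b k \<circ> \<pi> \<and> d (c k) (\<Psi> g) < \<epsilon> / 2"
    by blast
  \<comment> \<open>Dividing by \<open>g\<^sub>0\<close>, the extension of the identity, turns nearness to \<open>c k\<close> into nearness to 1.\<close>
  obtain g\<^sub>0 where g\<^sub>0: "bij g\<^sub>0" "g\<^sub>0 \<circ> b k = b k" "d (c k) (\<Psi> g\<^sub>0) < \<epsilon> / 2"
    using k[of id] by auto
  have "\<exists>g. bij g \<and> g \<circ> b k = b k \<circ> \<pi> \<and> lnorm (\<Psi> g) < \<epsilon>" if "bij \<pi>" for \<pi>
  proof -
    obtain g where g: "bij g" "g \<circ> b k = b k \<circ> \<pi>" "d (c k) (\<Psi> g) < \<epsilon> / 2"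
      using k[OF \<open>bij \<pi>\<close>] by blast
    let ?h = "inv_into UNIV g\<^sub>0 \<circ> g"
    have "bij ?h" using g\<^sub>0 g by (simp add: bij_comp bij_imp_bij_inv)
    moreover have "?h \<circ> b k = b k \<circ> \<pi>"
    proof
      fix n
      have "inv_into UNIV g\<^sub>0 (b k m) = b k m" for m
        using g\<^sub>0(1,2) by (metis bij_inv_eq_iff comp_apply)
      thus "(?h \<circ> b k) n = (b k \<circ> \<pi>) n" using g(2) by (simp add: fun_eq_iff)
    qed
    moreover have "lnorm (\<Psi> ?h) < \<epsilon>"
    proof -
      have "d (\<Psi> g\<^sub>0) (\<Psi> g) \<le> d (\<Psi> g\<^sub>0) (c k) + d (c k) (\<Psi> g)"
        using g g\<^sub>0 c(1) by (intro triangle) (auto simp: perm_hom_closed)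
      thus ?thesis using g(3) g\<^sub>0(3) commute[of "\<Psi> g\<^sub>0" "c k"]
        by (simp flip: dist_perm_hom add: g g\<^sub>0)
    qed
    ultimately show ?thesis by blast
  qed
  with inj show ?thesis by blast
qed

text \<open>
  There are uncountably many sets \<open>A\<close> of blocks, so the involutions acting on the blocks in \<open>A\<close> cannot all
  have their images near different members of the dense sequence. The quotient of two that come near the same
  member acts on the blocks of the symmetric difference. On each block the standard involution has
  both infinitely many moved and infinitely many fixed points, so a single block suffices.
\<close>

lemma small_moiety_involution:
  assumes "\<epsilon> > 0"
  shows "\<exists>\<tau>. moiety_involution \<tau> \<and> lnorm (\<Psi> \<tau>) < \<epsilon>"
proof -
  obtain c :: "nat \<Rightarrow> 'k" where c: "range c \<subseteq> carrier K"
    "\<And>x \<epsilon>. x \<in> carrier K \<Longrightarrow> \<epsilon> > 0 \<Longrightarrow> \<exists>i. d (c i) x < \<epsilon>"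
    using separable by blast
  define J where "J A n = (case prod_decode n of (k, m) \<Rightarrow>
    prod_encode (k, if k \<in> A then std_involution m else m))" for A :: "nat set" and n
  have std: "std_involution (std_involution n) = n" for n
    using moiety_involution_std by (simp add: moiety_involution_def)
  have JJ: "J A (J B n) = (case prod_decode n of (k, m) \<Rightarrow>
    prod_encode (k, if (k \<in> A) \<noteq> (k \<in> B) then std_involution m else m))" for A B n
    by (auto simp: J_def std split: prod.split)
  have J_invol: "J A \<circ> J A = id" for A
    by (auto simp: fun_eq_iff JJ split: prod.split)
  hence J_bij: "bij (J A)" for A
    using o_bij by blast
  have "\<forall>A. \<exists>i. d (c i) (\<Psi> (J A)) < \<epsilon> / 2"
  proof
    fix A show "\<exists>i. d (c i) (\<Psi> (J A)) < \<epsilon> / 2"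
      using c(2)[OF perm_hom_closed[OF J_bij], of "\<epsilon> / 2"] assms by simp
  qed
  then obtain i where i: "\<And>A. d (c (i A)) (\<Psi> (J A)) < \<epsilon> / 2"
    by metis
  have "\<not> inj i"
  proof
    assume "inj i"
    hence "\<exists>f :: nat \<Rightarrow> nat set. surj f" by (meson inj_imp_surj_inv)
    thus False using Cantors_theorem[of "UNIV::nat set"] by auto
  qed
  then obtain A B where AB: "A \<noteq> B" "i A = i B"
    by (auto simp: inj_on_def)
  have "moiety_involution (J A \<circ> J B)"
  proof -
    obtain k where k: "(k \<in> A) \<noteq> (k \<in> B)" using AB(1) by blast
    define b where "b = (\<lambda>n::nat. prod_encode (k, n))"
    have b: "inj b" by (auto simp: b_def inj_on_def)
    have Jb: "J A (J B (b n)) = b (std_involution n)" for n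
      using k by (auto simp: JJ b_def)
    have "b ` {n. std_involution n \<noteq> n} \<subseteq> {n. (J A \<circ> J B) n \<noteq> n}"
      "b ` {n. std_involution n = n} \<subseteq> {n. (J A \<circ> J B) n = n}"
      by (auto simp: Jb inj_eq[OF b])
    moreover have "infinite (b ` {n. std_involution n \<noteq> n})"
      "infinite (b ` {n. std_involution n = n})"
      using moiety_involution_std b
      by (auto simp: moiety_involution_def finite_image_iff inj_on_subset)
    moreover have "J A (J B (J A (J B n))) = n" for n
    proof -
      have "J A (J B m) = J B (J A m)" for m
        by (auto simp: JJ split: prod.split)
      thus ?thesis using J_invol by (metis comp_apply id_apply)
    qed
    ultimately show ?thesis
      unfolding moiety_involution_def comp_apply using infinite_super by blast
  qed
  moreover have "lnorm (\<Psi> (J A \<circ> J B)) < \<epsilon>"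
  proof -
    have "inv_into UNIV (J A) = J A"
      using J_invol by (metis inv_unique_comp)
    hence "lnorm (\<Psi> (J A \<circ> J B)) = d (\<Psi> (J A)) (\<Psi> (J B))"
      by (simp add: dist_perm_hom J_bij)
    also have "\<dots> \<le> d (\<Psi> (J A)) (c (i A)) + d (c (i A)) (\<Psi> (J B))"
      using c(1) by (intro triangle) (auto simp: perm_hom_closed J_bij)
    also have "\<dots> < \<epsilon>"
      using i[of A] i[of B] AB(2) by (simp add: commute)
    finally show ?thesis .
  qed
  ultimately show ?thesis by blast
qed

end

text \<open>
  On the range of \<open>b\<close> one involution has small image, and all others are its conjugates by permutations
  with small image. This step replaces invariance of the metric under conjugation.
\<close>

lemma uniformly_small_moiety:
  assumes \<Psi>: "\<Psi> \<in> hom Sym_nat K" and "\<epsilon> > 0"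
  shows "\<exists>b :: nat \<Rightarrow> nat. inj b \<and> (\<forall>\<tau>. moiety_involution \<tau> \<longrightarrow> lnorm (\<Psi> (lift_perm b \<tau>)) < \<epsilon>) \<and>
    (\<forall>\<pi>. bij \<pi> \<longrightarrow> (\<exists>g. bij g \<and> g \<circ> b = b \<circ> \<pi> \<and> lnorm (\<Psi> g) < \<epsilon>))"
proof -
  obtain b :: "nat \<Rightarrow> nat" where b: "inj b"
    "\<And>\<pi>. bij \<pi> \<Longrightarrow> \<exists>g. bij g \<and> g \<circ> b = b \<circ> \<pi> \<and> lnorm (\<Psi> g) < \<epsilon> / 3"
    using full_moiety[OF \<Psi>, of "\<epsilon> / 3"] \<open>\<epsilon> > 0\<close> by auto
  have "\<Psi> \<circ> lift_perm b \<in> hom Sym_nat K"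
    by (rule hom_comp_lift_perm[OF \<Psi> b(1)])
  then obtain \<tau>\<^sub>0 where \<tau>\<^sub>0: "moiety_involution \<tau>\<^sub>0" "lnorm (\<Psi> (lift_perm b \<tau>\<^sub>0)) < \<epsilon> / 3"
    using small_moiety_involution[of "\<Psi> \<circ> lift_perm b" "\<epsilon> / 3"] \<open>\<epsilon> > 0\<close> by auto
  have "lnorm (\<Psi> (lift_perm b \<tau>)) < \<epsilon>" if \<tau>: "moiety_involution \<tau>" for \<tau>
  proof -
    obtain \<pi> where \<pi>: "bij \<pi>" "\<pi> \<circ> \<tau>\<^sub>0 = \<tau> \<circ> \<pi>"
      using moiety_involutions_conjugate[OF \<tau>\<^sub>0(1) \<tau>] by blast
    obtain g where g: "bij g" "g \<circ> b = b \<circ> \<pi>" "lnorm (\<Psi> g) < \<epsilon> / 3"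
      using b(2)[OF \<pi>(1)] by blast
    let ?l = "lift_perm b"
    have "g \<circ> ?l \<tau>\<^sub>0 = ?l \<tau> \<circ> g"
      by (rule lift_perm_intertwine[OF b(1) g(1) \<pi>(1) g(2) \<pi>(2)])
    hence eq: "\<Psi> g \<otimes>\<^bsub>K\<^esub> \<Psi> (?l \<tau>\<^sub>0) = \<Psi> (?l \<tau>) \<otimes>\<^bsub>K\<^esub> \<Psi> g"
      using perm_hom_comp[OF \<Psi>] g(1) lift_perm_bij[OF b(1)] \<tau>\<^sub>0(1) \<tau> moiety_involution_bij
      by metis
    have cl: "\<Psi> g \<in> carrier K" "\<Psi> (?l \<tau>\<^sub>0) \<in> carrier K" "\<Psi> (?l \<tau>) \<in> carrier K"
      using perm_hom_closed[OF \<Psi>] g(1) lift_perm_bij[OF b(1)] \<tau>\<^sub>0(1) \<tau> moiety_involution_bij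
      by metis+
    have "\<Psi> (?l \<tau>) = \<Psi> g \<otimes>\<^bsub>K\<^esub> \<Psi> (?l \<tau>\<^sub>0) \<otimes>\<^bsub>K\<^esub> inv\<^bsub>K\<^esub> (\<Psi> g)"
      using eq cl by (simp add: m_assoc)
    hence "lnorm (\<Psi> (?l \<tau>)) \<le> lnorm (\<Psi> g) + lnorm (\<Psi> (?l \<tau>\<^sub>0)) + lnorm (\<Psi> g)"
      using lnorm_mult[of "\<Psi> g \<otimes>\<^bsub>K\<^esub> \<Psi> (?l \<tau>\<^sub>0)" "inv\<^bsub>K\<^esub> (\<Psi> g)"]
        lnorm_mult[of "\<Psi> g" "\<Psi> (?l \<tau>\<^sub>0)"] lnorm_inv[of "\<Psi> g"] cl by simp
    thus ?thesis using g(3) \<tau>\<^sub>0(2) by linarith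
  qed
  moreover have "\<exists>g. bij g \<and> g \<circ> b = b \<circ> \<pi> \<and> lnorm (\<Psi> g) < \<epsilon>" if "bij \<pi>" for \<pi>
  proof -
    have "\<epsilon> / 3 < \<epsilon>" using \<open>\<epsilon> > 0\<close> by simp
    thus ?thesis using b(2)[OF that] by (meson less_trans)
  qed
  ultimately show ?thesis using b(1) by blast
qed

text \<open>
  Each set is found inside the previous one by applying \<open>uniformly_small_moiety\<close> to the homomorphism that
  sends a permutation to the image of its copy on the previous set.
\<close>

lemma shrinking_moieties:
  assumes \<Psi>: "\<Psi> \<in> hom Sym_nat K"
  shows "\<exists>B :: nat \<Rightarrow> nat \<Rightarrow> nat. \<forall>n. inj (B n) \<and> (\<exists>c. inj c \<and> B (Suc n) = B n \<circ> c) \<and>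
    (\<forall>\<tau>. moiety_involution \<tau> \<longrightarrow> lnorm (\<Psi> (lift_perm (B n) \<tau>)) < (1/2) ^ n) \<and>
    (\<forall>\<pi>. bij \<pi> \<longrightarrow> (\<exists>g. bij g \<and> g \<circ> B n = B n \<circ> \<pi> \<and> lnorm (\<Psi> g) < (1/2) ^ n))"
proof -
  define P where "P n b \<longleftrightarrow> inj b \<and>
    (\<forall>\<tau>. moiety_involution \<tau> \<longrightarrow> lnorm (\<Psi> (lift_perm b \<tau>)) < (1/2) ^ n) \<and>
    (\<forall>\<pi>. bij \<pi> \<longrightarrow> (\<exists>g. bij g \<and> g \<circ> b = b \<circ> \<pi> \<and> lnorm (\<Psi> g) < (1/2) ^ n))" for n and b :: "nat \<Rightarrow> nat"
  have "\<exists>B. \<forall>n. P n (B n) \<and> (\<exists>c. inj c \<and> B (Suc n) = B n \<circ> c)"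
  proof (rule dependent_nat_choice)
    show "\<exists>b. P 0 b"
      using uniformly_small_moiety[OF \<Psi>, of 1] by (auto simp: P_def)
  next
    fix b n assume "P n b"
    hence b: "inj b" by (simp add: P_def)
    obtain c :: "nat \<Rightarrow> nat" where c: "inj c"
      "\<And>\<tau>. moiety_involution \<tau> \<Longrightarrow> lnorm (\<Psi> (lift_perm b (lift_perm c \<tau>))) < (1/2) ^ Suc n"
      "\<And>\<pi>. bij \<pi> \<Longrightarrow> \<exists>g. bij g \<and> g \<circ> c = c \<circ> \<pi> \<and> lnorm (\<Psi> (lift_perm b g)) < (1/2) ^ Suc n"
      using uniformly_small_moiety[OF hom_comp_lift_perm[OF \<Psi> b], of "(1/2) ^ Suc n"]
      by auto
    have "P (Suc n) (b \<circ> c)"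
      unfolding P_def
    proof (intro conjI allI impI)
      show "inj (b \<circ> c)" using b c(1) by (simp add: inj_compose)
      show "lnorm (\<Psi> (lift_perm (b \<circ> c) \<tau>)) < (1/2) ^ Suc n" if "moiety_involution \<tau>" for \<tau>
        using c(2)[OF that] by (simp add: lift_perm_lift_perm b c(1))
      show "\<exists>g. bij g \<and> g \<circ> (b \<circ> c) = b \<circ> c \<circ> \<pi> \<and> lnorm (\<Psi> g) < (1/2) ^ Suc n" if \<pi>: "bij \<pi>" for \<pi>
      proof -
        obtain g where g: "bij g" "g \<circ> c = c \<circ> \<pi>" "lnorm (\<Psi> (lift_perm b g)) < (1/2) ^ Suc n"
          using c(3)[OF \<pi>] by blast
        thus ?thesis
          by (intro exI[of _ "lift_perm b g"])
             (auto simp: lift_perm_bij b lift_perm_in fun_eq_iff)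
      qed
    qed
    thus "\<exists>b'. P (Suc n) b' \<and> (\<exists>c. inj c \<and> b' = b \<circ> c)"
      using c(1) by blast
  qed
  thus ?thesis by (auto simp: P_def)
qed

text \<open>
  The permutations \<open>h n\<close> transport an involution \<open>J 0\<close> into ever smaller sets, where the images of
  involutions tend to the identity, while completeness keeps the product of the transporting elements
  under control. For an incomplete left-invariant metric the statement fails: the full permutation group
  with its usual metric is an example, with the identity homomorphism.
\<close>

theorem hom_kills_moiety_involution:
  assumes \<Psi>: "\<Psi> \<in> hom Sym_nat K" and \<tau>: "moiety_involution \<tau>"
  shows "\<Psi> \<tau> = \<one>\<^bsub>K\<^esub>"
proof -
  note closed = perm_hom_closed[OF \<Psi>] and comp = perm_hom_comp[OF \<Psi>]
  obtain B where B: "\<And>n. inj (B n)" "\<And>n. \<exists>c. inj c \<and> B (Suc n) = B n \<circ> c"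
    "\<And>n \<tau>. moiety_involution \<tau> \<Longrightarrow> lnorm (\<Psi> (lift_perm (B n) \<tau>)) < (1/2) ^ n"
    "\<And>n \<pi>. bij \<pi> \<Longrightarrow> \<exists>g. bij g \<and> g \<circ> B n = B n \<circ> \<pi> \<and> lnorm (\<Psi> g) < (1/2) ^ n"
    using shrinking_moieties[OF \<Psi>] by metis
  let ?s = std_involution
  define J where "J n = lift_perm (B n) ?s" for n
  have J: "moiety_involution (J n)" "bij (J n)" for n
    using moiety_involution_lift_perm[OF B(1) moiety_involution_std] moiety_involution_bij
    by (auto simp: J_def)
  have "\<exists>h. bij h \<and> lnorm (\<Psi> h) < (1/2) ^ n \<and> J n \<circ> h = h \<circ> J (Suc n)" for n
  proof -
    obtain c where c: "inj c" "B (Suc n) = B n \<circ> c" using B(2) by blast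
    have "moiety_involution (lift_perm c ?s)"
      by (rule moiety_involution_lift_perm[OF c(1) moiety_involution_std])
    then obtain \<pi> where \<pi>: "bij \<pi>" "\<pi> \<circ> lift_perm c ?s = ?s \<circ> \<pi>"
      using moiety_involutions_conjugate[OF _ moiety_involution_std] by blast
    obtain h where h: "bij h" "h \<circ> B n = B n \<circ> \<pi>" "lnorm (\<Psi> h) < (1/2) ^ n"
      using B(4)[OF \<pi>(1)] by blast
    have "lift_perm (B n) ?s \<circ> h = h \<circ> lift_perm (B n) (lift_perm c ?s)"
      by (rule lift_perm_intertwine[OF B(1) h(1) \<pi>(1) h(2) \<pi>(2), symmetric])
    also have "lift_perm (B n) (lift_perm c ?s) = J (Suc n)"
      by (simp add: J_def c(2) lift_perm_lift_perm B(1) c(1))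
    finally have "J n \<circ> h = h \<circ> J (Suc n)" by (simp only: J_def)
    with h show ?thesis by blast
  qed
  then obtain h where h: "\<And>n. bij (h n)" "\<And>n. lnorm (\<Psi> (h n)) < (1/2) ^ n"
    "\<And>n. J n \<circ> h n = h n \<circ> J (Suc n)"
    by metis
  define S where "S = rec_nat id (\<lambda>n \<sigma>. \<sigma> \<circ> h n)"
  have S_Suc: "S 0 = id" "S (Suc n) = S n \<circ> h n" for n by (simp_all add: S_def)
  have S_bij: "bij (S n)" for n by (induction n) (simp_all only: S_Suc bij_comp h(1) bij_id)
  have SJ: "J 0 \<circ> S n = S n \<circ> J n" for n
  proof (induction n)
    case (Suc n)
    thus ?case by (metis S_Suc(2) comp_assoc h(3))
  qed (simp add: S_Suc)
  define k where "k n = \<Psi> (S n)" for n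
  have k: "k n \<in> carrier K" for n by (simp add: k_def closed S_bij)
  have step: "d (k n) (k (Suc n)) < (1/2) ^ n" for n
  proof -
    have "k (Suc n) = k n \<otimes>\<^bsub>K\<^esub> \<Psi> (h n)" by (simp add: k_def S_Suc comp S_bij h(1))
    hence "d (k n) (k (Suc n)) = lnorm (\<Psi> (h n))"
      using left_invariant[of "k n" "\<one>\<^bsub>K\<^esub>" "\<Psi> (h n)"] k by (simp add: lnorm_def closed h(1))
    thus ?thesis using h(2) by simp
  qed
  have tail: "d (k n) (k (n + m)) \<le> 2 * (1/2) ^ n - 2 * (1/2) ^ (n + m)" for n m
  proof (induction m)
    case (Suc m)
    have "d (k n) (k (n + Suc m)) \<le> d (k n) (k (n + m)) + d (k (n + m)) (k (Suc (n + m)))"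
      using triangle[of "k n" "k (n + m)" "k (n + Suc m)"] k by simp
    with Suc step[of "n + m"] show ?case by simp
  qed (simp add: k)
  have "MCauchy k"
    unfolding MCauchy_def
  proof (intro conjI allI impI)
    fix \<epsilon> :: real assume "\<epsilon> > 0"
    then obtain N where N: "(1/2) ^ N < \<epsilon> / 4"
      using real_arch_pow_inv[of "\<epsilon> / 4" "1/2"] by auto
    have close: "d (k N) (k n) < \<epsilon> / 2" if "N \<le> n" for n
    proof -
      have "(0::real) \<le> (1/2) ^ n" by simp
      moreover have "d (k N) (k n) \<le> 2 * (1/2) ^ N - 2 * (1/2) ^ n"
        using tail[of N "n - N"] that by simp
      ultimately show ?thesis using N by linarith
    qed
    have "d (k n) (k n') < \<epsilon>" if "N \<le> n" "N \<le> n'" for n n'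
      using close[OF that(1)] close[OF that(2)] triangle[OF k k k, of n n' N] commute[of "k n" "k N"]
      by linarith
    thus "\<exists>N. \<forall>n n'. N \<le> n \<longrightarrow> N \<le> n' \<longrightarrow> d (k n) (k n') < \<epsilon>" by blast
  qed (use k in auto)
  then obtain x where "limitin mtopology k x sequentially"
    using complete by (auto simp: mcomplete_def)
  hence x: "x \<in> carrier K" and lim: "(\<lambda>n. d (k n) x) \<longlonglongrightarrow> 0"
    by (auto simp: limitin_metric_dist_null)
  let ?j = "\<Psi> (J 0)"
  have j: "?j \<in> carrier K" using J closed by blast
  \<comment> \<open>Only left translations occur here; a conjugation could not be controlled by \<open>d\<close>.\<close>
  have "d (?j \<otimes>\<^bsub>K\<^esub> x) x \<le> 2 * d (k n) x + (1/2) ^ n" for n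
  proof -
    have Jn: "\<Psi> (J n) \<in> carrier K" using J closed by blast
    have comm: "?j \<otimes>\<^bsub>K\<^esub> k n = k n \<otimes>\<^bsub>K\<^esub> \<Psi> (J n)"
      using SJ[of n] comp[of "J 0" "S n"] comp[of "S n" "J n"] by (simp add: k_def J S_bij)
    have "d (?j \<otimes>\<^bsub>K\<^esub> x) x \<le> d (?j \<otimes>\<^bsub>K\<^esub> x) (?j \<otimes>\<^bsub>K\<^esub> k n) + d (?j \<otimes>\<^bsub>K\<^esub> k n) x"
      by (intro triangle m_closed j k x)
    moreover have "d (?j \<otimes>\<^bsub>K\<^esub> x) (?j \<otimes>\<^bsub>K\<^esub> k n) = d (k n) x"
      using left_invariant[OF j x k] commute by metis
    moreover have "d (?j \<otimes>\<^bsub>K\<^esub> k n) x \<le> d (?j \<otimes>\<^bsub>K\<^esub> k n) (k n) + d (k n) x"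
      by (intro triangle m_closed j k x)
    moreover have "d (?j \<otimes>\<^bsub>K\<^esub> k n) (k n) = lnorm (\<Psi> (J n))"
      using left_invariant[OF k Jn one_closed, of n] commute k by (simp add: comm lnorm_def)
    moreover have "lnorm (\<Psi> (J n)) \<le> (1/2) ^ n"
      using B(3)[OF moiety_involution_std, of n] by (simp add: J_def)
    ultimately show ?thesis by linarith
  qed
  moreover have "(\<lambda>n. 2 * d (k n) x + (1/2) ^ n) \<longlonglongrightarrow> 2 * 0 + 0"
    by (intro tendsto_intros lim LIMSEQ_realpow_zero) auto
  ultimately have "d (?j \<otimes>\<^bsub>K\<^esub> x) x \<le> 2 * 0 + 0"
    by (intro LIMSEQ_le_const) auto
  hence "d (?j \<otimes>\<^bsub>K\<^esub> x) x = 0"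
    using nonneg[of "?j \<otimes>\<^bsub>K\<^esub> x" x] by simp
  hence "?j \<otimes>\<^bsub>K\<^esub> x = x"
    using j x by simp
  hence j1: "?j = \<one>\<^bsub>K\<^esub>" using j x by simp
  obtain \<pi> where \<pi>: "bij \<pi>" "\<pi> \<circ> \<tau> = J 0 \<circ> \<pi>"
    using moiety_involutions_conjugate[OF \<tau> J(1)] by blast
  have "\<Psi> \<pi> \<otimes>\<^bsub>K\<^esub> \<Psi> \<tau> = \<Psi> (J 0) \<otimes>\<^bsub>K\<^esub> \<Psi> \<pi>"
    using comp \<pi> J(2) moiety_involution_bij[OF \<tau>] by metis
  thus ?thesis
    using j1 closed[OF \<pi>(1)] closed[OF moiety_involution_bij[OF \<tau>]] by simp
qed

end

section \<open>Inner product on square-summable sequences\<close>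

definition vscaled :: "'s::field \<Rightarrow> (nat \<Rightarrow> 's) \<Rightarrow> nat \<Rightarrow> 's" (infixr \<open>\<cdot>\<^sub>v\<close> 75) where
  "c \<cdot>\<^sub>v x = (\<lambda>n. c * x n)"

lemma vscaled_apply [simp]: "(c \<cdot>\<^sub>v x) n = c * x n"
  by (simp add: vscaled_def)

lemma ell2_add [intro]: "x \<in> ell2 \<Longrightarrow> y \<in> ell2 \<Longrightarrow> x + y \<in> ell2"
  by (simp add: ell2_vadd plus_fun_def)

lemma ell2_vscaled [intro]: "x \<in> ell2 \<Longrightarrow> c \<cdot>\<^sub>v x \<in> ell2"
  by (simp add: ell2_vscale vscaled_def)

lemma ell2_0 [intro, simp]: "0 \<in> ell2"
  by (simp add: ell2_zero zero_fun_def)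

lemma diff_eq_vscaled: "x - y = x + (- 1) \<cdot>\<^sub>v y"
  by (simp add: fun_eq_iff)

lemma ell2_diff [intro]: "x \<in> ell2 \<Longrightarrow> y \<in> ell2 \<Longrightarrow> x - y \<in> ell2"
  unfolding diff_eq_vscaled by (intro ell2_add ell2_vscaled)

lemma ell2_sum: "(\<And>i. i \<in> I \<Longrightarrow> x i \<in> ell2) \<Longrightarrow> (\<Sum>i\<in>I. x i) \<in> ell2"
  by (induction I rule: infinite_finite_induct) auto

definition nsq :: "(nat \<Rightarrow> 's::real_normed_field) \<Rightarrow> real" where
  "nsq x = (\<Sum>n. (norm (x n))\<^sup>2)"

lemma nsq_nonneg: "x \<in> ell2 \<Longrightarrow> nsq x \<ge> 0"
  by (simp add: nsq_def ell2_def suminf_nonneg)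

lemma nsq_eq_0: "x \<in> ell2 \<Longrightarrow> nsq x = 0 \<Longrightarrow> x = 0"
  by (simp add: nsq_def ell2_def suminf_eq_zero_iff fun_eq_iff)

lemma sum_le_nsq: "x \<in> ell2 \<Longrightarrow> finite I \<Longrightarrow> (\<Sum>n\<in>I. (norm (x n))\<^sup>2) \<le> nsq x"
  by (simp add: nsq_def ell2_def sum_le_suminf)

text \<open>
  The real case (\<open>cj\<close> the identity) and the complex case (\<open>cj\<close> the complex conjugation) are treated together.
  That \<open>cj\<close> is an isometric involution follows from \<open>mult_cj\<close>.
\<close>

locale hilbert_conj =
  fixes cj :: "'s::{real_normed_field, banach} \<Rightarrow> 's"
  assumes cj_add: "cj (x + y) = cj x + cj y"
    and cj_mult: "cj (x * y) = cj x * cj y"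
    and mult_cj: "z * cj z = of_real ((norm z)\<^sup>2)"
begin

lemma cj_0 [simp]: "cj 0 = 0"
  using cj_add[of 0 0] by simp

lemma norm_cj [simp]: "norm (cj z) = norm z"
proof (cases "z = 0")
  case False
  have "norm z * norm (cj z) = norm z * norm z"
    using mult_cj[of z] by (simp flip: norm_mult add: power2_eq_square)
  with False show ?thesis by simp
qed simp

lemma cj_cj [simp]: "cj (cj z) = z"
proof (cases "z = 0")
  case False
  hence "cj z \<noteq> 0" by (metis norm_cj norm_eq_zero)
  moreover have "cj z * cj (cj z) = cj z * z"
    using mult_cj[of z] mult_cj[of "cj z"] by (simp add: mult.commute)
  ultimately show ?thesis by simp
qed simp

lemma cj_eq_0_iff [simp]: "cj z = 0 \<longleftrightarrow> z = 0"
  by (metis norm_cj norm_eq_zero)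

lemma cj_of_real [simp]: "cj (of_real r) = of_real r"
proof (cases "r = 0")
  case False
  have "of_real r * cj (of_real r) = of_real r * (of_real r :: 's)"
    using mult_cj[of "of_real r"] by (simp add: power2_eq_square)
  with False show ?thesis by simp
qed simp

lemma cj_1 [simp]: "cj 1 = 1"
  using cj_of_real[of 1] by simp

lemma cj_minus [simp]: "cj (- z) = - cj z"
  using cj_add[of z "- z"] by (simp add: eq_neg_iff_add_eq_0 add.commute)

lemma cj_divide: "cj (x / y) = cj x / cj y"
proof (cases "y = 0")
  case False
  have "cj (x / y) * cj y = cj x" using False by (simp flip: cj_mult)
  thus ?thesis using False by (simp add: field_simps)
qed simp

lemma bounded_linear_cj: "bounded_linear cj"
  by (rule bounded_linear_intro[of _ 1]) (simp_all add: cj_add scaleR_conv_of_real cj_mult)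

definition ip :: "(nat \<Rightarrow> 's) \<Rightarrow> (nat \<Rightarrow> 's) \<Rightarrow> 's" where
  "ip x y = (\<Sum>n. x n * cj (y n))"

lemma ip_bound:
  assumes "x \<in> ell2" "y \<in> ell2"
  shows "summable (\<lambda>n. norm (x n * cj (y n)))"
    and "norm (ip x y) \<le> sqrt (nsq x) * sqrt (nsq y)"
proof -
  have bound: "(\<Sum>n<N. norm (x n * cj (y n))) \<le> sqrt (nsq x) * sqrt (nsq y)" for N
  proof -
    have "(\<Sum>n<N. norm (x n * cj (y n))) = (\<Sum>n<N. \<bar>norm (x n)\<bar> * \<bar>norm (y n)\<bar>)"
      by (simp add: norm_mult)
    also have "\<dots> \<le> L2_set (\<lambda>n. norm (x n)) {..<N} * L2_set (\<lambda>n. norm (y n)) {..<N}"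
      by (rule L2_set_mult_ineq)
    also have "\<dots> \<le> sqrt (nsq x) * sqrt (nsq y)"
      unfolding L2_set_def using assms
      by (intro mult_mono real_sqrt_le_mono sum_le_nsq) (auto intro: sum_nonneg nsq_nonneg)
    finally show ?thesis .
  qed
  show s: "summable (\<lambda>n. norm (x n * cj (y n)))"
    by (rule summableI_nonneg_bounded[OF _ bound]) simp
  have "norm (ip x y) \<le> (\<Sum>n. norm (x n * cj (y n)))"
    unfolding ip_def by (rule summable_norm[OF s])
  also have "\<dots> \<le> sqrt (nsq x) * sqrt (nsq y)"
    by (rule suminf_le_const[OF s bound])
  finally show "norm (ip x y) \<le> sqrt (nsq x) * sqrt (nsq y)" .
qed

lemma ip_summable: "x \<in> ell2 \<Longrightarrow> y \<in> ell2 \<Longrightarrow> summable (\<lambda>n. x n * cj (y n))"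
  by (rule summable_norm_cancel[OF ip_bound(1)])

lemma ip_self: "x \<in> ell2 \<Longrightarrow> ip x x = of_real (nsq x)"
  by (simp add: ip_def nsq_def mult_cj suminf_of_real ell2_def)

lemma ip_self_eq_0: "x \<in> ell2 \<Longrightarrow> ip x x = 0 \<Longrightarrow> x = 0"
  by (simp add: ip_self nsq_eq_0)

lemma ip_cj: "x \<in> ell2 \<Longrightarrow> y \<in> ell2 \<Longrightarrow> cj (ip x y) = ip y x"
  using bounded_linear.suminf[OF bounded_linear_cj ip_summable, of x y]
  by (simp add: ip_def cj_mult mult.commute)

lemma ip_add_left:
  "x \<in> ell2 \<Longrightarrow> y \<in> ell2 \<Longrightarrow> z \<in> ell2 \<Longrightarrow> ip (x + y) z = ip x z + ip y z"
  using suminf_add[OF ip_summable ip_summable, of x z y z] by (simp add: ip_def distrib_right)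

lemma ip_scale_left: "x \<in> ell2 \<Longrightarrow> z \<in> ell2 \<Longrightarrow> ip (c \<cdot>\<^sub>v x) z = c * ip x z"
  using suminf_mult[OF ip_summable, of x z c] by (simp add: ip_def mult.assoc)

lemma ip_add_right:
  "x \<in> ell2 \<Longrightarrow> y \<in> ell2 \<Longrightarrow> z \<in> ell2 \<Longrightarrow> ip z (x + y) = ip z x + ip z y"
  by (metis ip_add_left ip_cj cj_add ell2_add)

lemma ip_scale_right: "x \<in> ell2 \<Longrightarrow> z \<in> ell2 \<Longrightarrow> ip z (c \<cdot>\<^sub>v x) = cj c * ip z x"
  by (metis ip_scale_left ip_cj cj_mult ell2_vscaled)

lemma ip_diff_left:
  "x \<in> ell2 \<Longrightarrow> y \<in> ell2 \<Longrightarrow> z \<in> ell2 \<Longrightarrow> ip (x - y) z = ip x z - ip y z"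
  unfolding diff_eq_vscaled by (subst ip_add_left) (auto simp: ip_scale_left)

lemma ip_diff_right:
  "x \<in> ell2 \<Longrightarrow> y \<in> ell2 \<Longrightarrow> z \<in> ell2 \<Longrightarrow> ip z (x - y) = ip z x - ip z y"
  unfolding diff_eq_vscaled by (subst ip_add_right) (auto simp: ip_scale_right)

lemma ip_0_left [simp]: "ip 0 x = 0" and ip_0_right [simp]: "ip x 0 = 0"
  by (simp_all add: ip_def)

lemma ip_sum_left:
  "(\<And>i. i \<in> I \<Longrightarrow> x i \<in> ell2) \<Longrightarrow> z \<in> ell2 \<Longrightarrow> ip (\<Sum>i\<in>I. x i) z = (\<Sum>i\<in>I. ip (x i) z)"
  by (induction I rule: infinite_finite_induct) (auto simp: ip_add_left ell2_sum)

lemmas ip_simps = ip_add_left ip_add_right ip_diff_left ip_diff_right ip_scale_left ip_scale_right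
  ell2_add ell2_diff ell2_vscaled

section \<open>Isometries of subspaces, and homogeneity\<close>

abbreviation H :: "(nat \<Rightarrow> 's, 's) hilbert_structure" where
  "H \<equiv> ell2_structure cj"

lemma H_sel [simp]:
  "vecs H = ell2" "vzero H = 0" "vadd H x y = x + y" "vscale H c x = c \<cdot>\<^sub>v x" "vinner H x y = ip x y"
  "vdist H x y = of_real (sqrt (nsq (x - y)))"
  by (simp_all add: ell2_structure_def zero_fun_def plus_fun_def vscaled_def ip_def nsq_def)

text \<open>
  The members of the automorphism group of a subspace (\<open>carrier_Aut_iff\<close>). Injectivity and preservation of the
  metric follow from preservation of the inner product.
\<close>

definition unitary_on :: "(nat \<Rightarrow> 's) set \<Rightarrow> ((nat \<Rightarrow> 's) \<Rightarrow> (nat \<Rightarrow> 's)) \<Rightarrow> bool" where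
  "unitary_on Y f \<longleftrightarrow> f \<in> extensional Y \<and> f ` Y = Y \<and>
     (\<forall>x\<in>Y. \<forall>y\<in>Y. f (x + y) = f x + f y) \<and> (\<forall>c. \<forall>x\<in>Y. f (c \<cdot>\<^sub>v x) = c \<cdot>\<^sub>v f x) \<and>
     (\<forall>x\<in>Y. \<forall>y\<in>Y. ip (f x) (f y) = ip x y)"

lemma substructure_H_iff:
  "substructure H Y \<longleftrightarrow> Y \<subseteq> ell2 \<and> 0 \<in> Y \<and> (\<forall>x\<in>Y. \<forall>y\<in>Y. x + y \<in> Y) \<and> (\<forall>c. \<forall>x\<in>Y. c \<cdot>\<^sub>v x \<in> Y)"
  by (simp add: substructure_def)

lemma substructure_diff: "substructure H Y \<Longrightarrow> x \<in> Y \<Longrightarrow> y \<in> Y \<Longrightarrow> x - y \<in> Y"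
  unfolding diff_eq_vscaled by (simp add: substructure_H_iff)

lemma substructure_ell2': "substructure H ell2"
  using substructure_ell2[of cj] by simp

context
  fixes Y assumes Y: "substructure H Y"
begin

lemma unitary_on_diff: "unitary_on Y f \<Longrightarrow> x \<in> Y \<Longrightarrow> y \<in> Y \<Longrightarrow> f (x - y) = f x - f y"
  unfolding diff_eq_vscaled using Y by (simp add: unitary_on_def substructure_H_iff)

lemma unitary_on_closed: "unitary_on Y f \<Longrightarrow> x \<in> Y \<Longrightarrow> f x \<in> Y"
  by (auto simp: unitary_on_def)

lemma unitary_on_0: "unitary_on Y f \<Longrightarrow> f 0 = 0"
  using unitary_on_diff[of f 0 0] Y by (simp add: substructure_H_iff)

lemma unitary_on_bij:
  assumes "unitary_on Y f" shows "bij_betw f Y Y"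
proof -
  have "x = y" if "x \<in> Y" "y \<in> Y" "f x = f y" for x y
  proof -
    have xy: "x - y \<in> Y" using Y that by (simp add: substructure_diff)
    have "ip (x - y) (x - y) = ip (f (x - y)) (f (x - y))"
      using assms xy by (simp add: unitary_on_def)
    also have "f (x - y) = 0"
      using unitary_on_diff[OF assms that(1,2)] that(3) by simp
    finally have "ip (x - y) (x - y) = 0" by (simp only: ip_0_left)
    moreover have "x - y \<in> ell2" using xy Y by (auto simp: substructure_H_iff)
    ultimately have "x - y = 0" by (intro ip_self_eq_0)
    thus ?thesis by (rule iffD1[OF right_minus_eq])
  qed
  thus ?thesis using assms by (auto simp: bij_betw_def inj_on_def unitary_on_def)
qed

lemma carrier_Aut_iff: "f \<in> carrier (Aut (restrict_structure H Y)) \<longleftrightarrow> unitary_on Y f"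
proof
  assume "f \<in> carrier (Aut (restrict_structure H Y))"
  thus "unitary_on Y f"
    by (auto simp: Aut_def Bij_def isomorphism_def unitary_on_def bij_betw_def)
next
  assume f: "unitary_on Y f"
  have "nsq (f x - f y) = nsq (x - y)" if "x \<in> Y" "y \<in> Y" for x y
  proof -
    have "x - y \<in> Y" using Y that by (simp add: substructure_diff)
    hence "ip (f (x - y)) (f (x - y)) = ip (x - y) (x - y)" "f (x - y) \<in> ell2" "x - y \<in> ell2"
      using f Y unitary_on_closed by (auto simp: unitary_on_def substructure_H_iff)
    thus ?thesis
      using unitary_on_diff[OF f that] by (simp add: ip_self)
  qed
  thus "f \<in> carrier (Aut (restrict_structure H Y))"
    using f unitary_on_bij[OF f] unitary_on_0[OF f] Y
    by (simp add: Aut_def Bij_def isomorphism_def unitary_on_def)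
qed

lemma unitary_on_id: "unitary_on Y (\<lambda>x\<in>Y. x)"
  using Y by (auto simp: unitary_on_def substructure_H_iff)

lemma unitary_on_compose:
  assumes f: "unitary_on Y f" and g: "unitary_on Y g" shows "unitary_on Y (compose Y g f)"
proof -
  have "compose Y g f ` Y = g ` f ` Y"
    by (auto simp: compose_def image_image)
  also have "\<dots> = Y" using f g by (simp add: unitary_on_def)
  finally have "compose Y g f ` Y = Y" .
  thus ?thesis
    using f g Y unitary_on_closed[OF f] by (simp add: unitary_on_def compose_def substructure_H_iff)
qed

lemma unitary_on_inv:
  assumes "unitary_on Y f" shows "unitary_on Y (restrict (inv_into Y f) Y)"
proof -
  have bij: "bij_betw f Y Y" by (rule unitary_on_bij[OF assms])
  have inv: "inv_into Y f x \<in> Y" "f (inv_into Y f x) = x" "inv_into Y f (f x) = x" if "x \<in> Y" for x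
    using bij that by (auto simp: bij_betw_def inv_into_into f_inv_into_f)
  have Ycl: "x + y \<in> Y" "c \<cdot>\<^sub>v x \<in> Y" if "x \<in> Y" "y \<in> Y" for x y c
    using Y that by (auto simp: substructure_H_iff)
  have "inv_into Y f (x + y) = inv_into Y f x + inv_into Y f y" if "x \<in> Y" "y \<in> Y" for x y
  proof -
    have "f (inv_into Y f x + inv_into Y f y) = x + y"
      using assms inv that by (simp add: unitary_on_def)
    thus ?thesis using inv Ycl that by metis
  qed
  moreover have "inv_into Y f (c \<cdot>\<^sub>v x) = c \<cdot>\<^sub>v inv_into Y f x" if "x \<in> Y" for x c
  proof -
    have "f (c \<cdot>\<^sub>v inv_into Y f x) = c \<cdot>\<^sub>v x"
      using assms inv that by (simp add: unitary_on_def)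
    thus ?thesis using inv Ycl that by metis
  qed
  moreover have "ip (inv_into Y f x) (inv_into Y f y) = ip x y" if "x \<in> Y" "y \<in> Y" for x y
    using assms inv that unfolding unitary_on_def by metis
  moreover have "inv_into Y f ` Y = Y"
    using bij_betw_inv_into[OF bij] by (simp add: bij_betw_def)
  ultimately show ?thesis
    using Ycl by (auto simp: unitary_on_def)
qed

text \<open>
  The map multiplies the direction of \<open>w\<close> by a scalar and is the identity on the complement of \<open>w\<close>.
  The condition on \<open>\<alpha>\<close> says that the scalar has modulus 1 (if \<open>w \<noteq> 0\<close>). It is symmetric in \<open>\<alpha>\<close> and
  \<open>cj \<alpha>\<close>, and the inverse is the same map for \<open>cj \<alpha>\<close>.
\<close>

lemma unitary_quasi_reflection:
  assumes w: "w \<in> Y" and \<alpha>: "\<alpha> * cj \<alpha> * ip w w = \<alpha> + cj \<alpha>"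
  shows "unitary_on Y (\<lambda>x\<in>Y. x - (\<alpha> * ip x w) \<cdot>\<^sub>v w)"
proof -
  define q where "q \<beta> x = x - (\<beta> * ip x w) \<cdot>\<^sub>v w" for \<beta> x
  have sub: "Y \<subseteq> ell2" using Y by (simp add: substructure_H_iff)
  have q_in: "q \<beta> x \<in> Y" if "x \<in> Y" for x \<beta>
    using Y that w substructure_diff[OF Y] by (simp add: q_def substructure_H_iff)
  have q_ip: "ip (q \<alpha> x) (q \<alpha> y) = ip x y" if "x \<in> Y" "y \<in> Y" for x y
  proof -
    have "x \<in> ell2" "y \<in> ell2" "w \<in> ell2" using that w sub by auto
    moreover from this have "cj (ip y w) = ip w y" by (simp add: ip_cj)
    ultimately have "ip (q \<alpha> x) (q \<alpha> y) = ip x y - cj \<alpha> * (ip w y * ip x w) - \<alpha> * (ip x w * ip w y)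
        + \<alpha> * cj \<alpha> * ip w w * (ip x w * ip w y)"
      by (simp add: q_def ip_simps cj_mult algebra_simps)
    also have "\<dots> = ip x y - (\<alpha> + cj \<alpha> - \<alpha> * cj \<alpha> * ip w w) * (ip x w * ip w y)"
      by (simp add: algebra_simps)
    finally show ?thesis by (simp only: \<alpha> diff_self mult_zero_left diff_zero)
  qed
  have q_inv: "q \<alpha> (q (cj \<alpha>) y) = y" if "y \<in> Y" for y
  proof -
    have el: "y \<in> ell2" "w \<in> ell2" using that w sub by auto
    define p where "p = ip y w"
    have "ip (q (cj \<alpha>) y) w = p - cj \<alpha> * p * ip w w"
      using el by (simp add: q_def ip_simps p_def)
    hence "\<alpha> * ip (q (cj \<alpha>) y) w = \<alpha> * (p - cj \<alpha> * p * ip w w)"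
      by (simp only:)
    also have "\<dots> = \<alpha> * p - (\<alpha> * cj \<alpha> * ip w w) * p"
      by (simp add: algebra_simps)
    also have "\<dots> = - (cj \<alpha> * p)" unfolding \<alpha> by (simp add: algebra_simps)
    finally show ?thesis
      by (simp add: q_def[of \<alpha>]) (simp add: q_def p_def fun_eq_iff)
  qed
  have "q \<alpha> ` Y = Y"
  proof
    show "Y \<subseteq> q \<alpha> ` Y"
    proof
      fix y assume "y \<in> Y"
      thus "y \<in> q \<alpha> ` Y" using q_inv[of y] q_in[of y "cj \<alpha>"] by (metis imageI)
    qed
  qed (use q_in in auto)
  moreover have "q \<alpha> (x + y) = q \<alpha> x + q \<alpha> y" if "x \<in> Y" "y \<in> Y" for x y
  proof -
    have "x \<in> ell2" "y \<in> ell2" "w \<in> ell2" using that w sub by auto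
    thus ?thesis by (simp add: q_def ip_simps fun_eq_iff algebra_simps)
  qed
  moreover have "q \<alpha> (c \<cdot>\<^sub>v x) = c \<cdot>\<^sub>v q \<alpha> x" if "x \<in> Y" for x c
  proof -
    have "x \<in> ell2" "w \<in> ell2" using that w sub by auto
    thus ?thesis by (simp add: q_def ip_simps fun_eq_iff algebra_simps)
  qed
  ultimately have "unitary_on Y (restrict (q \<alpha>) Y)"
    using q_ip Y by (auto simp: unitary_on_def substructure_H_iff)
  thus ?thesis unfolding q_def[abs_def] .
qed

text \<open>
  In the real case this is the reflection in the hyperplane between \<open>u\<close> and \<open>v\<close>. In general, the
  coefficient \<open>1 / ip u w\<close> for \<open>w = u - v\<close> is the one for which \<open>u\<close> is sent to \<open>u - w\<close>; equality of the
  norms of \<open>u\<close> and \<open>v\<close> is exactly what makes the resulting map isometric.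
\<close>

lemma unitary_moving_vector:
  assumes u: "u \<in> Y" and v: "v \<in> Y" and eq: "ip u u = ip v v"
  shows "\<exists>h. unitary_on Y h \<and> h u = v \<and> (\<forall>x\<in>Y. ip x u = ip x v \<longrightarrow> h x = x)"
proof (cases "u = v")
  case True
  thus ?thesis using unitary_on_id u by (intro exI[of _ "\<lambda>x\<in>Y. x"]) auto
next
  case False
  define w where "w = u - v"
  have w: "w \<in> Y" using u v by (simp add: w_def substructure_diff[OF Y])
  have el: "u \<in> ell2" "v \<in> ell2" "w \<in> ell2"
    using u v w Y by (auto simp: substructure_H_iff)
  define c where "c = ip u w"
  have ww: "ip w w = c + cj c"
  proof -
    have "cj c = ip w u" using el by (simp add: c_def ip_cj)
    thus ?thesis using el eq by (simp add: c_def w_def ip_simps)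
  qed
  have "c \<noteq> 0"
    using ww ip_self_eq_0[OF el(3)] False by (auto simp: w_def)
  hence \<alpha>: "(1 / c) * cj (1 / c) * ip w w = 1 / c + cj (1 / c)"
    by (simp add: ww cj_divide field_simps)
  let ?h = "\<lambda>x\<in>Y. x - (1 / c * ip x w) \<cdot>\<^sub>v w"
  have "unitary_on Y ?h" by (rule unitary_quasi_reflection[OF w \<alpha>])
  moreover have "?h u = v"
  proof -
    have "?h u = u - (1 / c * c) \<cdot>\<^sub>v w" using u by (simp only: restrict_apply' c_def)
    thus ?thesis using \<open>c \<noteq> 0\<close> by (simp add: w_def fun_eq_iff)
  qed
  moreover have "?h x = x" if "x \<in> Y" "ip x u = ip x v" for x
  proof -
    have "x \<in> ell2" using that Y by (auto simp: substructure_H_iff)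
    hence "ip x w = 0" using that el by (simp add: w_def ip_simps)
    thus ?thesis using that by (simp add: fun_eq_iff)
  qed
  ultimately show ?thesis by blast
qed

text \<open>
  If \<open>g\<close> already agrees with \<open>f\<close> on \<open>A\<close>, then \<open>g a\<close> and \<open>f a\<close> have the same inner products with all
  vectors of \<open>f ` A\<close>, so that the isometry moving \<open>g a\<close> to \<open>f a\<close> does not disturb these.
\<close>

lemma partial_isometry_extends:
  assumes "finite A" "A \<subseteq> Y" "\<And>a. a \<in> A \<Longrightarrow> f a \<in> Y"
    "\<And>a b. a \<in> A \<Longrightarrow> b \<in> A \<Longrightarrow> ip (f a) (f b) = ip a b"
  shows "\<exists>g. unitary_on Y g \<and> (\<forall>a\<in>A. g a = f a)"
  using assms
proof (induction A rule: finite_induct)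
  case empty
  thus ?case using unitary_on_id by auto
next
  case (insert a A)
  then obtain g where g: "unitary_on Y g" "\<And>b. b \<in> A \<Longrightarrow> g b = f b" by auto
  have a: "a \<in> Y" "g a \<in> Y" "f a \<in> Y" using insert.prems unitary_on_closed[OF g(1)] by auto
  have "ip (g a) (g a) = ip (f a) (f a)"
    using g(1) a insert.prems by (simp add: unitary_on_def)
  then obtain h where h: "unitary_on Y h" "h (g a) = f a"
    "\<And>x. x \<in> Y \<Longrightarrow> ip x (g a) = ip x (f a) \<Longrightarrow> h x = x"
    using unitary_moving_vector[OF a(2,3)] by blast
  have "h (g b) = f b" if b: "b \<in> A" for b
  proof -
    have bY: "b \<in> Y" using b insert.prems by auto
    have "ip (g b) (g a) = ip b a" using g(1) a bY by (simp add: unitary_on_def)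
    also have "\<dots> = ip (f b) (f a)" using b insert.prems by simp
    finally show ?thesis using h(3)[of "f b"] g(2)[OF b] b insert.prems by simp
  qed
  moreover have "unitary_on Y (compose Y h g)"
    by (rule unitary_on_compose[OF g(1) h(1)])
  ultimately show ?case
    using h(2) insert.prems by (intro exI[of _ "compose Y h g"]) (auto simp: compose_eq)
qed

lemma homogeneous_restrict: "homogeneous (restrict_structure H Y)"
  unfolding homogeneous_def
proof (intro allI impI; elim conjE)
  let ?X = "restrict_structure H Y"
  fix A' B' f
  assume fg: "finitely_generated ?X A'" "finitely_generated ?X B'" and f: "isomorphism ?X A' B' f"
  have subX: "substructure ?X Z \<longleftrightarrow> Z \<subseteq> Y \<and> substructure H Z" for Z
    using Y by (auto simp: substructure_def)
  obtain A where A: "finite A" "A \<subseteq> Y" "A' = substructure ?X hull A"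
    using fg(1) by (auto simp: finitely_generated_def)
  have AA': "A \<subseteq> A'" by (simp add: A hull_subset)
  have mem: "x \<in> A' \<longleftrightarrow> (\<forall>t. substructure ?X t \<longrightarrow> A \<subseteq> t \<longrightarrow> x \<in> t)" for x
    by (auto simp: A(3) hull_def)
  have subY: "substructure ?X Y" using Y by (simp add: subX)
  hence A'Y: "A' \<subseteq> Y" using mem A(2) by blast
  have A': "substructure H A'"
    unfolding substructure_H_iff
  proof (intro conjI ballI allI)
    show "A' \<subseteq> ell2" using A'Y Y by (auto simp: substructure_H_iff)
    show "0 \<in> A'" by (auto simp: mem subX substructure_H_iff)
    show "x + y \<in> A'" if "x \<in> A'" "y \<in> A'" for x y
      using that by (auto simp: mem subX substructure_H_iff)
    show "c \<cdot>\<^sub>v x \<in> A'" if "x \<in> A'" for c x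
      using that by (auto simp: mem subX substructure_H_iff)
  qed
  have B'Y: "B' \<subseteq> Y"
    using fg(2) subY hull_minimal[of _ Y "substructure ?X"] by (auto simp: finitely_generated_def)
  have f_add: "f (x + y) = f x + f y" if "x \<in> A'" "y \<in> A'" for x y
    using f that by (simp add: isomorphism_def)
  have f_scale: "f (c \<cdot>\<^sub>v x) = c \<cdot>\<^sub>v f x" if "x \<in> A'" for x c
    using f that by (simp add: isomorphism_def)
  have f_zero: "f 0 = 0" using f by (simp add: isomorphism_def)
  have "\<exists>g. unitary_on Y g \<and> (\<forall>a\<in>A. g a = f a)"
  proof (rule partial_isometry_extends[OF A(1,2)])
    show "f a \<in> Y" if "a \<in> A" for a
      using f that AA' B'Y by (auto simp: isomorphism_def bij_betw_def)
    show "ip (f a) (f b) = ip a b" if "a \<in> A" "b \<in> A" for a b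
    proof -
      have "a \<in> A'" "b \<in> A'" using that AA' by auto
      thus ?thesis using f by (simp add: isomorphism_def)
    qed
  qed
  then obtain g where g: "unitary_on Y g" "\<And>a. a \<in> A \<Longrightarrow> g a = f a" by blast
  \<comment> \<open>The maps agree on the generators, and the set on which they agree is a substructure.\<close>
  have "A' \<subseteq> {x \<in> A'. g x = f x}"
    unfolding A(3)
  proof (rule hull_minimal)
    have "substructure H {x \<in> A'. g x = f x}"
      using g(1) A' A'Y f_add f_scale f_zero unitary_on_0[OF g(1)]
      by (auto simp: substructure_H_iff unitary_on_def subset_iff)
    thus "substructure ?X {x \<in> substructure ?X hull A. g x = f x}"
      using A'Y by (auto simp: subX simp flip: A(3))
  qed (use AA' g(2) in \<open>auto simp flip: A(3)\<close>)
  thus "\<exists>g\<in>carrier (Aut ?X). \<forall>x\<in>A'. g x = f x"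
    using g(1) carrier_Aut_iff by blast
qed

end

end

section \<open>Decomposition into infinitely many blocks\<close>

text \<open>The coordinates of block \<open>k\<close>, reindexed by \<open>\<nat>\<close>.\<close>

definition slice :: "nat \<Rightarrow> (nat \<Rightarrow> 's) \<Rightarrow> nat \<Rightarrow> 's" where
  "slice k x = (\<lambda>m. x (prod_encode (k, m)))"

definition block_embed :: "nat \<Rightarrow> (nat \<Rightarrow> 's::zero) \<Rightarrow> nat \<Rightarrow> 's" where
  "block_embed k y = (\<lambda>n. case prod_decode n of (j, m) \<Rightarrow> if j = k then y m else 0)"

text \<open>
  A block matrix with one nonzero entry in each row of blocks: row \<open>k\<close> has \<open>\<phi> k\<close> in column \<open>\<sigma> k\<close>. Direct sums of
  operators and permutations of blocks are the special cases in which \<open>\<sigma>\<close>, respectively each \<open>\<phi> k\<close>,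
  is the identity.
\<close>

definition block_op ::
    "(nat \<Rightarrow> nat) \<Rightarrow> (nat \<Rightarrow> (nat \<Rightarrow> 's) \<Rightarrow> (nat \<Rightarrow> 's)) \<Rightarrow>
     (nat \<Rightarrow> 's::real_normed_field) \<Rightarrow> (nat \<Rightarrow> 's)" where
  "block_op \<sigma> \<phi> =
     (\<lambda>x\<in>ell2. \<lambda>n. case prod_decode n of (k, m) \<Rightarrow> \<phi> k (slice (\<sigma> k) x) m)"

definition block_space :: "nat \<Rightarrow> (nat \<Rightarrow> 's::real_normed_field) set" where
  "block_space k = {x \<in> ell2. \<forall>j. j \<noteq> k \<longrightarrow> slice j x = 0}"

text \<open>The inverse makes this a homomorphism and not an antihomomorphism.\<close>

definition block_perm :: "(nat \<Rightarrow> nat) \<Rightarrow> (nat \<Rightarrow> 's::real_normed_field) \<Rightarrow> (nat \<Rightarrow> 's)" where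
  "block_perm \<sigma> = block_op (inv_into UNIV \<sigma>) (\<lambda>k. \<lambda>x\<in>ell2. x)"

lemma slices_eqI: "(\<And>k. slice k x = slice k y) \<Longrightarrow> x = y"
  by (metis (no_types) ext prod_decode_inverse slice_def surj_pair)

lemma vscaled_0: "c \<cdot>\<^sub>v 0 = 0"
  by (simp add: fun_eq_iff)

lemma slice_add: "slice k (x + y) = slice k x + slice k y"
  and slice_scale: "slice k (c \<cdot>\<^sub>v x) = c \<cdot>\<^sub>v slice k x"
  and slice_0: "slice k 0 = 0"
  by (simp_all add: slice_def fun_eq_iff)

lemma slice_embed: "slice j (block_embed k y) = (if j = k then y else 0)"
  by (simp add: slice_def block_embed_def fun_eq_iff)

lemma embed_add: "block_embed k (x + y) = block_embed k x + block_embed k y"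
  and embed_scale: "block_embed k (c \<cdot>\<^sub>v x) = c \<cdot>\<^sub>v block_embed k x"
  and embed_0: "block_embed k 0 = 0"
  for x y :: "nat \<Rightarrow> 's::field"
  by (rule slices_eqI, simp add: slice_embed slice_add slice_scale slice_0 vscaled_0)+

lemma slice_block_op: "x \<in> ell2 \<Longrightarrow> slice k (block_op \<sigma> \<phi> x) = \<phi> k (slice (\<sigma> k) x)"
  by (simp add: block_op_def slice_def)

lemma ell2_slices_iff:
  "x \<in> ell2 \<longleftrightarrow> (\<forall>k. slice k x \<in> ell2) \<and> summable (\<lambda>k. nsq (slice k x))"
proof -
  let ?g = "\<lambda>n. (norm (x n))\<^sup>2"
  have nonneg: "summable f \<longleftrightarrow> f summable_on UNIV" if "\<And>n. f n \<ge> 0" for f :: "nat \<Rightarrow> real"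
    using summable_on_UNIV_nonneg_real_iff[of f] that by simp
  have slice: "slice k x \<in> ell2 \<longleftrightarrow> (\<lambda>m. ?g (prod_encode (k, m))) summable_on UNIV" for k
    by (simp add: ell2_def slice_def nonneg)
  have nsq: "nsq (slice k x) = infsum (\<lambda>m. ?g (prod_encode (k, m))) UNIV"
    if "slice k x \<in> ell2" for k
    using infsumI[OF norm_summable_imp_has_sum[OF _ summable_sums], of "\<lambda>m. ?g (prod_encode (k, m))"] that
    by (simp add: nsq_def slice_def ell2_def)
  have "x \<in> ell2 \<longleftrightarrow> ?g summable_on UNIV"
    by (simp add: ell2_def nonneg)
  also have "\<dots> \<longleftrightarrow> (\<lambda>p. ?g (prod_encode p)) summable_on UNIV"
    by (rule summable_on_reindex_bij_betw[OF bij_prod_encode, symmetric])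
  also have "\<dots> \<longleftrightarrow> (\<lambda>p. norm (?g (prod_encode p))) summable_on Sigma UNIV (\<lambda>_. UNIV)"
    by simp
  also have "\<dots> \<longleftrightarrow> (\<forall>k. (\<lambda>m. ?g (prod_encode (k, m))) summable_on UNIV) \<and>
      (\<lambda>k. infsum (\<lambda>m. ?g (prod_encode (k, m))) UNIV) summable_on UNIV"
    by (subst Infinite_Sum.abs_summable_on_Sigma_iff) (simp add: infsum_nonneg)
  also have "\<dots> \<longleftrightarrow> (\<forall>k. slice k x \<in> ell2) \<and> summable (\<lambda>k. nsq (slice k x))"
  proof (rule conj_cong)
    show "(\<forall>k. (\<lambda>m. ?g (prod_encode (k, m))) summable_on UNIV) \<longleftrightarrow> (\<forall>k. slice k x \<in> ell2)"
      by (simp add: slice)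
    assume "\<forall>k. slice k x \<in> ell2"
    hence "infsum (\<lambda>m. ?g (prod_encode (k, m))) UNIV = nsq (slice k x)" for k
      by (simp add: nsq)
    moreover have "(\<lambda>k. nsq (slice k x)) summable_on UNIV \<longleftrightarrow> summable (\<lambda>k. nsq (slice k x))"
      by (rule nonneg[symmetric]) (simp add: nsq_nonneg \<open>\<forall>k. slice k x \<in> ell2\<close>)
    ultimately show "(\<lambda>k. infsum (\<lambda>m. ?g (prod_encode (k, m))) UNIV) summable_on UNIV \<longleftrightarrow>
        summable (\<lambda>k. nsq (slice k x))"
      by (simp only:)
  qed
  finally show ?thesis .
qed

lemma slice_ell2: "x \<in> ell2 \<Longrightarrow> slice k x \<in> ell2"
  using ell2_slices_iff by blast

lemma embed_ell2: "y \<in> ell2 \<Longrightarrow> block_embed k y \<in> ell2"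
proof -
  assume "y \<in> ell2"
  moreover have "(\<lambda>j. nsq (slice j (block_embed k y))) = (\<lambda>j. if j = k then nsq y else 0)"
    by (auto simp: slice_embed nsq_def)
  ultimately show ?thesis
    by (auto simp: ell2_slices_iff[of "block_embed k y"] slice_embed)
qed

lemma embed_slice: "x \<in> block_space k \<Longrightarrow> block_embed k (slice k x) = x"
  by (rule slices_eqI) (auto simp: block_space_def slice_embed)

lemma embed_block_space: "y \<in> ell2 \<Longrightarrow> block_embed k y \<in> block_space k"
  by (simp add: block_space_def embed_ell2 slice_embed)

context hilbert_conj
begin

abbreviation "unitary \<equiv> unitary_on ell2"

lemmas unitary_closed = unitary_on_closed[OF substructure_ell2']
  and unitary_compose = unitary_on_compose[OF substructure_ell2']
  and unitary_id = unitary_on_id[OF substructure_ell2']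
  and unitary_inv = unitary_on_inv[OF substructure_ell2']
  and unitary_bij = unitary_on_bij[OF substructure_ell2']
  and unitary_0 = unitary_on_0[OF substructure_ell2']

lemma unitary_nsq: "unitary f \<Longrightarrow> x \<in> ell2 \<Longrightarrow> nsq (f x) = nsq x"
  using ip_self[of x] ip_self[of "f x"] unitary_closed[of f x] by (simp add: unitary_on_def)

lemma ip_slices:
  assumes "x \<in> ell2" "y \<in> ell2"
  shows "((\<lambda>k. ip (slice k x) (slice k y)) has_sum ip x y) UNIV"
proof -
  have ip: "((\<lambda>n. x n * cj (y n)) has_sum ip x y) UNIV" if "x \<in> ell2" "y \<in> ell2" for x y
    unfolding ip_def
    by (rule norm_summable_imp_has_sum[OF ip_bound(1) summable_sums[OF ip_summable]]) fact+
  let ?g = "\<lambda>p. x (prod_encode p) * cj (y (prod_encode p))"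
  have "(?g has_sum ip x y) (Sigma UNIV (\<lambda>_. UNIV))"
    using has_sum_reindex_bij_betw[OF bij_prod_encode, of "\<lambda>n. x n * cj (y n)"] ip[OF assms] by simp
  moreover have "((\<lambda>m. ?g (k, m)) has_sum ip (slice k x) (slice k y)) UNIV" for k
    using ip[OF slice_ell2 slice_ell2, OF assms, of k k] by (simp add: slice_def)
  ultimately show ?thesis
    by (rule has_sum_SigmaD)
qed

lemma ip_embed: "x \<in> ell2 \<Longrightarrow> y \<in> ell2 \<Longrightarrow> ip (block_embed k x) (block_embed k y) = ip x y"
proof -
  assume xy: "x \<in> ell2" "y \<in> ell2"
  have "((\<lambda>j. ip (slice j (block_embed k x)) (slice j (block_embed k y))) has_sum ip x y) UNIV"
  proof (rule has_sum_finite_neutralI[of "{k}"])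
  qed (auto simp: slice_embed)
  thus ?thesis
    using ip_slices[OF embed_ell2 embed_ell2, OF xy, of k k] has_sum_unique by blast
qed

lemma block_op_ell2:
  assumes "bij \<sigma>" "\<And>k. unitary (\<phi> k)" "x \<in> ell2"
  shows "block_op \<sigma> \<phi> x \<in> ell2"
proof -
  have "(\<lambda>k. nsq (slice k x)) summable_on UNIV"
    using assms(3) by (subst summable_on_UNIV_nonneg_real_iff)
      (auto simp: ell2_slices_iff[of x] nsq_nonneg slice_ell2)
  hence "(\<lambda>k. nsq (slice (\<sigma> k) x)) summable_on UNIV"
    using summable_on_reindex_bij_betw[OF assms(1), of "\<lambda>k. nsq (slice k x)"] by (simp only:)
  hence "summable (\<lambda>k. nsq (slice (\<sigma> k) x))"
    by (rule summable_on_imp_summable)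
  thus ?thesis
    using assms by (simp add: ell2_slices_iff[of "block_op \<sigma> \<phi> x"] slice_block_op unitary_nsq
      unitary_closed slice_ell2)
qed

lemma block_op_compose:
  assumes "bij \<rho>" "\<And>k. unitary (\<psi> k)"
  shows "compose ell2 (block_op \<sigma> \<phi>) (block_op \<rho> \<psi>) =
    block_op (\<rho> \<circ> \<sigma>) (\<lambda>k. compose ell2 (\<phi> k) (\<psi> (\<sigma> k)))"
proof
  fix x
  show "compose ell2 (block_op \<sigma> \<phi>) (block_op \<rho> \<psi>) x =
    block_op (\<rho> \<circ> \<sigma>) (\<lambda>k. compose ell2 (\<phi> k) (\<psi> (\<sigma> k))) x"
  proof (cases "x \<in> ell2")
    case True
    thus ?thesis
      by - (rule slices_eqI, simp add: compose_eq slice_block_op block_op_ell2[OF assms] slice_ell2)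
  next
    case False
    thus ?thesis by (simp add: compose_def block_op_def)
  qed
qed

lemma unitary_block_op:
  assumes \<sigma>: "bij \<sigma>" and \<phi>: "\<And>k. unitary (\<phi> k)"
  shows "unitary (block_op \<sigma> \<phi>)"
proof -
  have "block_op \<sigma> \<phi> ` ell2 = ell2"
  proof -
    define \<tau> where "\<tau> = inv_into UNIV \<sigma>"
    have \<tau>: "bij \<tau>" "\<tau> \<circ> \<sigma> = id"
      using \<sigma> by (auto simp: \<tau>_def bij_imp_bij_inv bij_is_inj)
    define \<psi> where "\<psi> k = restrict (inv_into ell2 (\<phi> (\<tau> k))) ell2" for k
    have \<psi>: "unitary (\<psi> k)" for k
      using unitary_inv[OF \<phi>] by (simp add: \<psi>_def)
    have "y \<in> block_op \<sigma> \<phi> ` ell2" if y: "y \<in> ell2" for y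
    proof
      show "y = block_op \<sigma> \<phi> (block_op \<tau> \<psi> y)"
      proof (rule slices_eqI)
        fix k
        have "\<psi> (\<sigma> k) = restrict (inv_into ell2 (\<phi> k)) ell2"
          using \<tau>(2) by (simp add: \<psi>_def fun_eq_iff)
        moreover have "inv_into ell2 (\<phi> k) z \<in> ell2" "\<phi> k (inv_into ell2 (\<phi> k) z) = z"
          if "z \<in> ell2" for z
          using unitary_bij[OF \<phi>, of k] that
          by (auto simp: bij_betw_def inv_into_into f_inv_into_f)
        ultimately show "slice k y = slice k (block_op \<sigma> \<phi> (block_op \<tau> \<psi> y))"
          using \<tau>(2) y by (simp add: slice_block_op block_op_ell2[OF \<tau>(1) \<psi>] slice_ell2 fun_eq_iff)
      qed
      show "block_op \<tau> \<psi> y \<in> ell2" using block_op_ell2[OF \<tau>(1) \<psi> y] .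
    qed
    hence "ell2 \<subseteq> block_op \<sigma> \<phi> ` ell2" by (rule subsetI)
    moreover have "block_op \<sigma> \<phi> ` ell2 \<subseteq> ell2"
      by (rule image_subsetI) (rule block_op_ell2[OF \<sigma> \<phi>])
    ultimately show ?thesis by (rule subset_antisym[rotated])
  qed
  moreover have "block_op \<sigma> \<phi> (x + y) = block_op \<sigma> \<phi> x + block_op \<sigma> \<phi> y"
    if "x \<in> ell2" "y \<in> ell2" for x y
  proof (rule slices_eqI)
    fix k
    have "\<phi> k (slice (\<sigma> k) x + slice (\<sigma> k) y) = \<phi> k (slice (\<sigma> k) x) + \<phi> k (slice (\<sigma> k) y)"
      using \<phi> that by (simp only: unitary_on_def slice_ell2)
    thus "slice k (block_op \<sigma> \<phi> (x + y)) = slice k (block_op \<sigma> \<phi> x + block_op \<sigma> \<phi> y)"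
      using that by (simp only: slice_block_op slice_add ell2_add)
  qed
  moreover have "block_op \<sigma> \<phi> (c \<cdot>\<^sub>v x) = c \<cdot>\<^sub>v block_op \<sigma> \<phi> x" if "x \<in> ell2" for x c
  proof (rule slices_eqI)
    fix k
    have "\<phi> k (c \<cdot>\<^sub>v slice (\<sigma> k) x) = c \<cdot>\<^sub>v \<phi> k (slice (\<sigma> k) x)"
      using \<phi> that by (simp only: unitary_on_def slice_ell2)
    thus "slice k (block_op \<sigma> \<phi> (c \<cdot>\<^sub>v x)) = slice k (c \<cdot>\<^sub>v block_op \<sigma> \<phi> x)"
      using that by (simp only: slice_block_op slice_scale ell2_vscaled)
  qed
  moreover have "ip (block_op \<sigma> \<phi> x) (block_op \<sigma> \<phi> y) = ip x y" if "x \<in> ell2" "y \<in> ell2" for x y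
  proof -
    have "((\<lambda>k. ip (slice (\<sigma> k) x) (slice (\<sigma> k) y)) has_sum ip x y) UNIV"
      using has_sum_reindex_bij_betw[OF \<sigma>, of "\<lambda>k. ip (slice k x) (slice k y)"] ip_slices[OF that] by simp
    moreover have "ip (slice k (block_op \<sigma> \<phi> x)) (slice k (block_op \<sigma> \<phi> y)) =
        ip (slice (\<sigma> k) x) (slice (\<sigma> k) y)" for k
      using that \<phi>[of k] by (simp add: slice_block_op slice_ell2 unitary_on_def)
    ultimately have "((\<lambda>k. ip (slice k (block_op \<sigma> \<phi> x)) (slice k (block_op \<sigma> \<phi> y)))
        has_sum ip x y) UNIV"
      by (simp only:)
    with ip_slices[OF block_op_ell2[OF \<sigma> \<phi> that(1)] block_op_ell2[OF \<sigma> \<phi> that(2)]]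
    show ?thesis by (rule has_sum_unique)
  qed
  ultimately show ?thesis
    by (simp add: unitary_on_def block_op_def)
qed

lemma unitary_block_perm: "bij \<sigma> \<Longrightarrow> unitary (block_perm \<sigma>)"
  by (simp add: block_perm_def unitary_block_op unitary_id bij_imp_bij_inv)

lemma slice_block_perm: "x \<in> ell2 \<Longrightarrow> slice k (block_perm \<sigma> x) = slice (inv_into UNIV \<sigma> k) x"
  by (simp add: block_perm_def slice_block_op slice_ell2)

lemma restrict_structure_ell2: "restrict_structure H ell2 = H"
  by (simp add: ell2_structure_def)

lemma carrier_Aut_H: "f \<in> carrier (Aut H) \<longleftrightarrow> unitary f"
  using carrier_Aut_iff[OF substructure_ell2'] by (simp add: restrict_structure_ell2)

lemma mult_Aut_H: "unitary f \<Longrightarrow> unitary g \<Longrightarrow> f \<otimes>\<^bsub>Aut H\<^esub> g = compose ell2 f g"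
  using unitary_bij by (simp add: Aut_def BijGroup_def Bij_def unitary_on_def)

lemma hom_block_perm: "block_perm \<in> hom Sym_nat (Aut H)"
proof (rule homI)
  fix \<sigma> \<rho> :: "nat \<Rightarrow> nat"
  assume "\<sigma> \<in> carrier Sym_nat" "\<rho> \<in> carrier Sym_nat"
  hence bij: "bij \<sigma>" "bij \<rho>" by (simp_all add: carrier_Sym_nat)
  have "compose ell2 (block_perm \<sigma>) (block_perm \<rho>) =
      block_op (inv_into UNIV \<rho> \<circ> inv_into UNIV \<sigma>)
        (\<lambda>k. compose ell2 (\<lambda>x\<in>ell2. x) (\<lambda>x\<in>ell2. x) :: (nat \<Rightarrow> 's) \<Rightarrow> nat \<Rightarrow> 's)"
    unfolding block_perm_def using bij by (simp add: block_op_compose bij_imp_bij_inv unitary_id)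
  also have "compose ell2 (\<lambda>x\<in>ell2. x) (\<lambda>x\<in>ell2. x) = (\<lambda>x\<in>ell2. x :: nat \<Rightarrow> 's)"
    by (auto simp: compose_def)
  also have "inv_into UNIV \<rho> \<circ> inv_into UNIV \<sigma> = inv_into UNIV (\<sigma> \<circ> \<rho>)"
    using bij by (simp add: o_inv_distrib)
  finally have "compose ell2 (block_perm \<sigma>) (block_perm \<rho>) =
      (block_perm (\<sigma> \<circ> \<rho>) :: (nat \<Rightarrow> 's) \<Rightarrow> _)"
    by (simp only: block_perm_def)
  thus "block_perm (\<sigma> \<otimes>\<^bsub>Sym_nat\<^esub> \<rho>) = block_perm \<sigma> \<otimes>\<^bsub>Aut H\<^esub> (block_perm \<rho> :: (nat \<Rightarrow> 's) \<Rightarrow> _)"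
    using bij by (simp add: mult_Sym_nat mult_Aut_H unitary_block_perm)
qed (simp add: carrier_Sym_nat carrier_Aut_H unitary_block_perm)

lemma block_perm_block_space:
  assumes "bij \<sigma>" shows "block_perm \<sigma> ` block_space k = (block_space (\<sigma> k) :: (nat \<Rightarrow> 's) set)"
proof -
  have sub: "block_perm \<sigma> ` block_space k \<subseteq> (block_space (\<sigma> k) :: (nat \<Rightarrow> 's) set)" if "bij \<sigma>" for \<sigma> k
  proof (rule image_subsetI)
    fix x :: "nat \<Rightarrow> 's" assume x: "x \<in> block_space k"
    have "slice j (block_perm \<sigma> x) = 0" if "j \<noteq> \<sigma> k" for j
    proof -
      have "inv_into UNIV \<sigma> j \<noteq> k"
        using \<open>bij \<sigma>\<close> that by (metis bij_inv_eq_iff)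
      thus ?thesis
        using x by (simp add: slice_block_perm block_space_def)
    qed
    moreover have "x \<in> ell2" using x by (simp add: block_space_def)
    ultimately show "block_perm \<sigma> x \<in> block_space (\<sigma> k)"
      using unitary_closed[OF unitary_block_perm[OF \<open>bij \<sigma>\<close>]] by (simp add: block_space_def)
  qed
  define \<tau> where "\<tau> = inv_into UNIV \<sigma>"
  have \<tau>: "bij \<tau>" "\<tau> (\<sigma> k) = k"
    using assms by (auto simp: \<tau>_def bij_imp_bij_inv bij_is_inj)
  have "y \<in> block_perm \<sigma> ` block_space k" if y: "y \<in> block_space (\<sigma> k)" for y :: "nat \<Rightarrow> 's"
  proof (rule image_eqI)
    have y2: "y \<in> ell2" using y by (simp add: block_space_def)
    show mem: "block_perm \<tau> y \<in> block_space k"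
      using sub[OF \<tau>(1), of "\<sigma> k"] y \<tau>(2) by auto
    have "block_perm \<tau> y \<in> ell2" using mem by (simp add: block_space_def)
    thus "y = block_perm \<sigma> (block_perm \<tau> y)"
      using y2 assms
      by - (rule slices_eqI,
        simp add: slice_block_perm \<tau>_def inv_inv_eq bij_is_inj bij_is_surj surj_f_inv_f)
  qed
  hence "block_space (\<sigma> k) \<subseteq> block_perm \<sigma> ` (block_space k :: (nat \<Rightarrow> 's) set)"
    by (rule subsetI)
  with sub[OF assms, of k] show ?thesis by (rule subset_antisym)
qed

section \<open>Every tuple is homogeneously isolated\<close>

definition unit_vec :: "nat \<Rightarrow> nat \<Rightarrow> 's" where
  "unit_vec n = (\<lambda>m. if m = n then 1 else 0)"

lemma unit_vec_ell2: "unit_vec n \<in> ell2"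
proof -
  have "(\<lambda>m. (norm (unit_vec n m))\<^sup>2) = (\<lambda>m. if m = n then 1 else 0)"
    by (auto simp: unit_vec_def)
  thus ?thesis by (simp add: ell2_def)
qed

lemma block_space_eq_iff: "block_space k = (block_space l :: (nat \<Rightarrow> 's) set) \<longleftrightarrow> k = l"
proof
  assume eq: "block_space k = (block_space l :: (nat \<Rightarrow> 's) set)"
  have "block_embed k (unit_vec 0) \<in> block_space k"
    by (rule embed_block_space[OF unit_vec_ell2])
  hence "k \<noteq> l \<Longrightarrow> slice k (block_embed k (unit_vec 0)) = 0"
    unfolding eq by (simp add: block_space_def)
  hence "k \<noteq> l \<Longrightarrow> unit_vec 0 0 = 0"
    by (simp add: slice_embed)
  thus "k = l"
    by (auto simp: unit_vec_def)
qed simp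

lemma substructure_block_space: "substructure H (block_space k)"
  by (auto simp: substructure_H_iff block_space_def slice_add slice_scale slice_0)

text \<open>
  Embedding into a block preserves all operations of the structure, so it commutes with the evaluation of
  terms. The same holds for the truth of quantifier-free formulas because it is injective.
\<close>

lemma val_embed:
  assumes "set a \<subseteq> ell2"
  shows "vec_vars t \<subseteq> {..<length a} \<Longrightarrow> vec_val H a t \<in> ell2 \<and>
      vec_val H (map (block_embed k) a) t = block_embed k (vec_val H a t)"
    and "scal_vars r \<subseteq> {..<length a} \<Longrightarrow> scal_val H (map (block_embed k) a) r = scal_val H a r"
proof (induction t and r)
  case (VVar i)
  thus ?case using assms nth_mem by auto
next
  case (SDist s t)
  let ?s = "vec_val H a s" and ?t = "vec_val H a t"
  have st: "?s \<in> ell2" "?t \<in> ell2" using SDist by auto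
  have "block_embed k ?s - block_embed k ?t = block_embed k (?s - ?t)"
    unfolding diff_eq_vscaled by (simp only: embed_add embed_scale)
  moreover have "nsq (block_embed k (?s - ?t)) = nsq (?s - ?t)"
    using ip_embed[of "?s - ?t" "?s - ?t" k] st by (simp add: ip_self ell2_diff embed_ell2)
  ultimately show ?case using SDist by simp
qed (auto simp: embed_add embed_scale embed_0 ip_embed)

lemma embed_inj: "block_embed k x = block_embed k y \<Longrightarrow> x = y"
  by (metis slice_embed)

lemma qf_sat_embed:
  assumes "set a \<subseteq> ell2"
  shows "qf_vars \<phi> \<subseteq> {..<length a} \<Longrightarrow> qf_sat H (map (block_embed k) a) \<phi> = qf_sat H a \<phi>"
  by (induction \<phi>) (auto simp: val_embed[OF assms] dest: embed_inj)

lemma unitary_slice: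
  assumes "unitary_on (block_space l) \<phi>"
  shows "unitary (\<lambda>y\<in>ell2. slice l (\<phi> (block_embed l y)))"
proof -
  define \<phi>' where "\<phi>' = (\<lambda>y\<in>ell2. slice l (\<phi> (block_embed l y)))"
  have \<phi>_in: "\<phi> x \<in> block_space l" if "x \<in> block_space l" for x
    using unitary_on_closed[OF substructure_block_space assms that] .
  have "unitary \<phi>'"
    unfolding unitary_on_def
  proof (intro conjI ballI allI)
    note mem = embed_block_space[of _ l]
    have \<phi>_add: "\<phi> (x + y) = \<phi> x + \<phi> y" if "x \<in> block_space l" "y \<in> block_space l" for x y
      using assms that by (simp add: unitary_on_def)
    have \<phi>_ip: "ip (\<phi> x) (\<phi> y) = ip x y" if "x \<in> block_space l" "y \<in> block_space l" for x y
      using assms that by (simp add: unitary_on_def)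
    have \<phi>_scale: "\<phi> (c \<cdot>\<^sub>v x) = c \<cdot>\<^sub>v \<phi> x" if "x \<in> block_space l" for x c
      using assms that by (simp add: unitary_on_def)
    show "\<phi>' ` ell2 = ell2"
    proof -
      have "y \<in> \<phi>' ` ell2" if y: "y \<in> ell2" for y
      proof -
        obtain x where x: "x \<in> block_space l" "\<phi> x = block_embed l y"
          using mem[OF y] assms unfolding unitary_on_def by (metis imageE)
        have "slice l x \<in> ell2" using x by (simp add: block_space_def slice_ell2)
        hence "\<phi>' (slice l x) = y"
          using x by (simp add: \<phi>'_def embed_slice slice_embed)
        thus ?thesis using \<open>slice l x \<in> ell2\<close> by blast
      qed
      moreover have "\<phi>' y \<in> ell2" if "y \<in> ell2" for y
        using \<phi>_in[OF mem[OF that]] that by (simp add: \<phi>'_def block_space_def slice_ell2)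
      ultimately show ?thesis by blast
    qed
    show "\<phi>' (x + y) = \<phi>' x + \<phi>' y" if "x \<in> ell2" "y \<in> ell2" for x y
      using that by (simp add: \<phi>'_def embed_add slice_add ell2_add \<phi>_add mem)
    show "\<phi>' (c \<cdot>\<^sub>v x) = c \<cdot>\<^sub>v \<phi>' x" if "x \<in> ell2" for x c
      using that by (simp add: \<phi>'_def embed_scale slice_scale ell2_vscaled \<phi>_scale mem)
    show "ip (\<phi>' x) (\<phi>' y) = ip x y" if "x \<in> ell2" "y \<in> ell2" for x y
    proof -
      have "block_embed l (\<phi>' z) = \<phi> (block_embed l z)" "\<phi>' z \<in> ell2" if "z \<in> ell2" for z
        using \<phi>_in[OF mem[OF that]] that
        by (auto simp: \<phi>'_def embed_slice block_space_def slice_ell2)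
      hence "ip (\<phi>' x) (\<phi>' y) = ip (\<phi> (block_embed l x)) (\<phi> (block_embed l y))"
        using that ip_embed[of "\<phi>' x" "\<phi>' y" l] by simp
      also have "\<dots> = ip (block_embed l x) (block_embed l y)"
        by (intro \<phi>_ip mem that)
      also have "\<dots> = ip x y"
        by (intro ip_embed that)
      finally show ?thesis .
    qed
  qed (simp add: \<phi>'_def)
  thus ?thesis by (simp add: \<phi>'_def)
qed

lemma block_automorphisms_amalgamate:
  assumes "\<And>l. unitary_on (block_space l) (\<phi> l)"
  shows "\<exists>\<psi>. unitary \<psi> \<and> (\<forall>l. \<forall>x\<in>block_space l. \<psi> x = \<phi> l x)"
proof -
  define \<phi>' where "\<phi>' l = (\<lambda>y\<in>ell2. slice l (\<phi> l (block_embed l y)))" for l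
  have \<phi>_in: "\<phi> l x \<in> block_space l" if "x \<in> block_space l" for l x
    using unitary_on_closed[OF substructure_block_space assms that] .
  have \<phi>': "unitary (\<phi>' l)" for l
    unfolding \<phi>'_def by (rule unitary_slice[OF assms])
  have "block_op id \<phi>' x = \<phi> l x" if x: "x \<in> block_space l" for l x
  proof (rule slices_eqI)
    fix k
    have x2: "x \<in> ell2" using x by (simp add: block_space_def)
    show "slice k (block_op id \<phi>' x) = slice k (\<phi> l x)"
    proof (cases "k = l")
      case True
      thus ?thesis using x x2 by (simp add: slice_block_op \<phi>'_def slice_ell2 embed_slice)
    next
      case False
      have "slice k (block_op id \<phi>' x) = \<phi>' k (slice k x)"
        using x2 by (simp only: slice_block_op id_apply)
      also have "slice k x = 0" using x False by (simp add: block_space_def)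
      also have "\<phi>' k 0 = 0" by (rule unitary_0[OF \<phi>'])
      also have "0 = slice k (\<phi> l x)" using \<phi>_in[OF x] False by (simp add: block_space_def)
      finally show ?thesis .
    qed
  qed
  thus ?thesis
    by (intro exI[of _ "block_op id \<phi>'"] conjI unitary_block_op bij_id \<phi>' allI ballI)
qed

theorem homogeneously_isolated_H:
  assumes a: "set a \<subseteq> ell2"
  shows "homogeneously_isolated H a"
proof -
  have "homogeneous H"
    using homogeneous_restrict[OF substructure_ell2'] by (simp add: restrict_structure_ell2)
  moreover have "\<forall>k. map (block_embed k) a \<in> realizations H (length a) (qftp H a) (block_space k)"
    using a embed_block_space qf_sat_embed[OF a] by (auto simp: realizations_def qftp_def)
  moreover have "\<forall>k. substructure H (block_space k) \<and>
      homogeneous (restrict_structure H (block_space k))"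
    by (simp add: homogeneous_restrict[OF substructure_block_space] substructure_block_space)
  moreover have "\<forall>\<phi>. (\<forall>l. \<phi> l \<in> carrier (Aut (restrict_structure H (block_space l)))) \<longrightarrow>
      (\<exists>\<psi>\<in>carrier (Aut H). \<forall>l. \<forall>x\<in>block_space l. \<psi> x = \<phi> l x)"
    using block_automorphisms_amalgamate
    by (simp add: carrier_Aut_iff[OF substructure_block_space] Bex_def carrier_Aut_H)
  moreover have "\<exists>e\<in>hom Sym_nat (Aut H). inj_on e (carrier Sym_nat) \<and>
      (\<forall>\<sigma>\<in>carrier Sym_nat. \<forall>k l. \<sigma> k = l \<longleftrightarrow> e \<sigma> ` block_space k = block_space l)"
  proof (intro bexI conjI)
    show "inj_on (block_perm :: _ \<Rightarrow> (nat \<Rightarrow> 's) \<Rightarrow> _) (carrier Sym_nat)"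
    proof (rule inj_onI)
      fix \<sigma> \<rho> assume *: "\<sigma> \<in> carrier Sym_nat" "\<rho> \<in> carrier Sym_nat"
        "block_perm \<sigma> = (block_perm \<rho> :: (nat \<Rightarrow> 's) \<Rightarrow> _)"
      have "block_space (\<sigma> k) = (block_space (\<rho> k) :: (nat \<Rightarrow> 's) set)" for k
        using * block_perm_block_space by (metis carrier_Sym_nat)
      thus "\<sigma> = \<rho>" by (simp add: block_space_eq_iff fun_eq_iff)
    qed
    show "\<forall>\<sigma>\<in>carrier Sym_nat. \<forall>k l. \<sigma> k = l \<longleftrightarrow>
        block_perm \<sigma> ` block_space k = (block_space l :: (nat \<Rightarrow> 's) set)"
      by (simp add: carrier_Sym_nat block_perm_block_space block_space_eq_iff)
  qed (rule hom_block_perm)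
  ultimately show ?thesis
    unfolding homogeneously_isolated_def using a
    by (intro conjI exI[of _ block_space] exI[of _ "\<lambda>k. map (block_embed k) a"]) simp_all
qed

section \<open>Orthonormal bases\<close>

definition orthonormal :: "(nat \<Rightarrow> 's) set \<Rightarrow> bool" where
  "orthonormal B \<longleftrightarrow> B \<subseteq> ell2 \<and> (\<forall>x\<in>B. \<forall>y\<in>B. ip x y = (if x = y then 1 else 0))"

definition orthonormal_seq :: "(nat \<Rightarrow> nat \<Rightarrow> 's) \<Rightarrow> bool" where
  "orthonormal_seq w \<longleftrightarrow> (\<forall>i. w i \<in> ell2) \<and> (\<forall>i j. ip (w i) (w j) = (if i = j then 1 else 0))"

lemma ip_unit_vec: "x \<in> ell2 \<Longrightarrow> ip x (unit_vec n) = x n"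
proof -
  assume "x \<in> ell2"
  have "(\<lambda>m. x m * cj (unit_vec n m)) = (\<lambda>m. if m = n then x m else 0)"
    by (auto simp: unit_vec_def)
  moreover have "(\<lambda>m. if m = n then x m else 0) sums x n"
    by (rule sums_single)
  ultimately show ?thesis by (simp add: ip_def sums_iff)
qed

lemma orthogonal_sym: "x \<in> ell2 \<Longrightarrow> y \<in> ell2 \<Longrightarrow> ip x y = 0 \<Longrightarrow> ip y x = 0"
  using ip_cj[of x y] by simp

lemma normalise:
  assumes "x \<in> ell2" "x \<noteq> 0"
  defines "r \<equiv> of_real (1 / sqrt (nsq x))"
  shows "ip (r \<cdot>\<^sub>v x) (r \<cdot>\<^sub>v x) = 1"
proof -
  have "nsq x > 0"
    using assms nsq_nonneg[of x] nsq_eq_0[of x] by fastforce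
  hence eq: "(1 / sqrt (nsq x)) * (1 / sqrt (nsq x)) * nsq x = 1"
    by (simp add: field_simps)
  have "ip (r \<cdot>\<^sub>v x) (r \<cdot>\<^sub>v x) = r * (cj r * ip x x)"
    using assms(1) by (simp add: ip_scale_left ip_scale_right ell2_vscaled)
  also have "\<dots> = of_real ((1 / sqrt (nsq x)) * (1 / sqrt (nsq x)) * nsq x)"
    unfolding r_def by (simp only: cj_of_real ip_self[OF assms(1)] of_real_mult mult.assoc)
  finally show ?thesis by (simp only: eq of_real_1)
qed

lemma ip_sum_right:
  "(\<And>i. i \<in> I \<Longrightarrow> x i \<in> ell2) \<Longrightarrow> z \<in> ell2 \<Longrightarrow> ip z (\<Sum>i\<in>I. x i) = (\<Sum>i\<in>I. ip z (x i))"
  by (induction I rule: infinite_finite_induct) (auto simp: ip_add_right ell2_sum)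

lemma nsq_orthonormal_sum:
  assumes w: "orthonormal_seq w" and "finite I"
  shows "nsq (\<Sum>i\<in>I. c i \<cdot>\<^sub>v w i) = (\<Sum>i\<in>I. (norm (c i))\<^sup>2)"
proof -
  have wl: "w i \<in> ell2" and on: "ip (w i) (w j) = (if i = j then 1 else 0)" for i j
    using w by (auto simp: orthonormal_seq_def)
  have cl: "c i \<cdot>\<^sub>v w i \<in> ell2" for i by (simp add: ell2_vscaled wl)
  define S where "S = (\<Sum>i\<in>I. c i \<cdot>\<^sub>v w i)"
  have Sl: "S \<in> ell2" unfolding S_def by (rule ell2_sum[OF cl])
  have wS: "ip (w i) S = cj (c i)" if "i \<in> I" for i
  proof -
    have "ip (w i) S = (\<Sum>j\<in>I. cj (c j) * ip (w i) (w j))"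
      unfolding S_def by (simp add: ip_sum_right cl wl ip_scale_right)
    also have "\<dots> = (\<Sum>j\<in>I. if j = i then cj (c i) else 0)"
      by (intro sum.cong refl) (auto simp: on)
    also have "\<dots> = cj (c i)" using that \<open>finite I\<close> by simp
    finally show ?thesis .
  qed
  have "ip S S = (\<Sum>i\<in>I. ip (c i \<cdot>\<^sub>v w i) S)"
    by (subst (1) S_def) (rule ip_sum_left[OF cl Sl])
  also have "\<dots> = (\<Sum>i\<in>I. of_real ((norm (c i))\<^sup>2))"
    by (intro sum.cong refl) (simp only: ip_scale_left wl Sl wS mult_cj)
  finally have "of_real (nsq S) = (of_real (\<Sum>i\<in>I. (norm (c i))\<^sup>2) :: 's)"
    using ip_self[OF Sl] by simp
  hence "nsq S = (\<Sum>i\<in>I. (norm (c i))\<^sup>2)" by (simp only: of_real_eq_iff)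
  thus ?thesis by (simp only: S_def)
qed

lemma bessel:
  assumes F: "finite F" "orthonormal F" and x: "x \<in> ell2"
  shows "(\<Sum>b\<in>F. (norm (ip x b))\<^sup>2) \<le> nsq x"
proof -
  have Fl: "b \<in> ell2" if "b \<in> F" for b using F that by (auto simp: orthonormal_def)
  define p where "p = (\<Sum>b\<in>F. ip x b \<cdot>\<^sub>v b)"
  define S where "S = (\<Sum>b\<in>F. (norm (ip x b))\<^sup>2)"
  have pl: "p \<in> ell2" unfolding p_def by (intro ell2_sum ell2_vscaled Fl)
  have pb: "ip p b = ip x b" if "b \<in> F" for b
  proof -
    have "ip p b = (\<Sum>b'\<in>F. ip x b' * ip b' b)"
      unfolding p_def using that by (simp add: ip_sum_left Fl ell2_vscaled ip_scale_left)
    also have "\<dots> = (\<Sum>b'\<in>F. if b' = b then ip x b else 0)"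
      using F(2) that by (intro sum.cong refl) (auto simp: orthonormal_def)
    also have "\<dots> = ip x b" using F(1) that by simp
    finally show ?thesis .
  qed
  have S: "ip z p = of_real S" if "z \<in> ell2" "\<And>b. b \<in> F \<Longrightarrow> ip z b = ip x b" for z
  proof -
    have "ip z p = (\<Sum>b\<in>F. cj (ip x b) * ip z b)"
      unfolding p_def using that(1) by (simp add: ip_sum_right Fl ell2_vscaled ip_scale_right)
    also have "\<dots> = (\<Sum>b\<in>F. of_real ((norm (ip x b))\<^sup>2))"
      using that(2) by (intro sum.cong refl) (metis mult.commute mult_cj)
    finally show ?thesis by (simp add: S_def)
  qed
  have xp: "ip x p = of_real S" using S[OF x] by simp
  have pp: "ip p p = of_real S" using S[OF pl pb] .
  have px: "ip p x = of_real S" using ip_cj[OF x pl] by (simp add: xp)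
  have "of_real (nsq (x - p)) = (of_real (nsq x - S) :: 's)"
    using ip_self[OF ell2_diff[OF x pl]] ip_self[OF x]
    by (simp add: ip_simps x pl xp pp px)
  hence "nsq x - S = nsq (x - p)" by (simp only: of_real_eq_iff)
  thus ?thesis using nsq_nonneg[OF ell2_diff[OF x pl]] by (simp add: S_def)
qed

text \<open>
  By Bessel's inequality for the \<open>n\<close>-th unit vector, the \<open>n\<close>-th coordinates of the members of \<open>B\<close> are
  square-summable, so that only countably many of them are nonzero.
\<close>

lemma orthonormal_countable:
  assumes B: "orthonormal B" shows "countable B"
proof -
  have "countable {b \<in> B. b n \<noteq> 0}" for n
  proof -
    have "(\<lambda>b. (norm (b n))\<^sup>2) summable_on B"
    proof (rule nonneg_bdd_above_summable_on)
      have "(\<Sum>b\<in>F. (norm (b n))\<^sup>2) \<le> nsq (unit_vec n)" if F: "F \<subseteq> B" "finite F" for F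
      proof -
        have "orthonormal F" using B F(1) by (auto simp: orthonormal_def subset_iff)
        moreover have "norm (ip (unit_vec n) b) = norm (b n)" if "b \<in> F" for b
        proof -
          have "b \<in> ell2" using B F(1) that by (auto simp: orthonormal_def)
          thus ?thesis by (metis ip_cj ip_unit_vec norm_cj unit_vec_ell2)
        qed
        ultimately show ?thesis using bessel[OF F(2) _ unit_vec_ell2, of n] by simp
      qed
      thus "bdd_above (sum (\<lambda>b. (norm (b n))\<^sup>2) ` {F. F \<subseteq> B \<and> finite F})"
        by (intro bdd_aboveI[of _ "nsq (unit_vec n)"]) auto
    qed simp
    from summable_countable_real[OF this] show ?thesis by simp
  qed
  hence "countable (\<Union>n. {b \<in> B. b n \<noteq> 0})" by simp
  moreover have "B \<subseteq> (\<Union>n. {b \<in> B. b n \<noteq> 0})"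
  proof
    fix b assume "b \<in> B"
    hence "ip b b = 1" using B by (simp add: orthonormal_def)
    hence "b \<noteq> 0" by auto
    with \<open>b \<in> B\<close> show "b \<in> (\<Union>n. {b \<in> B. b n \<noteq> 0})" by (auto simp: fun_eq_iff)
  qed
  ultimately show ?thesis by (rule countable_subset[rotated])
qed

lemma orthonormal_maximal:
  assumes "orthonormal A"
  shows "\<exists>B. A \<subseteq> B \<and> orthonormal B \<and> (\<forall>x\<in>ell2. (\<forall>b\<in>B. ip x b = 0) \<longrightarrow> x = 0)"
proof -
  let ?S = "{B. A \<subseteq> B \<and> orthonormal B}"
  have "\<exists>M\<in>?S. \<forall>X\<in>?S. M \<subseteq> X \<longrightarrow> X = M"
  proof (rule subset_Zorn_nonempty)
    show "?S \<noteq> {}" using assms by blast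
  next
    fix C assume C: "C \<noteq> {}" "subset.chain ?S C"
    obtain X where X: "X \<in> C" using C(1) by blast
    moreover have "A \<subseteq> X" using C(2) X by (auto simp: subset.chain_def)
    ultimately have "A \<subseteq> \<Union>C" by blast
    moreover have "orthonormal (\<Union>C)"
      unfolding orthonormal_def
    proof (intro conjI ballI)
      show "\<Union>C \<subseteq> ell2" using C by (auto simp: subset.chain_def orthonormal_def)
      fix x y assume "x \<in> \<Union>C" "y \<in> \<Union>C"
      then obtain X Y where XY: "X \<in> C" "x \<in> X" "Y \<in> C" "y \<in> Y" by blast
      hence "X \<subseteq> Y \<or> Y \<subseteq> X" using C(2) by (simp add: subset_chain_def)
      moreover have "orthonormal X" "orthonormal Y" using XY C(2) by (auto simp: subset.chain_def)
      ultimately show "ip x y = (if x = y then 1 else 0)"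
        using XY unfolding orthonormal_def by (metis subsetD)
    qed
    ultimately show "\<Union>C \<in> ?S" by simp
  qed
  then obtain B where B: "A \<subseteq> B" "orthonormal B"
    and max: "\<And>X. A \<subseteq> X \<Longrightarrow> orthonormal X \<Longrightarrow> B \<subseteq> X \<Longrightarrow> X = B"
    by auto
  have "x = 0" if x: "x \<in> ell2" "\<forall>b\<in>B. ip x b = 0" for x
  proof (rule ccontr)
    assume "x \<noteq> 0"
    define z where "z = of_real (1 / sqrt (nsq x)) \<cdot>\<^sub>v x"
    have z: "z \<in> ell2" "ip z z = 1"
      using x \<open>x \<noteq> 0\<close> normalise by (auto simp: z_def)
    have zb: "ip z b = 0" "ip b z = 0" if "b \<in> B" for b
    proof -
      have bl: "b \<in> ell2" using B(2) that by (auto simp: orthonormal_def)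
      show "ip z b = 0" using x that bl by (simp add: z_def ip_scale_left)
      thus "ip b z = 0" by (rule orthogonal_sym[OF z(1) bl])
    qed
    have "orthonormal (insert z B)"
      using B(2) z zb by (auto simp: orthonormal_def)
    hence "insert z B = B" using max[of "insert z B"] B(1) by blast
    hence "z \<in> B" by blast
    with zb(1)[of z] z(2) show False by simp
  qed
  with B show ?thesis by blast
qed

text \<open>
  Completeness of \<open>\<ell>\<^sub>2\<close>, in the form in which it is used: the sum \<open>t\<close> of the orthogonal series with
  coefficients \<open>c\<close> exists, and inner products may be taken termwise. The sum is built coordinatewise,
  and the tails \<open>r I\<close> of the series of \<open>c\<close> control the distance of \<open>t\<close> from the partial sums.
\<close>

lemma orthonormal_synthesis:
  assumes b: "orthonormal_seq b" and c: "c \<in> ell2"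
  shows "\<exists>t\<in>ell2. \<forall>y\<in>ell2. (\<lambda>i. c i * ip (b i) y) sums ip t y"
proof -
  have bl: "b i \<in> ell2" for i using b by (simp add: orthonormal_seq_def)
  define S where "S I = (\<Sum>i<I. c i \<cdot>\<^sub>v b i)" for I
  have Sl: "S I \<in> ell2" for I unfolding S_def by (intro ell2_sum ell2_vscaled bl)
  define r where "r I = nsq c - (\<Sum>i<I. (norm (c i))\<^sup>2)" for I
  have r_lim: "r \<longlonglongrightarrow> 0"
  proof -
    have "(\<lambda>I. \<Sum>i<I. (norm (c i))\<^sup>2) \<longlonglongrightarrow> nsq c"
      using c summable_LIMSEQ by (auto simp: ell2_def nsq_def)
    thus ?thesis unfolding r_def by (auto intro: tendsto_eq_intros)
  qed
  have diff: "nsq (S J - S I) \<le> r I" if "I \<le> J" for I J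
  proof -
    have split: "{..<J} = {..<I} \<union> {I..<J}" using that by auto
    have "S J = S I + (\<Sum>i\<in>{I..<J}. c i \<cdot>\<^sub>v b i)"
      unfolding S_def split by (rule sum.union_disjoint) auto
    hence "nsq (S J - S I) = (\<Sum>i\<in>{I..<J}. (norm (c i))\<^sup>2)"
      by (simp only: add_diff_cancel_left' nsq_orthonormal_sum[OF b finite_atLeastLessThan])
    moreover have "(\<Sum>i<J. (norm (c i))\<^sup>2) = (\<Sum>i<I. (norm (c i))\<^sup>2) + (\<Sum>i\<in>{I..<J}. (norm (c i))\<^sup>2)"
      unfolding split by (rule sum.union_disjoint) auto
    ultimately show ?thesis
      using sum_le_nsq[OF c, of "{..<J}"] by (simp add: r_def)
  qed
  have "Cauchy (\<lambda>I. S I n)" for n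
  proof (rule CauchyI')
    fix e :: real assume "e > 0"
    hence "\<forall>\<^sub>F I in sequentially. r I < e\<^sup>2"
      using r_lim by (intro order_tendstoD(2)) auto
    then obtain M where M: "r M' < e\<^sup>2" if "M' \<ge> M" for M' by (auto simp: eventually_sequentially)
    have "dist (S m n) (S k n) < e" if "m \<ge> M" "k > m" for m k
    proof -
      have "(norm ((S k - S m) n))\<^sup>2 \<le> nsq (S k - S m)"
        using sum_le_nsq[of "S k - S m" "{n}"] Sl by (simp add: ell2_diff)
      also have "\<dots> \<le> r m" using diff that by simp
      also have "\<dots> < e\<^sup>2" using M that by simp
      finally have "norm ((S k - S m) n) < e"
        using \<open>e > 0\<close> by (simp add: power_less_imp_less_base)
      thus ?thesis by (simp add: dist_norm norm_minus_commute)
    qed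
    thus "\<exists>M. \<forall>m\<ge>M. \<forall>n'>m. dist (S m n) (S n' n) < e" by blast
  qed
  hence "\<forall>n. \<exists>l. (\<lambda>I. S I n) \<longlonglongrightarrow> l"
    using Cauchy_convergent convergent_def by blast
  then obtain t where t: "\<And>n. (\<lambda>I. S I n) \<longlonglongrightarrow> t n" by metis
  have partial: "(\<Sum>n<N. (norm ((t - S I) n))\<^sup>2) \<le> r I" for N I
  proof (rule LIMSEQ_le_const2)
    have "(\<lambda>J. \<Sum>n<N. (norm (S J n - S I n))\<^sup>2) \<longlonglongrightarrow> (\<Sum>n<N. (norm (t n - S I n))\<^sup>2)"
      by (intro tendsto_intros t)
    thus "(\<lambda>J. \<Sum>n<N. (norm ((S J - S I) n))\<^sup>2) \<longlonglongrightarrow> (\<Sum>n<N. (norm ((t - S I) n))\<^sup>2)"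
      by simp
    have "(\<Sum>n<N. (norm ((S J - S I) n))\<^sup>2) \<le> r I" if "J \<ge> I" for J
      using sum_le_nsq[of "S J - S I" "{..<N}"] diff[OF that] Sl
      by (meson ell2_diff finite_lessThan order_trans)
    thus "\<exists>M. \<forall>J\<ge>M. (\<Sum>n<N. (norm ((S J - S I) n))\<^sup>2) \<le> r I" by blast
  qed
  have sm: "summable (\<lambda>n. (norm ((t - S I) n))\<^sup>2)" for I
    by (rule summableI_nonneg_bounded[OF _ partial]) simp
  hence tS: "t - S I \<in> ell2" for I unfolding ell2_def by blast
  have tS_nsq: "nsq (t - S I) \<le> r I" for I
    unfolding nsq_def by (rule suminf_le_const[OF sm partial])
  have tl: "t \<in> ell2" using ell2_add[OF tS Sl, of 0 0] by simp
  have "(\<lambda>i. c i * ip (b i) y) sums ip t y" if y: "y \<in> ell2" for y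
  proof -
    have Sy: "ip (S I) y = (\<Sum>i<I. c i * ip (b i) y)" for I
      unfolding S_def using y by (simp add: ip_sum_left ell2_vscaled bl ip_scale_left)
    have "(\<lambda>I. sqrt (r I) * sqrt (nsq y)) \<longlonglongrightarrow> sqrt 0 * sqrt (nsq y)"
      by (intro tendsto_intros r_lim)
    hence lim: "(\<lambda>I. sqrt (r I) * sqrt (nsq y)) \<longlonglongrightarrow> 0" by simp
    have "norm (ip (S I) y - ip t y) \<le> sqrt (r I) * sqrt (nsq y)" for I
    proof -
      have "norm (ip (S I) y - ip t y) = norm (ip (t - S I) y)"
        by (simp add: ip_diff_left tl Sl y norm_minus_commute)
      also have "\<dots> \<le> sqrt (nsq (t - S I)) * sqrt (nsq y)"
        by (rule ip_bound(2)[OF tS y])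
      also have "\<dots> \<le> sqrt (r I) * sqrt (nsq y)"
        using tS_nsq by (intro mult_right_mono real_sqrt_le_mono) (auto simp: nsq_nonneg y)
      finally show ?thesis .
    qed
    hence "(\<lambda>I. ip (S I) y - ip t y) \<longlonglongrightarrow> 0"
      by (intro Lim_null_comparison[OF _ lim] always_eventually allI)
    hence "(\<lambda>I. ip (S I) y) \<longlonglongrightarrow> ip t y" by (rule LIM_zero_cancel)
    thus ?thesis by (simp add: sums_def Sy)
  qed
  with tl show ?thesis by blast
qed

text \<open>
  Taking coefficients is isometric by Parseval's identity: \<open>x\<close> differs from the sum of its orthogonal series
  by a vector orthogonal to the basis. It is surjective because every square-summable sequence is the sequence of
  coefficients of a sum.
\<close>

lemma unitary_of_orthonormal_basis:
  assumes b: "orthonormal_seq b" and complete: "\<And>x. x \<in> ell2 \<Longrightarrow> (\<And>i. ip x (b i) = 0) \<Longrightarrow> x = 0"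
  shows "unitary (\<lambda>x\<in>ell2. \<lambda>i. ip x (b i))"
proof -
  have bl: "b i \<in> ell2" and on: "ip (b i) (b j) = (if i = j then 1 else 0)" for i j
    using b by (auto simp: orthonormal_seq_def)
  define U where "U x = (\<lambda>i. ip x (b i))" for x
  have inj: "inj b"
    by (rule injI) (metis on zero_neq_one)
  have Ul: "U x \<in> ell2" if x: "x \<in> ell2" for x
  proof -
    have "(\<Sum>i<N. (norm (U x i))\<^sup>2) \<le> nsq x" for N
    proof -
      have "orthonormal (b ` {..<N})"
        using bl on inj by (auto simp: orthonormal_def inj_eq)
      from bessel[OF _ this x] show ?thesis
        using inj by (simp add: sum.reindex inj_on_subset U_def)
    qed
    hence "summable (\<lambda>i. (norm (U x i))\<^sup>2)"
      by (intro summableI_nonneg_bounded[of _ "nsq x"]) simp_all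
    thus ?thesis by (simp add: ell2_def)
  qed
  have synth: "\<exists>t\<in>ell2. U t = c \<and> (\<forall>y\<in>ell2. (\<lambda>i. c i * ip (b i) y) sums ip t y)"
    if c: "c \<in> ell2" for c
  proof -
    obtain t where t: "t \<in> ell2" "\<And>y. y \<in> ell2 \<Longrightarrow> (\<lambda>i. c i * ip (b i) y) sums ip t y"
      using orthonormal_synthesis[OF b c] by blast
    have "ip t (b j) = c j" for j
    proof -
      have "(\<lambda>i. c i * ip (b i) (b j)) = (\<lambda>i. if i = j then c j else 0)"
        by (auto simp: on)
      hence "(\<lambda>i. if i = j then c j else 0) sums ip t (b j)"
        using t(2)[OF bl[of j]] by (simp only:)
      moreover have "(\<lambda>i. if i = j then c j else 0) sums c j"
        by (rule sums_single)
      ultimately show ?thesis by (rule sums_unique2)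
    qed
    hence "U t = c" by (simp add: U_def)
    with t show ?thesis by blast
  qed
  have Uip: "ip (U x) (U y) = ip x y" if x: "x \<in> ell2" and y: "y \<in> ell2" for x y
  proof -
    obtain t where t: "t \<in> ell2" "U t = U x" "\<And>y. y \<in> ell2 \<Longrightarrow> (\<lambda>i. U x i * ip (b i) y) sums ip t y"
      using synth[OF Ul[OF x]] by blast
    have "ip (x - t) (b i) = 0" for i
    proof -
      have "ip t (b i) = ip x (b i)" using t(2) by (auto simp: U_def fun_eq_iff)
      thus ?thesis by (simp add: ip_diff_left x t(1) bl)
    qed
    hence "x - t = 0" by (intro complete ell2_diff x t(1))
    hence xt: "x = t" by (rule iffD1[OF right_minus_eq])
    have "cj (U y i) = ip (b i) y" for i
      by (simp add: U_def ip_cj y bl)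
    hence "(\<lambda>i. U x i * cj (U y i)) sums ip x y"
      using t(3)[OF y] xt by simp
    thus ?thesis by (simp add: ip_def sums_iff)
  qed
  have "U ` ell2 = ell2"
  proof (rule subset_antisym)
    show "U ` ell2 \<subseteq> ell2" using Ul by (rule image_subsetI)
    show "ell2 \<subseteq> U ` ell2"
    proof
      fix c :: "nat \<Rightarrow> 's" assume "c \<in> ell2"
      from synth[OF this] obtain t where "t \<in> ell2" "U t = c" by blast
      thus "c \<in> U ` ell2" by (metis imageI)
    qed
  qed
  moreover have "U (x + y) = U x + U y" if "x \<in> ell2" "y \<in> ell2" for x y
    using that by (simp add: U_def fun_eq_iff ip_add_left bl)
  moreover have "U (a \<cdot>\<^sub>v x) = a \<cdot>\<^sub>v U x" if "x \<in> ell2" for x a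
    using that by (simp add: U_def fun_eq_iff ip_scale_left bl)
  ultimately have "unitary (restrict U ell2)"
    unfolding unitary_on_def by (simp add: Uip ell2_add ell2_vscaled)
  thus ?thesis unfolding U_def[abs_def] .
qed

lemma infinite_even_odd: "infinite {i::nat. even i}" "infinite {i::nat. odd i}"
proof -
  have "infinite (range (\<lambda>n::nat. 2 * n))" "infinite (range (\<lambda>n::nat. 2 * n + 1))"
    by (rule range_inj_infinite, simp add: inj_on_def)+
  moreover have "range (\<lambda>n::nat. 2 * n) \<subseteq> {i. even i}" "range (\<lambda>n::nat. 2 * n + 1) \<subseteq> {i. odd i}"
    by auto
  ultimately show "infinite {i::nat. even i}" "infinite {i::nat. odd i}"
    using infinite_super by blast+
qed

text \<open>
  Extend \<open>w\<close> to a basis. Enumerating it suitably, one lets the members of \<open>w\<close> with even index occupy the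
  positions in \<open>M\<close>; those with odd index guarantee that infinitely many basis vectors are left for the complement.
\<close>

lemma unitary_onto_coordinates:
  assumes w: "orthonormal_seq w" and M: "infinite M" "infinite (- M)"
  shows "\<exists>U \<iota>. unitary U \<and> (\<forall>n\<in>M. U (w (\<iota> n)) = unit_vec n)"
proof -
  have wl: "w i \<in> ell2" and on: "ip (w i) (w j) = (if i = j then 1 else 0)" for i j
    using w by (auto simp: orthonormal_seq_def)
  have inj: "inj w" by (rule injI) (metis on zero_neq_one)
  have "orthonormal (range w)"
    using wl on inj by (auto simp: orthonormal_def inj_eq)
  then obtain B where B: "range w \<subseteq> B" "orthonormal B"
    "\<And>x. x \<in> ell2 \<Longrightarrow> \<forall>b\<in>B. ip x b = 0 \<Longrightarrow> x = 0"
    using orthonormal_maximal by metis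
  define E where "E = w ` {i. even i}"
  have "w ` {i. odd i} \<subseteq> B - E"
    using B(1) inj by (auto simp: E_def inj_eq)
  moreover have "infinite (w ` {i. odd i})"
    using inj infinite_even_odd(2) by (auto simp: finite_image_iff inj_on_subset)
  ultimately have BE: "infinite (B - E)" by (rule infinite_super)
  have E: "infinite E"
    using inj infinite_even_odd(1) by (auto simp: E_def finite_image_iff inj_on_subset)
  have cB: "countable B" by (rule orthonormal_countable[OF B(2)])
  have EB: "E \<subseteq> B" using B(1) by (auto simp: E_def)
  have bij_ex: "\<exists>f. bij_betw f N X" if "infinite N" "infinite X" "countable X"
    for N :: "nat set" and X :: "(nat \<Rightarrow> 's) set"
    using bij_betw_trans[OF bij_betw_inv_into[OF bij_enumerate[OF that(1)]] bij_betw_from_nat_into[OF that(3,2)]]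
    by blast
  obtain \<beta> where \<beta>: "bij_betw \<beta> M E"
    using bij_ex[OF M(1) E] countable_subset[OF EB cB] by blast
  obtain \<gamma> where \<gamma>: "bij_betw \<gamma> (- M) (B - E)"
    using bij_ex[OF M(2) BE] cB by blast
  define b where "b n = (if n \<in> M then \<beta> n else \<gamma> n)" for n
  have b: "bij_betw b UNIV B"
    using bij_betw_disjoint_Un[OF \<beta> \<gamma>] EB unfolding b_def[abs_def] by (simp add: Un_absorb1)
  have bB: "b n \<in> B" for n using b by (auto simp: bij_betw_def)
  have b_on: "orthonormal_seq b"
    using B(2) bB b unfolding orthonormal_seq_def orthonormal_def bij_betw_def
    by (auto simp: inj_eq)
  define U where "U = (\<lambda>x\<in>ell2. \<lambda>i. ip x (b i))"
  have "unitary U"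
    unfolding U_def
  proof (rule unitary_of_orthonormal_basis[OF b_on])
    fix x assume x: "x \<in> ell2" "\<And>i. ip x (b i) = 0"
    have "\<forall>y\<in>B. ip x y = 0" using b x(2) by (auto simp: bij_betw_def)
    thus "x = 0" by (rule B(3)[OF x(1)])
  qed
  moreover have "\<exists>i. U (w i) = unit_vec n" if n: "n \<in> M" for n
  proof -
    have "b n \<in> E" using \<beta> n by (auto simp: b_def bij_betw_def)
    then obtain i where i: "b n = w i" by (auto simp: E_def)
    have "U (b n) = unit_vec n"
      using b_on by (auto simp: U_def orthonormal_seq_def unit_vec_def fun_eq_iff)
    thus ?thesis unfolding i by blast
  qed
  hence "\<exists>\<iota>. \<forall>n\<in>M. U (w (\<iota> n)) = unit_vec n" by metis
  ultimately show ?thesis by blast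
qed

lemma unitary_diagonal:
  assumes \<zeta>: "\<And>n. norm (\<zeta> n) = 1"
  shows "unitary (\<lambda>x\<in>ell2. \<lambda>n. \<zeta> n * x n)"
proof -
  have in2: "(\<lambda>n. \<xi> n * x n) \<in> ell2" if "x \<in> ell2" "\<And>n. norm (\<xi> n) = 1" for x \<xi> :: "nat \<Rightarrow> 's"
    using that by (simp add: ell2_def norm_mult)
  have one: "\<zeta> n * cj (\<zeta> n) = 1" for n by (simp add: mult_cj \<zeta>)
  have "(\<lambda>x\<in>ell2. \<lambda>n. \<zeta> n * x n) ` ell2 = ell2"
  proof (rule subset_antisym)
    show "(\<lambda>x\<in>ell2. \<lambda>n. \<zeta> n * x n) ` ell2 \<subseteq> ell2" using in2 \<zeta> by auto
    show "ell2 \<subseteq> (\<lambda>x\<in>ell2. \<lambda>n. \<zeta> n * x n) ` ell2"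
    proof
      fix y :: "nat \<Rightarrow> 's" assume y: "y \<in> ell2"
      have x: "(\<lambda>n. cj (\<zeta> n) * y n) \<in> ell2" by (rule in2[OF y]) (simp add: \<zeta>)
      show "y \<in> (\<lambda>x\<in>ell2. \<lambda>n. \<zeta> n * x n) ` ell2"
        by (rule image_eqI[OF _ x]) (simp add: x fun_eq_iff one flip: mult.assoc)
    qed
  qed
  moreover have "ip (\<lambda>n. \<zeta> n * x n) (\<lambda>n. \<zeta> n * y n) = ip x y" for x y
  proof -
    have "\<zeta> n * x n * cj (\<zeta> n * y n) = (\<zeta> n * cj (\<zeta> n)) * (x n * cj (y n))" for n
      by (simp add: cj_mult)
    thus ?thesis by (simp only: ip_def one mult_1_left)
  qed
  ultimately show ?thesis
    by (simp add: unitary_on_def ell2_add ell2_vscaled fun_eq_iff algebra_simps)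
qed

section \<open>Homomorphisms from the isometry group\<close>

lemma orthogonal_unit_vector:
  assumes "finite F" "F \<subseteq> ell2"
  shows "\<exists>x\<in>ell2. ip x x = 1 \<and> (\<forall>f\<in>F. ip x f = 0)"
proof -
  \<comment> \<open>The supports are kept finite and beyond \<open>N\<close> so that in the induction step two solutions with disjoint
    supports exist; their combination orthogonal to \<open>f\<close> is then nonzero.\<close>
  have "\<exists>x\<in>ell2. x \<noteq> 0 \<and> (\<forall>n<N. x n = 0) \<and> (\<exists>N'. \<forall>n\<ge>N'. x n = 0) \<and> (\<forall>f\<in>F. ip x f = 0)" for N
    using assms
  proof (induction F arbitrary: N rule: finite_induct)
    case empty
    have "unit_vec N \<noteq> 0" by (auto simp: unit_vec_def fun_eq_iff)
    moreover have "\<forall>n<N. unit_vec N n = 0" "\<forall>n\<ge>Suc N. unit_vec N n = 0"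
      by (auto simp: unit_vec_def)
    ultimately show ?case using unit_vec_ell2 by blast
  next
    case (insert f F)
    hence F: "F \<subseteq> ell2" and f: "f \<in> ell2" by auto
    obtain x N' where x: "x \<in> ell2" "x \<noteq> 0" "\<forall>n<N. x n = 0" "\<forall>n\<ge>N'. x n = 0" "\<forall>f\<in>F. ip x f = 0"
      using insert.IH[OF F, of N] by blast
    obtain y N'' where y: "y \<in> ell2" "y \<noteq> 0" "\<forall>n<max N N'. y n = 0" "\<forall>n\<ge>N''. y n = 0" "\<forall>f\<in>F. ip y f = 0"
      using insert.IH[OF F, of "max N N'"] by blast
    show ?case
    proof (cases "ip x f = 0")
      case True
      with x show ?thesis by blast
    next
      case False
      define c where "c = ip y f / ip x f"
      define z where "z = y - c \<cdot>\<^sub>v x"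
      have zl: "z \<in> ell2" by (simp add: z_def ell2_diff ell2_vscaled x y)
      obtain m where m: "y m \<noteq> 0" using y(2) by (auto simp: fun_eq_iff)
      hence "m \<ge> N'" using y(3) by (metis leI less_max_iff_disj)
      hence "z m \<noteq> 0" using m x(4) by (simp add: z_def)
      hence "z \<noteq> 0" by auto
      moreover have "\<forall>n<N. z n = 0" using x(3) y(3) by (simp add: z_def)
      moreover have "\<forall>n\<ge>max N' N''. z n = 0" using x(4) y(4) by (simp add: z_def)
      moreover have "ip z g = ip y g - c * ip x g" if "g \<in> ell2" for g
        using that x(1) y(1) by (simp add: z_def ip_diff_left ip_scale_left ell2_vscaled)
      hence "\<forall>g\<in>insert f F. ip z g = 0"
        using F f x(5) y(5) False by (auto simp: c_def)
      ultimately show ?thesis using zl by blast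
    qed
  qed
  then obtain x where x: "x \<in> ell2" "x \<noteq> 0" "\<forall>f\<in>F. ip x f = 0" by blast
  define z where "z = of_real (1 / sqrt (nsq x)) \<cdot>\<^sub>v x"
  have "z \<in> ell2" "ip z z = 1"
    using x(1,2) normalise by (auto simp: z_def)
  moreover have "\<forall>f\<in>F. ip z f = 0"
    using x assms(2) by (auto simp: z_def ip_scale_left)
  ultimately show ?thesis by blast
qed

text \<open>
  The isometry moving \<open>u\<close> to \<open>v\<close> of \<open>unitary_moving_vector\<close>, described by its eigenvector \<open>w\<close> and the
  eigenvalue \<open>\<zeta>\<close>. The last clause stands for membership of \<open>w\<close> in the span of \<open>u\<close> and \<open>v\<close>. For \<open>u = v\<close>
  the eigenvalue is 1 and \<open>w = u\<close>, so that a unit vector is available in this case as well.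
\<close>

lemma unit_quasi_reflection:
  assumes u: "u \<in> ell2" and v: "v \<in> ell2" and uv: "ip u u = 1" "ip v v = 1"
  shows "\<exists>w \<zeta>. w \<in> ell2 \<and> ip w w = 1 \<and> norm \<zeta> = 1 \<and> v = u + ((\<zeta> - 1) * ip u w) \<cdot>\<^sub>v w \<and>
    (\<forall>y\<in>ell2. ip u y = 0 \<longrightarrow> ip v y = 0 \<longrightarrow> ip w y = 0)"
proof (cases "u = v")
  case True
  thus ?thesis using assms by (intro exI[of _ u] exI[of _ 1]) (auto simp: fun_eq_iff)
next
  case False
  define w where "w = u - v"
  have w: "w \<in> ell2" "w \<noteq> 0" using u v False by (auto simp: w_def ell2_diff)
  define r where "r = (of_real (1 / sqrt (nsq w)) :: 's)"
  define z where "z = r \<cdot>\<^sub>v w"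
  have z: "z \<in> ell2" "ip z z = 1"
    using w normalise by (auto simp: z_def r_def)
  define c where "c = ip u w"
  have ww: "ip w w = c + cj c"
  proof -
    have "cj c = ip w u" using u w by (simp add: c_def ip_cj)
    thus ?thesis using u v uv by (simp add: c_def w_def ip_simps)
  qed
  have c0: "c \<noteq> 0" using ww ip_self_eq_0[OF w(1)] w(2) by auto
  define \<zeta> where "\<zeta> = - cj c / c"
  have "norm \<zeta> = 1" using c0 by (simp add: \<zeta>_def norm_divide)
  moreover have "v = u + ((\<zeta> - 1) * ip u z) \<cdot>\<^sub>v z"
  proof -
    have cjr: "cj r = r" by (simp only: r_def cj_of_real)
    have rr: "r * r * (c + cj c) = 1"
      using z(2) w(1) by (simp add: z_def ip_simps ww cjr mult.assoc)
    have "(\<zeta> - 1) * (r * c) * r = - (r * r * (c + cj c))"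
      using c0 by (simp add: \<zeta>_def field_simps)
    hence "(\<zeta> - 1) * (r * c) * r = - 1" using rr by simp
    moreover have "ip u z = r * c" using u w by (simp add: z_def ip_scale_right c_def cjr)
    ultimately have "((\<zeta> - 1) * ip u z) \<cdot>\<^sub>v z = (- 1) \<cdot>\<^sub>v w"
      by (simp add: z_def fun_eq_iff flip: mult.assoc)
    thus ?thesis by (simp add: w_def fun_eq_iff)
  qed
  moreover have "\<forall>y\<in>ell2. ip u y = 0 \<longrightarrow> ip v y = 0 \<longrightarrow> ip z y = 0"
    using u v w by (simp add: z_def ip_scale_left) (simp add: w_def ip_diff_left)
  ultimately show ?thesis using z by blast
qed

text \<open>
  Each \<open>x n\<close> is chosen orthogonal to \<open>x j\<close>, \<open>g (x j)\<close> and the preimage of \<open>x j\<close> under \<open>g\<close>, for \<open>j < n\<close>.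
  The preimages are needed for the orthogonality of \<open>g (x n)\<close> to the earlier \<open>x j\<close>.
\<close>

lemma orbit_orthogonal_sequence:
  assumes g: "unitary g"
  shows "\<exists>x. orthonormal_seq x \<and> (\<forall>i j. i \<noteq> j \<longrightarrow> ip (x i) (g (x j)) = 0)"
proof -
  define h where "h = restrict (inv_into ell2 g) ell2"
  have h: "unitary h" unfolding h_def by (rule unitary_inv[OF g])
  have gh: "g (h y) = y" if "y \<in> ell2" for y
    using that unitary_bij[OF g] by (auto simp: h_def bij_betw_def f_inv_into_f)
  have gip: "ip (g x) (g y) = ip x y" if "x \<in> ell2" "y \<in> ell2" for x y
    using g that by (simp add: unitary_on_def)
  define P where "P x n r \<longleftrightarrow> r \<in> ell2 \<and> ip r r = 1 \<and>
    (\<forall>j<n. ip r (x j) = 0 \<and> ip r (g (x j)) = 0 \<and> ip r (h (x j)) = 0)"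
    for x :: "nat \<Rightarrow> nat \<Rightarrow> 's" and n :: nat and r
  have "\<exists>x. \<forall>n. P x n (x n)"
  proof (rule dependent_wellorder_choice)
    show "P x n r = P y n r" if "\<And>m. m < n \<Longrightarrow> x m = y m" for r x y n
      using that by (simp add: P_def)
  next
    fix n x assume IH: "\<And>m. m < n \<Longrightarrow> P x m (x m)"
    have xl: "x j \<in> ell2" if "j < n" for j using IH[OF that] by (simp add: P_def)
    let ?F = "x ` {..<n} \<union> (\<lambda>j. g (x j)) ` {..<n} \<union> (\<lambda>j. h (x j)) ` {..<n}"
    have "?F \<subseteq> ell2" using xl unitary_closed[OF g] unitary_closed[OF h] by auto
    then obtain r where "r \<in> ell2" "ip r r = 1" "\<forall>f\<in>?F. ip r f = 0"
      using orthogonal_unit_vector[of ?F] by auto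
    thus "\<exists>r. P x n r" unfolding P_def by blast
  qed
  then obtain x where x: "\<And>n. P x n (x n)" by blast
  have xl: "x n \<in> ell2" for n using x by (simp add: P_def)
  have gl: "g (x n) \<in> ell2" for n using unitary_closed[OF g xl] .
  have orth: "ip (x i) (x j) = 0" if "i \<noteq> j" for i j
  proof (cases "j < i")
    case True thus ?thesis using x[of i] by (simp add: P_def)
  next
    case False
    hence "i < j" using that by simp
    hence "ip (x j) (x i) = 0" using x[of j] by (simp add: P_def)
    thus ?thesis by (rule orthogonal_sym[OF xl xl])
  qed
  have gorth: "ip (x i) (g (x j)) = 0" if "i \<noteq> j" for i j
  proof (cases "j < i")
    case True thus ?thesis using x[of i] by (simp add: P_def)
  next
    case False
    hence "i < j" using that by simp
    hence "ip (x j) (h (x i)) = 0" using x[of j] by (simp add: P_def)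
    hence "ip (g (x j)) (g (h (x i))) = 0"
      using gip[OF xl unitary_closed[OF h xl]] by simp
    hence "ip (g (x j)) (x i) = 0" by (simp add: gh xl)
    thus ?thesis by (rule orthogonal_sym[OF gl xl])
  qed
  have "orthonormal_seq x"
    using x orth by (auto simp: orthonormal_seq_def P_def)
  with gorth show ?thesis by blast
qed

lemma infinite_off_block_0:
  "infinite {n. fst (prod_decode n) \<noteq> (0::nat)}" "infinite (- {n. fst (prod_decode n) \<noteq> (0::nat)})"
proof -
  have inf: "infinite (range (\<lambda>m::nat. prod_encode (k, m)))" for k
    by (rule range_inj_infinite) (auto simp: inj_on_def)
  show "infinite {n. fst (prod_decode n) \<noteq> (0::nat)}"
    by (rule infinite_super[OF _ inf[of 1]]) auto
  show "infinite (- {n. fst (prod_decode n) \<noteq> (0::nat)})"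
    by (rule infinite_super[OF _ inf[of 0]]) auto
qed

text \<open>
  The coordinates off block 0 are inner products with fixed vectors, so they are preserved by \<open>g\<close> and by its
  inverse. Hence \<open>g\<close> maps block 0 onto itself, and therefore the orthogonal complement of block 0 to itself.
\<close>

lemma fixes_coordinates_imp_block_op:
  assumes g: "unitary g" and fix_g: "\<And>n. fst (prod_decode n) \<noteq> 0 \<Longrightarrow> g (unit_vec n) = unit_vec n"
  shows "\<exists>f. unitary f \<and> g = block_op id (\<lambda>k. if k = 0 then f else (\<lambda>x\<in>ell2. x))"
proof -
  have slice_fix: "slice k (g x) = slice k x"
    if g: "unitary g" and fix_g: "\<And>n. fst (prod_decode n) \<noteq> 0 \<Longrightarrow> g (unit_vec n) = unit_vec n"
      and "x \<in> ell2" "k \<noteq> 0" for g x k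
  proof
    fix m
    let ?n = "prod_encode (k, m)"
    have "g x ?n = ip (g x) (g (unit_vec ?n))"
      using fix_g[of ?n] \<open>k \<noteq> 0\<close> by (simp add: ip_unit_vec unitary_closed[OF g \<open>x \<in> ell2\<close>])
    also have "\<dots> = ip x (unit_vec ?n)"
      using g \<open>x \<in> ell2\<close> unit_vec_ell2 by (simp add: unitary_on_def)
    finally show "slice k (g x) m = slice k x m"
      by (simp add: slice_def ip_unit_vec \<open>x \<in> ell2\<close>)
  qed
  define h where "h = restrict (inv_into ell2 g) ell2"
  have h: "unitary h" unfolding h_def by (rule unitary_inv[OF g])
  have gh: "g (h y) = y" and hg: "h (g y) = y" if "y \<in> ell2" for y
    using that unitary_bij[OF g] unitary_closed[OF g that]
    by (auto simp: h_def bij_betw_def f_inv_into_f)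
  have fix_h: "h (unit_vec n) = unit_vec n" if "fst (prod_decode n) \<noteq> 0" for n
    using hg[OF unit_vec_ell2, of n] by (simp add: fix_g[OF that])
  have g_slice: "slice k (g x) = slice k x" if "x \<in> ell2" "k \<noteq> 0" for x k
    by (rule slice_fix[OF g _ that]) (rule fix_g)
  have h_slice: "slice k (h x) = slice k x" if "x \<in> ell2" "k \<noteq> 0" for x k
    by (rule slice_fix[OF h _ that]) (rule fix_h)
  have gl: "g x \<in> ell2" and hl: "h x \<in> ell2" if "x \<in> ell2" for x
    using unitary_closed[OF g that] unitary_closed[OF h that] .
  have g_in: "g x \<in> block_space 0" and h_in: "h x \<in> block_space 0" if "x \<in> block_space 0" for x
    using that g_slice[of x] h_slice[of x] gl[of x] hl[of x] by (auto simp: block_space_def)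
  have "unitary_on (block_space 0) (restrict g (block_space 0))"
  proof -
    have "block_space 0 \<subseteq> g ` block_space 0"
    proof
      fix y :: "nat \<Rightarrow> 's" assume y: "y \<in> block_space 0"
      hence "y \<in> ell2" by (simp add: block_space_def)
      hence "y = g (h y)" by (simp add: gh)
      thus "y \<in> g ` block_space 0" using h_in[OF y] by (rule image_eqI)
    qed
    hence "g ` block_space 0 = block_space 0"
      using g_in by (intro subset_antisym image_subsetI)
    moreover have "x \<in> ell2" if "x \<in> block_space 0" for x :: "nat \<Rightarrow> 's"
      using that by (simp add: block_space_def)
    ultimately show ?thesis
      using g substructure_block_space[of 0] by (simp add: unitary_on_def substructure_H_iff)
  qed
  note f = unitary_slice[OF this]
  let ?f = "\<lambda>y\<in>ell2. slice 0 (restrict g (block_space 0) (block_embed 0 y))"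
  have f_eq: "?f y = slice 0 (g (block_embed 0 y))" if "y \<in> ell2" for y
    using that by (simp add: embed_block_space)
  have complement: "slice 0 (g x) = 0" if x: "x \<in> ell2" "slice 0 x = 0" for x
  proof -
    \<comment> \<open>The component \<open>z\<close> of \<open>g x\<close> in block 0 is the image of a vector of block 0, to which
      \<open>x\<close> is orthogonal; so \<open>z\<close> is orthogonal to \<open>g x\<close>, and hence 0.\<close>
    define z where "z = block_embed 0 (slice 0 (g x))"
    have z: "z \<in> block_space 0" "z \<in> ell2"
      using gl[OF x(1)] by (simp_all add: z_def embed_block_space slice_ell2 embed_ell2)
    have "((\<lambda>k. ip (slice k x) (slice k (h z))) has_sum ip x (h z)) UNIV"
      by (rule ip_slices[OF x(1) hl[OF z(2)]])
    moreover have "ip (slice k x) (slice k (h z)) = 0" for k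
      using x(2) h_in[OF z(1)] by (cases "k = 0") (simp_all add: block_space_def)
    ultimately have "((\<lambda>k::nat. 0) has_sum ip x (h z)) UNIV" by (simp only:)
    hence "ip x (h z) = 0" by (rule has_sum_unique) (simp add: has_sum_0)
    hence "ip (g x) (g (h z)) = 0"
      using g x(1) hl[OF z(2)] by (simp add: unitary_on_def)
    hence gz: "ip (g x) z = 0" by (simp add: gh z)
    have "((\<lambda>k. ip (slice k (g x)) (slice k z)) has_sum ip (slice 0 (g x)) (slice 0 (g x))) UNIV"
      by (rule has_sum_finite_neutralI[of "{0}"]) (auto simp: z_def slice_embed)
    hence "ip (slice 0 (g x)) (slice 0 (g x)) = ip (g x) z"
      by (rule has_sum_unique[OF _ ip_slices[OF gl[OF x(1)] z(2)]])
    thus ?thesis using gz ip_self_eq_0 slice_ell2[OF gl[OF x(1)]] by simp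
  qed
  have "g = block_op id (\<lambda>k. if k = 0 then ?f else (\<lambda>x\<in>ell2. x))" (is "g = ?B")
  proof
    fix x show "g x = ?B x"
    proof (cases "x \<in> ell2")
      case True
      define x0 where "x0 = block_embed 0 (slice 0 x)"
      have x0: "x0 \<in> ell2" by (simp add: x0_def embed_ell2 slice_ell2 True)
      have "slice 0 (x - x0) = 0"
        by (simp add: diff_eq_vscaled slice_add slice_scale x0_def slice_embed) (simp add: fun_eq_iff)
      hence "slice 0 (g (x - x0)) = 0" by (intro complement ell2_diff True x0)
      moreover have "g (x - x0) + g x0 = g x"
        using unitary_on_diff[OF substructure_ell2' g True x0] by simp
      hence "slice 0 (g x) = slice 0 (g (x - x0)) + slice 0 (g x0)"
        by (metis slice_add)
      ultimately have "slice 0 (g x) = slice 0 (g x0)" by simp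
      hence zero: "slice 0 (g x) = ?f (slice 0 x)"
        using f_eq[OF slice_ell2[OF True]] by (simp only: x0_def)
      show ?thesis
      proof (rule slices_eqI)
        fix k show "slice k (g x) = slice k (?B x)"
        proof (cases "k = 0")
          case True
          thus ?thesis using zero \<open>x \<in> ell2\<close> by (simp only: slice_block_op id_apply simp_thms if_True)
        next
          case False
          thus ?thesis using g_slice[OF \<open>x \<in> ell2\<close> False] \<open>x \<in> ell2\<close>
            by (simp add: slice_block_op slice_ell2)
        qed
      qed
    next
      case False
      thus ?thesis using g by (simp add: unitary_on_def extensional_def block_op_def)
    qed
  qed
  with f show ?thesis by (intro exI[of _ ?f] conjI)
qed

end

text \<open>
  Swaps \<open>3m + 1\<close> with \<open>3m + 3\<close>. Together with \<open>std_involution\<close>, which swaps \<open>3m\<close> with \<open>3m + 1\<close>, it generates an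
  infinite dihedral group: the composition of the two moves along the bi-infinite path
  \<open>\<dots>, 4, 1, 0, 3, 6, \<dots>\<close>, on which the multiples of 3 form a half-line with end point 0.
\<close>

definition block_swap :: "nat \<Rightarrow> nat" where
  "block_swap n = (if n mod 3 = 1 then n + 2 else if n mod 3 = 0 \<and> n > 0 then n - 2 else n)"

lemma block_swap_simps:
  "block_swap 0 = 0" "block_swap (3 * m + 1) = 3 * m + 3" "block_swap (3 * m + 2) = 3 * m + 2"
  "block_swap (3 * m + 3) = 3 * m + 1"
proof -
  have "(3 * m + 1) mod 3 = 1" "(3 * m + 2) mod 3 = 2" "(3 * m + 3) mod 3 = 0" by presburger+
  thus "block_swap 0 = 0" "block_swap (3 * m + 1) = 3 * m + 3"
    "block_swap (3 * m + 2) = 3 * m + 2" "block_swap (3 * m + 3) = 3 * m + 1"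
    unfolding block_swap_def by simp_all
qed

lemma std_involution_simps:
  "std_involution (3 * m) = 3 * m + 1" "std_involution (3 * m + 1) = 3 * m"
  "std_involution (3 * m + 2) = 3 * m + 2"
proof -
  have "(3 * m) mod 3 = 0" "(3 * m + 1) mod 3 = 1" "(3 * m + 2) mod 3 = 2" by presburger+
  thus "std_involution (3 * m) = 3 * m + 1" "std_involution (3 * m + 1) = 3 * m"
    "std_involution (3 * m + 2) = 3 * m + 2"
    unfolding std_involution_def by simp_all
qed

lemma residue_cases:
  obtains "n = 0" | m where "n = 3 * m + 3" | m where "n = 3 * m + 1" | m where "n = 3 * m + (2::nat)"
proof -
  have "n = 0 \<or> (\<exists>m. n = 3 * m + 3) \<or> (\<exists>m. n = 3 * m + 1) \<or> (\<exists>m. n = 3 * m + 2)"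
    by presburger
  thus ?thesis using that by blast
qed

lemma moiety_involution_block_swap: "moiety_involution block_swap"
proof -
  have "block_swap (block_swap n) = n" for n
    by (cases n rule: residue_cases) (simp_all only: block_swap_simps)
  moreover have "infinite {n. block_swap n \<noteq> n}"
    by (rule infinite_super[OF _ infinite_residue_class[of 1]]) (auto simp: block_swap_def)
  moreover have "infinite {n. block_swap n = n}"
    by (rule infinite_super[OF _ infinite_residue_class[of 2]]) (auto simp: block_swap_def)
  ultimately show ?thesis by (simp add: moiety_involution_def)
qed

lemma shift_residue:
  assumes "k \<noteq> 0"
  shows "std_involution (block_swap k) mod 3 = 0 \<longleftrightarrow> k mod 3 = 0"
proof (cases k rule: residue_cases)
  case (2 m)
  hence "std_involution (block_swap k) = 3 * m"
    by (simp only: block_swap_simps std_involution_simps)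
  with 2 show ?thesis by presburger
next
  case (3 m)
  hence "std_involution (block_swap k) = std_involution (3 * (m + 1))"
    by (simp only: block_swap_simps distrib_left mult_1_right)
  also have "\<dots> = 3 * (m + 1) + 1" by (rule std_involution_simps)
  finally have eq: "std_involution (block_swap k) = 3 * (m + 1) + 1" .
  have "(3 * (m + 1) + 1) mod 3 = 1" "k mod 3 = 1" using 3 by presburger+
  thus ?thesis by (simp only: eq)
next
  case (4 m)
  thus ?thesis by (simp only: block_swap_simps std_involution_simps)
qed (use assms in simp)

locale hom_from_isometry_group = hilbert_conj cj + K: separable_cli_group K d
  for cj :: "'s::{real_normed_field, banach} \<Rightarrow> 's" and K :: "'k monoid" and d +
  fixes \<Phi> assumes \<Phi>: "\<Phi> \<in> hom (Aut (ell2_structure cj)) K"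
begin

lemma hom_val_closed: "unitary f \<Longrightarrow> \<Phi> f \<in> carrier K"
  using \<Phi> by (auto simp: hom_def carrier_Aut_H)

lemma hom_val_compose: "unitary f \<Longrightarrow> unitary g \<Longrightarrow> \<Phi> (compose ell2 f g) = \<Phi> f \<otimes>\<^bsub>K\<^esub> \<Phi> g"
  using \<Phi> by (auto simp: hom_def carrier_Aut_H mult_Aut_H)

lemma block_involution_in_kernel: "moiety_involution \<tau> \<Longrightarrow> \<Phi> (block_perm \<tau>) = \<one>\<^bsub>K\<^esub>"
proof -
  assume "moiety_involution \<tau>"
  moreover have "\<Phi> \<circ> block_perm \<in> hom Sym_nat K"
    by (rule homI) (simp_all add: hom_in_carrier[OF hom_block_perm] hom_in_carrier[OF \<Phi>]
      hom_mult[OF hom_block_perm] hom_mult[OF \<Phi>])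
  ultimately show ?thesis
    using K.hom_kills_moiety_involution[of "\<Phi> \<circ> block_perm" \<tau>] by simp
qed

text \<open>
  Let \<open>G\<close> act as \<open>f\<close> on block 0 and \<open>F\<close> as \<open>f\<close> on every third block. The shift \<open>T\<close> of the half-line of
  these blocks gives \<open>G (T F T\<^sup>-\<^sup>1) = F\<close>. As a product of two involutions \<open>T\<close> is in the kernel of \<open>\<Phi>\<close>,
  so that \<open>G\<close> is in the kernel, too.
\<close>

lemma one_block_in_kernel:
  assumes f: "unitary f"
  shows "\<Phi> (block_op id (\<lambda>k. if k = 0 then f else (\<lambda>x\<in>ell2. x))) = \<one>\<^bsub>K\<^esub>"
proof -
  let ?id = "\<lambda>x\<in>ell2. x :: nat \<Rightarrow> 's"
  define \<psi> where "\<psi> k = (if k = 0 then f else ?id)" for k :: nat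
  define \<phi> where "\<phi> k = (if k mod 3 = 0 then f else ?id)" for k :: nat
  have \<psi>: "unitary (\<psi> k)" and \<phi>: "unitary (\<phi> k)" for k
    using f unitary_id by (auto simp: \<psi>_def \<phi>_def)
  define T where "T = compose ell2 (block_perm block_swap) (block_perm std_involution :: (nat \<Rightarrow> 's) \<Rightarrow> _)"
  note perms = moiety_involution_block_swap moiety_involution_std
  note bijs = perms[THEN moiety_involution_bij]
  note us = unitary_block_perm[OF bijs(1)] unitary_block_perm[OF bijs(2)]
  have T: "unitary T" "\<Phi> T = \<one>\<^bsub>K\<^esub>"
    unfolding T_def using us by (simp_all add: unitary_compose hom_val_compose block_involution_in_kernel perms)
  have inv: "inv_into UNIV block_swap = block_swap" "inv_into UNIV std_involution = std_involution"
    using perms by (simp_all add: moiety_involution_inv)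
  have T_slice: "slice k (T x) = slice (std_involution (block_swap k)) x" if "x \<in> ell2" for k x
    unfolding T_def using that unitary_closed[OF us(2) that]
    by (simp add: compose_eq slice_block_perm inv)
  define F where "F = block_op id \<phi>"
  define G where "G = block_op id \<psi>"
  have F: "unitary F" and G: "unitary G"
    unfolding F_def G_def by (rule unitary_block_op[OF bij_id]; fact)+
  have "compose ell2 G (compose ell2 T F) = compose ell2 F T"
  proof
    fix x
    show "compose ell2 G (compose ell2 T F) x = compose ell2 F T x"
    proof (cases "x \<in> ell2")
      case True
      have mem: "F x \<in> ell2" "T (F x) \<in> ell2" "T x \<in> ell2"
        using unitary_closed[OF F True] unitary_closed[OF T(1) True]
          unitary_closed[OF T(1) unitary_closed[OF F True]] by simp_all
      have "slice k (G (T (F x))) = slice k (F (T x))" for k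
      proof -
        let ?j = "std_involution (block_swap k)"
        have "slice k (G (T (F x))) = \<psi> k (\<phi> ?j (slice ?j x))"
          using mem True by (simp add: G_def slice_block_op T_slice) (simp add: F_def slice_block_op)
        also have "\<dots> = \<phi> k (slice ?j x)"
        proof (cases "k = 0")
          case True
          hence "?j = 1" by (simp add: block_swap_simps std_involution_def)
          thus ?thesis using True slice_ell2[OF \<open>x \<in> ell2\<close>, of 1] by (simp add: \<psi>_def \<phi>_def)
        next
          case False
          thus ?thesis
            using shift_residue[OF False] slice_ell2[OF \<open>x \<in> ell2\<close>, of ?j] unitary_closed[OF f]
            by (simp add: \<psi>_def \<phi>_def)
        qed
        also have "\<dots> = slice k (F (T x))"
          using mem True by (simp add: F_def slice_block_op T_slice)
        finally show ?thesis .
      qed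
      hence "G (T (F x)) = F (T x)" by (rule slices_eqI)
      thus ?thesis using True by (simp add: compose_eq)
    qed (simp add: compose_def)
  qed
  hence "\<Phi> G \<otimes>\<^bsub>K\<^esub> (\<Phi> T \<otimes>\<^bsub>K\<^esub> \<Phi> F) = \<Phi> F \<otimes>\<^bsub>K\<^esub> \<Phi> T"
    using F G T(1) by (metis hom_val_compose unitary_compose)
  hence "\<Phi> G \<otimes>\<^bsub>K\<^esub> \<Phi> F = \<Phi> F"
    using T(2) hom_val_closed[OF F] by simp
  hence "\<Phi> G = \<one>\<^bsub>K\<^esub>"
    using hom_val_closed[OF F] hom_val_closed[OF G] by simp
  thus ?thesis by (simp only: G_def \<psi>_def[abs_def])
qed

lemma fixing_orthonormal_seq_in_kernel:
  assumes g: "unitary g" and w: "orthonormal_seq w" and fix_w: "\<And>i. g (w i) = w i"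
  shows "\<Phi> g = \<one>\<^bsub>K\<^esub>"
proof -
  define M where "M = {n. fst (prod_decode n) \<noteq> (0::nat)}"
  have "infinite M" "infinite (- M)"
    unfolding M_def by (rule infinite_off_block_0)+
  then obtain U \<iota> where U: "unitary U" "\<And>n. n \<in> M \<Longrightarrow> U (w (\<iota> n)) = unit_vec n"
    using unitary_onto_coordinates[OF w] by blast
  define V where "V = restrict (inv_into ell2 U) ell2"
  have V: "unitary V" unfolding V_def by (rule unitary_inv[OF U(1)])
  have VU: "V (U y) = y" if "y \<in> ell2" for y
    using that unitary_bij[OF U(1)] unitary_closed[OF U(1) that] by (auto simp: V_def bij_betw_def)
  define g' where "g' = compose ell2 (compose ell2 U g) V"
  have g': "unitary g'" unfolding g'_def by (intro unitary_compose V U(1) g)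
  have wl: "w i \<in> ell2" for i using w by (simp add: orthonormal_seq_def)
  have "g' (unit_vec n) = unit_vec n" if n: "n \<in> M" for n
  proof -
    have "V (unit_vec n) = w (\<iota> n)" using VU[OF wl] U(2)[OF n] by metis
    thus ?thesis using U(2)[OF n] by (simp add: g'_def compose_eq unit_vec_ell2 wl fix_w)
  qed
  then obtain f where f: "unitary f" "g' = block_op id (\<lambda>k. if k = 0 then f else (\<lambda>x\<in>ell2. x))"
    using fixes_coordinates_imp_block_op[OF g'] by (auto simp: M_def)
  hence "\<Phi> g' = \<one>\<^bsub>K\<^esub>" using one_block_in_kernel by simp
  moreover have "compose ell2 g' U = compose ell2 U g"
    using unitary_closed[OF U(1)] by (auto simp: g'_def compose_def VU fun_eq_iff)
  hence "\<Phi> g' \<otimes>\<^bsub>K\<^esub> \<Phi> U = \<Phi> U \<otimes>\<^bsub>K\<^esub> \<Phi> g"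
    using hom_val_compose g' U(1) g by metis
  ultimately show ?thesis
    using hom_val_closed[OF U(1)] hom_val_closed[OF g] by simp
qed

text \<open>
  The isometry \<open>u\<close> multiplies each of infinitely many orthonormal vectors \<open>w i\<close> by a scalar and fixes
  everything orthogonal to them. The scalars are chosen so that \<open>u\<close> sends \<open>g (x i)\<close> to \<open>x i\<close>. Infinitely many other
  \<open>w i\<close> are left fixed by \<open>u\<close>, so both \<open>u\<close> and the composition of \<open>u\<close> and \<open>g\<close> fix an infinite orthonormal sequence.
\<close>

theorem unitary_in_kernel:
  assumes g: "unitary g"
  shows "\<Phi> g = \<one>\<^bsub>K\<^esub>"
proof -
  obtain x where x: "orthonormal_seq x" "\<And>i j. i \<noteq> j \<Longrightarrow> ip (x i) (g (x j)) = 0"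
    using orbit_orthogonal_sequence[OF g] by blast
  have xl: "x i \<in> ell2" and x_on: "ip (x i) (x j) = (if i = j then 1 else 0)" for i j
    using x(1) by (auto simp: orthonormal_seq_def)
  have gl: "g (x i) \<in> ell2" for i by (rule unitary_closed[OF g xl])
  have g_on: "ip (g (x i)) (g (x j)) = (if i = j then 1 else 0)" for i j
    using g xl x_on[of i j] by (simp add: unitary_on_def)
  have gx: "ip (g (x j)) (x i) = 0" if "i \<noteq> j" for i j
    using x(2)[OF that] by (rule orthogonal_sym[OF xl gl])
  have "\<forall>i. \<exists>w \<zeta>. w \<in> ell2 \<and> ip w w = 1 \<and> norm \<zeta> = 1 \<and>
      x i = g (x i) + ((\<zeta> - 1) * ip (g (x i)) w) \<cdot>\<^sub>v w \<and>
      (\<forall>y\<in>ell2. ip (g (x i)) y = 0 \<longrightarrow> ip (x i) y = 0 \<longrightarrow> ip w y = 0)"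
    using g_on x_on by (intro allI unit_quasi_reflection gl xl) simp_all
  then obtain w \<zeta> where w: "\<And>i. w i \<in> ell2" "\<And>i. ip (w i) (w i) = 1" "\<And>i. norm (\<zeta> i) = 1"
    "\<And>i. x i = g (x i) + ((\<zeta> i - 1) * ip (g (x i)) (w i)) \<cdot>\<^sub>v w i"
    "\<And>i y. y \<in> ell2 \<Longrightarrow> ip (g (x i)) y = 0 \<Longrightarrow> ip (x i) y = 0 \<Longrightarrow> ip (w i) y = 0"
    by metis
  have w_perp: "ip (g (x j)) (w i) = 0" "ip (x j) (w i) = 0" if "i \<noteq> j" for i j
  proof -
    have "ip (w i) (g (x j)) = 0" using that by (intro w(5) gl) (simp_all add: g_on x(2))
    thus "ip (g (x j)) (w i) = 0" by (rule orthogonal_sym[OF w(1) gl])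
    have "ip (w i) (x j) = 0" using that by (intro w(5) xl) (simp_all add: x_on gx)
    thus "ip (x j) (w i) = 0" by (rule orthogonal_sym[OF w(1) xl])
  qed
  have "ip (w i) (w j) = 0" if "i \<noteq> j" for i j
    using w_perp[of j i] that by (intro w(5) w(1)) simp_all
  hence w_on: "orthonormal_seq w" using w(1,2) by (simp add: orthonormal_seq_def)
  define M where "M = {n. fst (prod_decode n) \<noteq> (0::nat)}"
  have "infinite M" "infinite (- M)"
    unfolding M_def by (rule infinite_off_block_0)+
  then obtain U \<iota> where U: "unitary U" "\<And>n. n \<in> M \<Longrightarrow> U (w (\<iota> n)) = unit_vec n"
    using unitary_onto_coordinates[OF w_on] by blast
  have Uip: "ip (U y) (U z) = ip y z" if "y \<in> ell2" "z \<in> ell2" for y z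
    using U(1) that by (simp add: unitary_on_def)
  have Ul: "U y \<in> ell2" if "y \<in> ell2" for y using unitary_closed[OF U(1) that] .
  have \<iota>_inj: "m = n" if "m \<in> M" "n \<in> M" "\<iota> m = \<iota> n" for m n
    using U(2)[OF that(1)] U(2)[OF that(2)] that(3) by (metis one_neq_zero unit_vec_def)
  define V where "V = restrict (inv_into ell2 U) ell2"
  have V: "unitary V" unfolding V_def by (rule unitary_inv[OF U(1)])
  have VU: "V (U y) = y" if "y \<in> ell2" for y
    using that unitary_bij[OF U(1)] Ul[OF that] by (auto simp: V_def bij_betw_def)
  \<comment> \<open>Block 1 of the coordinates is used to undo \<open>g\<close>, block 2 for the vectors left fixed.\<close>
  define \<xi> where "\<xi> n = (if fst (prod_decode n) = (1::nat) then \<zeta> (\<iota> n) else 1)" for n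
  define D where "D = (\<lambda>y\<in>ell2. \<lambda>n. \<xi> n * y n)"
  have D: "unitary D"
    unfolding D_def by (rule unitary_diagonal) (simp add: \<xi>_def w(3))
  define u where "u = compose ell2 (compose ell2 V D) U"
  have u: "unitary u" unfolding u_def by (intro unitary_compose V U(1) D)
  have u_eq: "u y = V (D (U y))" if "y \<in> ell2" for y
    using that Ul by (simp add: u_def compose_eq)
  have u_fix: "u (w (\<iota> n)) = w (\<iota> n)" if n: "fst (prod_decode n) = 2" for n
  proof -
    have nM: "n \<in> M" using n by (simp add: M_def)
    have "D (unit_vec n) = unit_vec n"
    proof
      have "\<xi> n = 1" using n by (simp add: \<xi>_def)
      thus "D (unit_vec n) m = unit_vec n m" for m
        by (simp add: D_def unit_vec_ell2) (simp add: unit_vec_def)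
    qed
    thus ?thesis using VU[OF w(1), of "\<iota> n"] by (simp add: u_eq w(1) U(2)[OF nM])
  qed
  have u_g: "u (g (x (\<iota> n))) = x (\<iota> n)" if n: "fst (prod_decode n) = 1" for n
  proof -
    let ?i = "\<iota> n"
    have nM: "n \<in> M" using n by (simp add: M_def)
    define a where "a = ip (g (x ?i)) (w ?i)"
    define y where "y = U (g (x ?i))"
    have y: "y \<in> ell2" by (simp add: y_def Ul gl)
    have y_coord: "y m = ip (g (x ?i)) (w (\<iota> m))" if "m \<in> M" for m
      using ip_unit_vec[OF y, of m] Uip[OF gl w(1), of ?i "\<iota> m"] by (simp add: y_def U(2)[OF that])
    have "U (x ?i) = U (g (x ?i) + ((\<zeta> ?i - 1) * a) \<cdot>\<^sub>v w ?i)"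
      using w(4)[of ?i] by (simp only: a_def)
    also have "\<dots> = y + ((\<zeta> ?i - 1) * a) \<cdot>\<^sub>v unit_vec n"
      using U(1) gl w(1) by (simp add: unitary_on_def ell2_vscaled y_def U(2)[OF nM])
    finally have Ux: "U (x ?i) = y + ((\<zeta> ?i - 1) * a) \<cdot>\<^sub>v unit_vec n" .
    have "D y m = U (x ?i) m" for m
    proof (cases "m = n")
      case True
      thus ?thesis using n y y_coord[OF nM]
        by (simp add: Ux D_def \<xi>_def unit_vec_def a_def algebra_simps)
    next
      case False
      have "\<xi> m * y m = y m"
      proof (cases "fst (prod_decode m) = 1")
        case True
        hence mM: "m \<in> M" by (simp add: M_def)
        have "\<iota> m \<noteq> ?i" using \<iota>_inj[OF mM nM] False by blast
        thus ?thesis using w_perp(1)[of "\<iota> m" ?i] by (simp add: y_coord[OF mM])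
      qed (simp add: \<xi>_def)
      thus ?thesis using False y by (simp add: Ux D_def unit_vec_def)
    qed
    hence "D y = U (x ?i)" by (rule ext)
    thus ?thesis using VU[OF xl, of ?i] by (simp add: u_eq gl y_def)
  qed
  have sub: "orthonormal_seq (\<lambda>m. v (\<iota> (prod_encode (k, m))))" if "orthonormal_seq v" "k \<noteq> 0" for v k
  proof -
    have "\<iota> (prod_encode (k, i)) = \<iota> (prod_encode (k, j)) \<longleftrightarrow> i = j" for i j
      using \<iota>_inj[of "prod_encode (k, i)" "prod_encode (k, j)"] that(2) by (auto simp: M_def)
    thus ?thesis using that(1) by (simp add: orthonormal_seq_def)
  qed
  have "\<Phi> u = \<one>\<^bsub>K\<^esub>"
    by (rule fixing_orthonormal_seq_in_kernel[OF u sub[OF w_on, of 2]]) (simp_all add: u_fix)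
  moreover have "\<Phi> (compose ell2 u g) = \<one>\<^bsub>K\<^esub>"
    by (rule fixing_orthonormal_seq_in_kernel[OF unitary_compose[OF g u] sub[OF x(1), of 1]])
       (simp_all add: compose_eq xl u_g)
  ultimately show ?thesis
    using hom_val_compose[OF u g] hom_val_closed[OF g] by simp
qed

end

section \<open>The real and the complex Hilbert space\<close>

lemma hilbert_conj_real: "hilbert_conj (\<lambda>x::real. x)"
  by standard (simp_all add: power2_eq_square)

lemma hilbert_conj_complex: "hilbert_conj cnj"
  by standard (simp_all only: complex_cnj_add complex_cnj_mult complex_norm_square)

lemma separable_cli_group_of_topological_group:
  assumes "topological_group K T" "separable_space T" "has_complete_left_invariant_metric K T"
  obtains d where "separable_cli_group K d"
proof -
  obtain d where d: "Metric_space (carrier K) d" "Metric_space.mtopology (carrier K) d = T"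
    "Metric_space.mcomplete (carrier K) d"
    "\<forall>g\<in>carrier K. \<forall>x\<in>carrier K. \<forall>y\<in>carrier K. d (g \<otimes>\<^bsub>K\<^esub> x) (g \<otimes>\<^bsub>K\<^esub> y) = d x y"
    using assms(3) by (auto simp: has_complete_left_invariant_metric_def)
  interpret Metric_space "carrier K" d by (rule d(1))
  have K: "group K" using assms(1) by (simp add: topological_group_def)
  have top: "topspace T = carrier K" using assms(1) by (simp add: topological_group_def)
  obtain C where C: "countable C" "C \<subseteq> carrier K" "T closure_of C = carrier K"
    using assms(2) unfolding separable_space_def top by blast
  have dense: "\<exists>y\<in>C. d y x < \<epsilon>" if "x \<in> carrier K" "\<epsilon> > 0" for x \<epsilon>
  proof -
    have "x \<in> mtopology closure_of C" using that C(3) d(2) by simp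
    hence "\<exists>y\<in>C. y \<in> mball x \<epsilon>" using that(2) by (auto simp: metric_closure_of)
    thus ?thesis by (auto simp: in_mball commute)
  qed
  have "C \<noteq> {}" using dense[OF group.is_monoid[OF K, THEN monoid.one_closed], of 1] by auto
  have "range (from_nat_into C) \<subseteq> carrier K"
    using from_nat_into[OF \<open>C \<noteq> {}\<close>] C(2) by auto
  moreover have "\<exists>i. d (from_nat_into C i) x < \<epsilon>" if "x \<in> carrier K" "\<epsilon> > 0" for x \<epsilon>
    using dense[OF that] from_nat_into_surj[OF C(1)] by metis
  ultimately have "separable_cli_group K d"
    using K d by (intro separable_cli_group.intro separable_cli_group_axioms.intro) blast+
  thus ?thesis by (rule that)
qed

lemma orthogonal_group_hom_trivial:
  assumes K: "separable_cli_group K d"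
    and \<Phi>: "\<Phi> \<in> hom orthogonal_group K" and g: "g \<in> carrier orthogonal_group"
  shows "\<Phi> g = \<one>\<^bsub>K\<^esub>"
proof -
  have Aut: "Aut (ell2_structure (\<lambda>x::real. x)) = orthogonal_group"
    using Aut_real_hilbert by (simp only: real_hilbert_def)
  have "\<Phi> \<in> hom (Aut (ell2_structure (\<lambda>x::real. x))) K"
    unfolding Aut by (rule \<Phi>)
  note hom = hom_from_isometry_group.intro[OF hilbert_conj_real K
      hom_from_isometry_group_axioms.intro[OF this]]
  have "g \<in> carrier (Aut (ell2_structure (\<lambda>x::real. x)))"
    unfolding Aut by (rule g)
  thus ?thesis
    by (intro hom_from_isometry_group.unitary_in_kernel[OF hom])
      (rule iffD1[OF hilbert_conj.carrier_Aut_H[OF hilbert_conj_real]])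
qed

lemma unitary_group_hom_trivial:
  assumes K: "separable_cli_group K d"
    and \<Phi>: "\<Phi> \<in> hom unitary_group K" and g: "g \<in> carrier unitary_group"
  shows "\<Phi> g = \<one>\<^bsub>K\<^esub>"
proof -
  have Aut: "Aut (ell2_structure cnj) = unitary_group"
    using Aut_complex_hilbert by (simp only: complex_hilbert_def)
  have "\<Phi> \<in> hom (Aut (ell2_structure cnj)) K"
    unfolding Aut by (rule \<Phi>)
  note hom = hom_from_isometry_group.intro[OF hilbert_conj_complex K
      hom_from_isometry_group_axioms.intro[OF this]]
  have "g \<in> carrier (Aut (ell2_structure cnj))"
    unfolding Aut by (rule g)
  thus ?thesis
    by (intro hom_from_isometry_group.unitary_in_kernel[OF hom])
      (rule iffD1[OF hilbert_conj.carrier_Aut_H[OF hilbert_conj_complex]])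
qed

theorem theorem15:
  shows "(\<forall>a. set a \<subseteq> vecs real_hilbert \<longrightarrow> homogeneously_isolated real_hilbert a) \<and>
    (\<forall>a. set a \<subseteq> vecs complex_hilbert \<longrightarrow> homogeneously_isolated complex_hilbert a) \<and>
    (\<forall>(K :: 'k monoid) T.
       topological_group K T \<and> separable_space T \<and> has_complete_left_invariant_metric K T \<longrightarrow>
       (\<forall>\<Phi>\<in>hom orthogonal_group K. \<forall>g\<in>carrier orthogonal_group. \<Phi> g = \<one>\<^bsub>K\<^esub>) \<and>
       (\<forall>\<Phi>\<in>hom unitary_group K. \<forall>g\<in>carrier unitary_group. \<Phi> g = \<one>\<^bsub>K\<^esub>))"
proof (intro conjI allI impI)
  fix a :: "(nat \<Rightarrow> real) list"
  assume "set a \<subseteq> vecs real_hilbert"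
  thus "homogeneously_isolated real_hilbert a"
    using hilbert_conj.homogeneously_isolated_H[OF hilbert_conj_real, of a]
    by (simp add: real_hilbert_def hilbert_conj.H_sel[OF hilbert_conj_real])
next
  fix a :: "(nat \<Rightarrow> complex) list"
  assume "set a \<subseteq> vecs complex_hilbert"
  thus "homogeneously_isolated complex_hilbert a"
    using hilbert_conj.homogeneously_isolated_H[OF hilbert_conj_complex, of a]
    by (simp add: complex_hilbert_def hilbert_conj.H_sel[OF hilbert_conj_complex])
next
  fix K :: "'k monoid" and T
  assume "topological_group K T \<and> separable_space T \<and> has_complete_left_invariant_metric K T"
  then obtain d where K: "separable_cli_group K d"
    using separable_cli_group_of_topological_group[of K T] by metis
  show "\<forall>\<Phi>\<in>hom orthogonal_group K. \<forall>g\<in>carrier orthogonal_group. \<Phi> g = \<one>\<^bsub>K\<^esub>"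
    using orthogonal_group_hom_trivial[OF K] by blast
next
  fix K :: "'k monoid" and T
  assume "topological_group K T \<and> separable_space T \<and> has_complete_left_invariant_metric K T"
  then obtain d where K: "separable_cli_group K d"
    using separable_cli_group_of_topological_group[of K T] by metis
  show "\<forall>\<Phi>\<in>hom unitary_group K. \<forall>g\<in>carrier unitary_group. \<Phi> g = \<one>\<^bsub>K\<^esub>"
    using unitary_group_hom_trivial[OF K] by blast
qed

end
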